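(* Let $G$ be a finite group, let $g$ be an element of the center of $G$ of order $N=\prod_j p_j^{n_j}$ (prime factorization, $n_j\ge 1$), and let $h\in G$ be an $N$-regular element, i.e. $\gcd(|h|,N)=1$. Fix a prime factor $p_i$ of $N$, let $R$ be a discrete valuation ring of mixed characteristic $(0,p_i)$, and let $A$ be a finitely generated $R$-free $R[\langle g,h\rangle]$-module. Then $\hat H^*(g,A)=\hat H^0(g,A)-\hat H^1(g,A)$ is a virtual representation of $\langle h\rangle$, and $$\widetilde{\operatorname{Tr}}_{p_i}\big(h\,|\,\hat H^*(g,A)\big)=\sum_{k=1}^{N-1}a_{k,p_i}\operatorname{Tr}\big(g^kh\,|\,A\big),$$ where $$a_{k,p_i}=\begin{cases}\dfrac{1}{\sum_{d\mid N,\ (p_i,d)=1}\varphi(N/d)}\left(n_i-l-\dfrac{n_i-l-1}{p_i}\right), & \gcd(k,p_i^{n_i})=p_i^l,\ 0\le l\le n_i-1,\\[2mm] 0, & \gcd(k,p_i^{n_i})=p_i^{n_i}.\end{cases}$$ Here $\varphi$ is Euler's totient function.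
   Context: A discrete valuation ring $R$ has mixed characteristic $(0,p)$ if $R$ has characteristic $0$ and its residue field $R/\mathfrak m_R$ has characteristic $p$. Let $K=\operatorname{Frac}(R)$ and let $v:R\to\mathbb Z_{\ge0}\cup\{\infty\}$ be the surjective valuation. $R[h]$ denotes the group ring of $\langle h\rangle$. Tate cohomology: for a finite cyclic group $\langle g\rangle$ of order $N$ acting on an abelian group $A$, let $\mathrm{Nr}=\sum_{i=0}^{N-1}g^i:A\to A$. Then $\hat H^i(g,A)$ is the Tate cohomology of $\langle g\rangle$ with coefficients in $A$; it is $2$-periodic, with $\hat H^0(g,A)=\operatorname{Ker}(g-1)/\operatorname{Im}(\mathrm{Nr})$ and $\hat H^1(g,A)\cong\operatorname{Ker}(\mathrm{Nr})/\operatorname{Im}(g-1)$. $p$-Brauer character: let $M$ be a finite length $R[h]$-module, where $h$ is an element of a finite group with $p\nmid|h|$ and $R$ has mixed characteristic $(0,p)$. Take a composition series $0=M_0\subsetneq M_1\subsetneq\dots\subsetneq M_n=M$ of $R[h]$-modules, and for each $i$ an $R$-free (finite rank) $R[h]$-module $\widetilde M_i$ with $M_i/M_{i-1}\cong\widetilde M_i\otimes_{R[h]}(R/\mathfrak m_R)[h]$. Then $$\widetilde{\operatorname{Tr}}_p(h|M)=\frac1{v(p)}\sum_{i=1}^n\operatorname{Tr}(h\,|\,\widetilde M_i\otimes_R K)\in K .$$ This does not depend on the choices. Whenever $\widetilde{\operatorname{Tr}}_p$ is written, the required lifts $\widetilde M_i$ are understood to exist (this is automatic when $R$ is complete). For a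 formal difference, $\widetilde{\operatorname{Tr}}_p(h|M-M')=\widetilde{\operatorname{Tr}}_p(h|M)-\widetilde{\operatorname{Tr}}_p(h|M')$. "Virtual representation of $\langle h\rangle$" means a formal difference of finite length $R[h]$-modules. *)

theory Defs
  imports
    "HOL-Algebra.Ring_Divisibility"
    "HOL-Algebra.QuotRing"
    "HOL-Algebra.Multiplicative_Group"
    "HOL-Algebra.Generated_Groups"
    "HOL-Computational_Algebra.Polynomial_Factorial"
    "HOL-Number_Theory.Totient"
    "HOL-Library.Extended_Nat"
    "Jordan_Normal_Form.VS_Connect"
begin

text \<open>
  The discrete valuation ring \<open>R\<close> is a type \<open>'r :: idom\<close>, viewed as a HOL-Algebra ring through
  \<^const>\<open>class_ring\<close>; its fraction field \<open>K\<close> is the type \<open>'r fract\<close>.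
\<close>

section \<open>Discrete valuation rings of mixed characteristic\<close>

definition discrete_valuation_ring :: "'r::idom itself \<Rightarrow> bool" where
  "discrete_valuation_ring _ \<longleftrightarrow>
     principal_domain (class_ring :: 'r ring) \<and> \<not> field (class_ring :: 'r ring) \<and>
     (\<exists>!I. maximalideal I (class_ring :: 'r ring))"

definition max_ideal :: "'r::idom set" where
  "max_ideal = (THE I. maximalideal I class_ring)"

definition ring_char :: "('a, 'b) ring_scheme \<Rightarrow> nat" where
  "ring_char S =
     (if \<exists>n::nat. n > 0 \<and> [n] \<cdot>\<^bsub>S\<^esub> \<one>\<^bsub>S\<^esub> = \<zero>\<^bsub>S\<^esub>
      then LEAST n::nat. n > 0 \<and> [n] \<cdot>\<^bsub>S\<^esub> \<one>\<^bsub>S\<^esub> = \<zero>\<^bsub>S\<^esub> else 0)"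

definition mixed_characteristic :: "'r::idom itself \<Rightarrow> nat \<Rightarrow> bool" where
  "mixed_characteristic _ p \<longleftrightarrow>
     ring_char (class_ring :: 'r ring) = 0 \<and>
     ring_char ((class_ring :: 'r ring) Quot max_ideal) = p"

text \<open>On a discrete valuation ring there is exactly one such \<open>v\<close>.\<close>

definition surjective_valuation :: "('r::idom \<Rightarrow> enat) \<Rightarrow> bool" where
  "surjective_valuation v \<longleftrightarrow>
     (\<forall>x. v x = \<infinity> \<longleftrightarrow> x = 0) \<and>
     (\<forall>x y. v (x * y) = v x + v y) \<and>
     (\<forall>x y. min (v x) (v y) \<le> v (x + y)) \<and>
     surj v"

section \<open>Modules over group rings\<close>

text \<open>
  An \<open>R[G]\<close>-module is an \<open>R\<close>-module \<open>M\<close> together with an action \<open>\<rho>\<close> of the group \<open>G\<close> by \<open>R\<close>-linear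
  maps. Only the values of \<open>\<rho> x\<close> on the carrier of \<open>M\<close> matter, for \<open>x\<close> in the carrier of \<open>G\<close>.
\<close>

locale group_ring_module =
  fixes G :: "('g, 'b) monoid_scheme"
    and M :: "('r::idom, 'm) module"
    and \<rho> :: "'g \<Rightarrow> 'm \<Rightarrow> 'm"
  assumes group: "group G"
    and module: "Module.module class_ring M"
    and act_linear: "x \<in> carrier G \<Longrightarrow> \<rho> x \<in> module_hom class_ring M M"
    and act_one: "u \<in> carrier M \<Longrightarrow> \<rho> \<one>\<^bsub>G\<^esub> u = u"
    and act_mult: "\<lbrakk>x \<in> carrier G; y \<in> carrier G; u \<in> carrier M\<rbrakk> \<Longrightarrow>
                     \<rho> (x \<otimes>\<^bsub>G\<^esub> y) u = \<rho> x (\<rho> y u)"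

definition group_ring_submodule ::
    "('g, 'b) monoid_scheme \<Rightarrow> ('r::idom, 'm) module \<Rightarrow> ('g \<Rightarrow> 'm \<Rightarrow> 'm) \<Rightarrow> 'm set \<Rightarrow> bool" where
  "group_ring_submodule G M \<rho> N \<longleftrightarrow>
     LinearCombinations.submodule class_ring N M \<and> (\<forall>x\<in>carrier G. \<forall>u\<in>N. \<rho> x u \<in> N)"

definition group_ring_iso ::
    "('g, 'b) monoid_scheme \<Rightarrow> ('r::idom, 'm) module \<Rightarrow> ('g \<Rightarrow> 'm \<Rightarrow> 'm) \<Rightarrow>
     ('r, 'n) module \<Rightarrow> ('g \<Rightarrow> 'n \<Rightarrow> 'n) \<Rightarrow> bool" where
  "group_ring_iso G M \<rho> M' \<rho>' \<longleftrightarrow>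
     (\<exists>\<phi> \<in> module_hom class_ring M M'. bij_betw \<phi> (carrier M) (carrier M') \<and>
        (\<forall>x\<in>carrier G. \<forall>u\<in>carrier M. \<phi> (\<rho> x u) = \<rho>' x (\<phi> u)))"

text \<open>
  For a linear map \<open>f\<close> that preserves the submodule \<open>N\<close>, \<open>quot_map M N f\<close> sends the coset of \<open>u\<close> to
  the coset of \<open>f u\<close>. The fields \<open>mult\<close> and \<open>one\<close> of a module record are irrelevant.
\<close>

definition quot_map :: "('r, 'm) module \<Rightarrow> 'm set \<Rightarrow> ('m \<Rightarrow> 'm) \<Rightarrow> 'm set \<Rightarrow> 'm set" where
  "quot_map M N f X = N <+>\<^bsub>M\<^esub> (f ` X)"

definition quot_module :: "('r, 'm) module \<Rightarrow> 'm set \<Rightarrow> ('r, 'm set) module" where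
  "quot_module M N =
     \<lparr>carrier = a_rcosets\<^bsub>M\<^esub> N, mult = undefined, one = undefined,
      zero = N, add = (\<lambda>X Y. X <+>\<^bsub>M\<^esub> Y), smult = (\<lambda>a. quot_map M N (\<lambda>u. a \<odot>\<^bsub>M\<^esub> u))\<rparr>"

text \<open>\<open>subquot M P N\<close> is \<open>P / N\<close> for submodules \<open>N \<subseteq> P\<close> of \<open>M\<close>.\<close>

abbreviation subquot :: "('r, 'm) module \<Rightarrow> 'm set \<Rightarrow> 'm set \<Rightarrow> ('r, 'm set) module" where
  "subquot M P N \<equiv> quot_module (M\<lparr>carrier := P\<rparr>) N"

abbreviation quot_act ::
    "('r, 'm) module \<Rightarrow> 'm set \<Rightarrow> ('g \<Rightarrow> 'm \<Rightarrow> 'm) \<Rightarrow> 'g \<Rightarrow> 'm set \<Rightarrow> 'm set" where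
  "quot_act M N \<rho> x \<equiv> quot_map M N (\<rho> x)"

definition simple_module ::
    "('g, 'b) monoid_scheme \<Rightarrow> ('r::idom, 'm) module \<Rightarrow> ('g \<Rightarrow> 'm \<Rightarrow> 'm) \<Rightarrow> bool" where
  "simple_module G M \<rho> \<longleftrightarrow>
     group_ring_module G M \<rho> \<and> carrier M \<noteq> {\<zero>\<^bsub>M\<^esub>} \<and>
     (\<forall>N. group_ring_submodule G M \<rho> N \<longrightarrow> N = {\<zero>\<^bsub>M\<^esub>} \<or> N = carrier M)"

definition composition_series ::
    "('g, 'b) monoid_scheme \<Rightarrow> ('r::idom, 'm) module \<Rightarrow> ('g \<Rightarrow> 'm \<Rightarrow> 'm) \<Rightarrow>
     nat \<Rightarrow> (nat \<Rightarrow> 'm set) \<Rightarrow> bool" where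
  "composition_series G M \<rho> n F \<longleftrightarrow>
     F 0 = {\<zero>\<^bsub>M\<^esub>} \<and> F n = carrier M \<and>
     (\<forall>i\<le>n. group_ring_submodule G M \<rho> (F i)) \<and>
     (\<forall>i<n. F i \<subset> F (Suc i) \<and>
        simple_module G (subquot M (F (Suc i)) (F i)) (quot_act M (F i) \<rho>))"

definition finite_length ::
    "('g, 'b) monoid_scheme \<Rightarrow> ('r::idom, 'm) module \<Rightarrow> ('g \<Rightarrow> 'm \<Rightarrow> 'm) \<Rightarrow> bool" where
  "finite_length G M \<rho> \<longleftrightarrow>
     group_ring_module G M \<rho> \<and> (\<exists>n F. composition_series G M \<rho> n F)"

section \<open>Traces on free modules\<close>

definition finite_basis :: "('r::idom, 'm) module \<Rightarrow> 'm set \<Rightarrow> bool" where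
  "finite_basis M B \<longleftrightarrow>
     finite B \<and> B \<subseteq> carrier M \<and> \<not> LinearCombinations.module.lin_dep class_ring M B \<and>
     LinearCombinations.module.span class_ring M B = carrier M"

definition fg_free :: "('r::idom, 'm) module \<Rightarrow> bool" where
  "fg_free M \<longleftrightarrow> (\<exists>B. finite_basis M B)"

definition coords :: "('r::idom, 'm) module \<Rightarrow> 'm set \<Rightarrow> 'm \<Rightarrow> 'm \<Rightarrow> 'r" where
  "coords M B u = (SOME a. LinearCombinations.module.lincomb M a B = u)"

text \<open>The sum of the diagonal entries of the matrix of \<open>f\<close> with respect to some basis of \<open>M\<close>.\<close>

definition lin_trace :: "('r::idom, 'm) module \<Rightarrow> ('m \<Rightarrow> 'm) \<Rightarrow> 'r" where
  "lin_trace M f = (let B = (SOME B. finite_basis M B) in \<Sum>b\<in>B. coords M B (f b) b)"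

text \<open>
  If \<open>B\<close> is a basis of \<open>M\<close>, then \<open>b \<otimes> 1\<close> for \<open>b \<in> B\<close> is a \<open>K\<close>-basis of \<open>M \<otimes>\<^sub>R K\<close>, and the matrix of
  \<open>f \<otimes> K\<close> has the same entries as that of \<open>f\<close>; so this is the trace of \<open>f\<close> on \<open>M \<otimes>\<^sub>R K\<close>.
\<close>

definition generic_trace :: "('r::idom, 'm) module \<Rightarrow> ('m \<Rightarrow> 'm) \<Rightarrow> 'r fract" where
  "generic_trace M f = to_fract (lin_trace M f)"

section \<open>The Brauer character\<close>

text \<open>
  With \<open>\<mm>\<close> the maximal ideal, \<open>(R/\<mm>)[G] = R[G] / \<mm>R[G]\<close>, so
  \<open>M \<otimes>\<^bsub>R[G]\<^esub> (R/\<mm>)[G] = M / \<mm>M\<close>.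
\<close>

definition max_ideal_times :: "('r::idom, 'm) module \<Rightarrow> 'm set" where
  "max_ideal_times M =
     LinearCombinations.module.span class_ring M {a \<odot>\<^bsub>M\<^esub> u | a u. a \<in> max_ideal \<and> u \<in> carrier M}"

text \<open>
  Every \<open>R\<close>-free module of rank \<open>r\<close> is isomorphic to \<open>R\<^sup>r\<close>, so a lift is taken to be an
  \<open>R[G]\<close>-module structure \<open>\<sigma>\<close> on \<open>R\<^sup>r\<close>.
\<close>

abbreviation free_module :: "nat \<Rightarrow> ('r::idom, 'r vec) module" where
  "free_module r \<equiv> module_vec TYPE('r) r"

definition is_lift ::
    "('g, 'b) monoid_scheme \<Rightarrow> ('r::idom, 'm) module \<Rightarrow> ('g \<Rightarrow> 'm \<Rightarrow> 'm) \<Rightarrow>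
     nat \<Rightarrow> ('g \<Rightarrow> 'r vec \<Rightarrow> 'r vec) \<Rightarrow> bool" where
  "is_lift G M \<rho> r \<sigma> \<longleftrightarrow>
     group_ring_module G (free_module r) \<sigma> \<and>
     (let N = max_ideal_times (free_module r)
      in group_ring_iso G M \<rho> (quot_module (free_module r) N) (quot_act (free_module r) N \<sigma>))"

text \<open>
  The choices in the definition of the Brauer character: a composition series \<open>F\<close> of length \<open>n\<close>
  and, for each \<open>i < n\<close>, a lift \<open>(r i, \<sigma> i)\<close> of the factor \<open>F (i + 1) / F i\<close>.
\<close>

definition brauer_choice ::
    "('g, 'b) monoid_scheme \<Rightarrow> ('r::idom, 'm) module \<Rightarrow> ('g \<Rightarrow> 'm \<Rightarrow> 'm) \<Rightarrow>
     nat \<Rightarrow> (nat \<Rightarrow> 'm set) \<Rightarrow> (nat \<Rightarrow> nat) \<Rightarrow> (nat \<Rightarrow> 'g \<Rightarrow> 'r vec \<Rightarrow> 'r vec) \<Rightarrow> bool" where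
  "brauer_choice G M \<rho> n F r \<sigma> \<longleftrightarrow>
     composition_series G M \<rho> n F \<and>
     (\<forall>i<n. is_lift G (subquot M (F (Suc i)) (F i)) (quot_act M (F i) \<rho>) (r i) (\<sigma> i))"

definition has_lifts ::
    "('g, 'b) monoid_scheme \<Rightarrow> ('r::idom, 'm) module \<Rightarrow> ('g \<Rightarrow> 'm \<Rightarrow> 'm) \<Rightarrow> bool" where
  "has_lifts G M \<rho> \<longleftrightarrow> (\<exists>n F r \<sigma>. brauer_choice G M \<rho> n F r \<sigma>)"

text \<open>
  Here \<open>G\<close> is the group generated by \<open>h\<close>. The value is the common value of all choices, which
  makes independence of the choices part of every statement about it.
\<close>

definition brauer_trace ::
    "('r::idom \<Rightarrow> enat) \<Rightarrow> nat \<Rightarrow> ('g, 'b) monoid_scheme \<Rightarrow> 'g \<Rightarrow>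
     ('r, 'm) module \<Rightarrow> ('g \<Rightarrow> 'm \<Rightarrow> 'm) \<Rightarrow> 'r fract" where
  "brauer_trace v p G h M \<rho> =
     (THE t. \<exists>n F r \<sigma>. brauer_choice G M \<rho> n F r \<sigma> \<and>
        t = 1 / of_nat (the_enat (v (of_nat p))) *
            (\<Sum>i<n. generic_trace (free_module (r i)) (\<sigma> i h)))"

section \<open>Tate cohomology of a cyclic group\<close>

definition tate_norm ::
    "('g, 'b) monoid_scheme \<Rightarrow> 'g \<Rightarrow> ('r::idom, 'm) module \<Rightarrow> ('g \<Rightarrow> 'm \<Rightarrow> 'm) \<Rightarrow> 'm \<Rightarrow> 'm" where
  "tate_norm G g A \<rho> u = (\<Oplus>\<^bsub>A\<^esub>i\<in>{..<group.ord G g}. \<rho> (g [^]\<^bsub>G\<^esub> i) u)"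

definition tate_diff ::
    "'g \<Rightarrow> ('r::idom, 'm) module \<Rightarrow> ('g \<Rightarrow> 'm \<Rightarrow> 'm) \<Rightarrow> 'm \<Rightarrow> 'm" where
  "tate_diff g A \<rho> u = \<rho> g u \<ominus>\<^bsub>A\<^esub> u"

abbreviation map_ker :: "('r::idom, 'm) module \<Rightarrow> ('m \<Rightarrow> 'm) \<Rightarrow> 'm set" where
  "map_ker A f \<equiv> a_kernel A A f"

abbreviation map_im :: "('r::idom, 'm) module \<Rightarrow> ('m \<Rightarrow> 'm) \<Rightarrow> 'm set" where
  "map_im A f \<equiv> f ` carrier A"

definition tate_H0 ::
    "('g, 'b) monoid_scheme \<Rightarrow> 'g \<Rightarrow> ('r::idom, 'm) module \<Rightarrow> ('g \<Rightarrow> 'm \<Rightarrow> 'm) \<Rightarrow>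
     ('r, 'm set) module" where
  "tate_H0 G g A \<rho> = subquot A (map_ker A (tate_diff g A \<rho>)) (map_im A (tate_norm G g A \<rho>))"

definition tate_H1 ::
    "('g, 'b) monoid_scheme \<Rightarrow> 'g \<Rightarrow> ('r::idom, 'm) module \<Rightarrow> ('g \<Rightarrow> 'm \<Rightarrow> 'm) \<Rightarrow>
     ('r, 'm set) module" where
  "tate_H1 G g A \<rho> = subquot A (map_ker A (tate_norm G g A \<rho>)) (map_im A (tate_diff g A \<rho>))"

definition tate_H0_act ::
    "('g, 'b) monoid_scheme \<Rightarrow> 'g \<Rightarrow> ('r::idom, 'm) module \<Rightarrow> ('g \<Rightarrow> 'm \<Rightarrow> 'm) \<Rightarrow>
     'g \<Rightarrow> 'm set \<Rightarrow> 'm set" where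
  "tate_H0_act G g A \<rho> = quot_act A (map_im A (tate_norm G g A \<rho>)) \<rho>"

definition tate_H1_act ::
    "('g, 'b) monoid_scheme \<Rightarrow> 'g \<Rightarrow> ('r::idom, 'm) module \<Rightarrow> ('g \<Rightarrow> 'm \<Rightarrow> 'm) \<Rightarrow>
     'g \<Rightarrow> 'm set \<Rightarrow> 'm set" where
  "tate_H1_act G g A \<rho> = quot_act A (map_im A (tate_diff g A \<rho>)) \<rho>"

section \<open>The coefficients\<close>

definition tate_coeff :: "nat \<Rightarrow> nat \<Rightarrow> nat \<Rightarrow> 'k::field" where
  "tate_coeff N p k =
     (let n = multiplicity p N; l = multiplicity p (gcd k (p ^ n)) in
      if gcd k (p ^ n) = p ^ n then 0
      else 1 / (\<Sum>d | d dvd N \<and> coprime p d. of_nat (totient (N div d))) *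
           (of_nat n - of_nat l - (of_nat n - of_nat l - 1) / of_nat p))"

end

theory Submission
  imports Defs "HOL-Library.Set_Algebras" "Jordan_Normal_Form.Char_Poly"
begin

text \<open>
  Over a discrete valuation ring \<open>R\<close> with uniformizer \<open>\<pi>\<close>, the order \<open>m\<close> of \<open>h\<close> is a unit, so
  the monic factorization \<open>x\<^sup>m - 1 = \<Prod>\<^sub>i f\<^sub>i\<close> over the fraction field lifts to idempotents of
  \<open>R[h]\<close>. On a lattice \<open>C\<close> killed by \<open>f\<^sub>i(h)\<close> the trace of \<open>h\<close> is \<open>\<kappa>\<^sub>i rk C\<close>, and
  \<open>rk C\<close> is the length of \<open>C / \<pi>C\<close>; hence the Brauer character of a finite length module \<open>M\<close> is
  the sum over \<open>i\<close> of \<open>\<kappa>\<^sub>i\<close> times the length of the \<open>i\<close>-th component of \<open>M\<close>, divided by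
  \<open>e = v(p)\<close>.

  It remains to compute, for each component \<open>C\<close> of \<open>A\<close>, the difference of the lengths of the two
  Tate groups of \<open>g\<close>. With \<open>F\<^sub>l\<close> the kernel of \<open>g\<close> to the power \<open>p\<^sup>l\<close> minus \<open>1\<close>, this Herbrand
  quotient is \<open>n e rk F\<^sub>0\<close> minus the lengths of the cokernels of \<open>g - 1\<close> on the layers
  \<open>F\<^sub>l\<^sub>+\<^sub>1 / F\<^sub>l\<close>. On such a layer \<open>g - 1\<close> raised to the power \<open>\<phi>(p\<^sup>l\<^sup>+\<^sup>1)\<close> agrees with \<open>p\<close>
  up to an automorphism, so its cokernel has length \<open>e (rk F\<^sub>l\<^sub>+\<^sub>1 - rk F\<^sub>l) / \<phi>(p\<^sup>l\<^sup>+\<^sup>1)\<close>. On the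
  other side, the sum of \<open>Tr(g\<^sup>k h)\<close> over the multiples \<open>k\<close> of \<open>p\<^sup>l\<close> is \<open>N / p\<^sup>l\<close> times the trace
  of \<open>h\<close> on \<open>F\<^sub>l\<close>, and both sides agree by telescoping.
\<close>

section \<open>Lengths in the lattice of submodules\<close>

text \<open>All lengths are taken over R, not over R[h]. The \<open>f i\<close> are irreducible only
  over the fraction field and may split modulo the uniformizer, so composition factors are never
  matched with simple modules; only the components cut out by the idempotents are measured. The
  obstacle is that quotients change the carrier type and that finiteness is unknown at first. Hence
  every module is presented by a pair \<open>Q \<subseteq> P\<close> of submodules of one polynomial
  module, isomorphic subquotients are compared through relations, and lengths live in
  \<open>enat\<close>. Origin of the coefficients: let \<open>x_l\<close> be the rank of
  \<open>F_l\<close> on one component and \<open>N'\<close> the part of N prime to p. The weights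
  \<open>c_l\<close> in the sum of \<open>c_l (p^(n-l) N' x_l - p^(n-l-1) N' x_(l+1))\<close> are
  forced by comparison with \<open>n x_0\<close> minus the sum of
  \<open>(x_(l+1) - x_l) / \<phi>(p^(l+1))\<close>: the coefficient of \<open>x_n\<close> gives
  \<open>c_(n-1) = 1 / (\<phi>(p^n) N')\<close>, and descending through the other \<open>x_l\<close>
  gives the remaining weights.\<close>

locale module_lengths = Modules.module scale
  for scale :: "'a::comm_ring_1 \<Rightarrow> 'b::ab_group_add \<Rightarrow> 'b"  (infixr \<open>*s\<close> 75)
begin

text \<open>The base case asks only for \<open>Q \<subseteq> P\<close>, so a chain may begin with an
  uncounted gap. This makes the notion monotone in the upper end and downward closed in the number
  of steps.\<close>

inductive strict_chain :: "nat \<Rightarrow> 'b set \<Rightarrow> 'b set \<Rightarrow> bool" where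
  strict_chain_0: "subspace Q \<Longrightarrow> subspace P \<Longrightarrow> Q \<subseteq> P \<Longrightarrow> strict_chain 0 Q P"
| strict_chain_Suc: "strict_chain n Q U \<Longrightarrow> U \<subset> P \<Longrightarrow> subspace P \<Longrightarrow> strict_chain (Suc n) Q P"

definition len :: "'b set \<Rightarrow> 'b set \<Rightarrow> enat" where
  "len Q P = Sup {enat n | n. strict_chain n Q P}"

lemma strict_chain_imp: "strict_chain n Q P \<Longrightarrow> subspace Q \<and> subspace P \<and> Q \<subseteq> P"
  by (induction rule: strict_chain.induct) auto

lemma strict_chain_mono: "strict_chain n Q U \<Longrightarrow> U \<subseteq> P \<Longrightarrow> subspace P \<Longrightarrow> strict_chain n Q P"
proof (induction arbitrary: P rule: strict_chain.induct)
  case (strict_chain_0 Q P)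
  then show ?case by (intro strict_chain.intros) auto
next
  case (strict_chain_Suc n Q U P P')
  then show ?case by (intro strict_chain.strict_chain_Suc[of n Q U P']) auto
qed

lemma strict_chain_antimono: "strict_chain n Q P \<Longrightarrow> m \<le> n \<Longrightarrow> strict_chain m Q P"
proof (induction arbitrary: m rule: strict_chain.induct)
  case (strict_chain_0 Q P)
  then show ?case by (auto intro: strict_chain.intros)
next
  case (strict_chain_Suc n Q U P m)
  show ?case
  proof (cases "m = Suc n")
    case True
    then show ?thesis using strict_chain_Suc by (auto intro: strict_chain.intros)
  next
    case False
    then have "strict_chain m Q U" using strict_chain_Suc by auto
    then show ?thesis by (rule strict_chain_mono) (use strict_chain_Suc in auto)
  qed
qed

text \<open>A supremum of naturals that is at least \<open>k\<close> is witnessed by a member at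
  least \<open>k\<close>, and long chains yield shorter ones. With \<open>enat_eqI\<close> and
  \<open>enat_le_add_iff\<close> this turns equations between possibly infinite lengths into
  statements about finite chains.\<close>

lemma enat_le_len_iff:
  assumes "subspace Q" "subspace P" "Q \<subseteq> P"
  shows "enat k \<le> len Q P \<longleftrightarrow> strict_chain k Q P"
proof
  assume "strict_chain k Q P"
  then show "enat k \<le> len Q P" unfolding len_def by (intro Sup_upper) auto
next
  assume le: "enat k \<le> len Q P"
  show "strict_chain k Q P"
  proof (rule ccontr)
    assume no: "\<not> strict_chain k Q P"
    have k0: "k \<noteq> 0" using no strict_chain_0[OF assms] by metis
    have "len Q P \<le> enat (k - 1)"
      unfolding len_def
    proof (rule Sup_least)
      fix x assume "x \<in> {enat n | n. strict_chain n Q P}"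
      then obtain n where n: "x = enat n" "strict_chain n Q P" by auto
      have "n < k" using no n(2) strict_chain_antimono[of n Q P k] by (meson not_less)
      then show "x \<le> enat (k - 1)" using n(1) by auto
    qed
    then have "enat k \<le> enat (k - 1)" using le by (rule order_trans[rotated])
    then show False using k0 by simp
  qed
qed

lemma enat_eqI:
  assumes "\<And>k. enat k \<le> a \<longleftrightarrow> enat k \<le> b"
  shows "a = b"
proof (rule antisym)
  have *: "x \<le> y" if "\<And>k. enat k \<le> x \<Longrightarrow> enat k \<le> y" for x y :: enat
  proof (cases x)
    case (enat n)
    then show ?thesis using that by simp
  next
    case infinity
    then have "enat k \<le> y" for k using that by simp
    then have "y = \<infinity>" by (metis Suc_ile_eq enat.exhaust less_irrefl)
    then show ?thesis by simp
  qed
  show "a \<le> b" "b \<le> a" using assms by (auto intro: *)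
qed

lemma enat_le_add_iff: "enat k \<le> a + b \<longleftrightarrow> (\<exists>i j. k = i + j \<and> enat i \<le> a \<and> enat j \<le> b)"
proof
  assume le: "enat k \<le> a + b"
  show "\<exists>i j. k = i + j \<and> enat i \<le> a \<and> enat j \<le> b"
  proof (cases a)
    case (enat m)
    show ?thesis
    proof (cases b)
      case (enat n)
      then show ?thesis using le \<open>a = enat m\<close>
        by (intro exI[of _ "min k m"] exI[of _ "k - min k m"]) auto
    next
      case infinity
      then show ?thesis by (intro exI[of _ 0] exI[of _ k]) (auto simp: zero_enat_def[symmetric])
    qed
  next
    case infinity
    then show ?thesis by (intro exI[of _ k] exI[of _ 0]) (auto simp: zero_enat_def[symmetric])
  qed
next
  assume "\<exists>i j. k = i + j \<and> enat i \<le> a \<and> enat j \<le> b"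
  then show "enat k \<le> a + b" by (metis add_mono plus_enat_simps(1))
qed

lemma subspace_plus:
  assumes "subspace X" "subspace Y"
  shows "subspace (X + Y)"
proof (rule subspaceI)
  show "0 \<in> X + Y" using set_plus_intro[OF assms[THEN subspace_0]] by simp
next
  fix u v assume "u \<in> X + Y" "v \<in> X + Y"
  then obtain x y x' y' where "u = x + y" "v = x' + y'" "x \<in> X" "y \<in> Y" "x' \<in> X" "y' \<in> Y"
    by (auto simp: set_plus_def)
  then have "u + v = (x + x') + (y + y')" "x + x' \<in> X" "y + y' \<in> Y"
    using assms by (auto simp: ac_simps subspace_add)
  then show "u + v \<in> X + Y" by auto
next
  fix c u assume "u \<in> X + Y"
  then obtain x y where "u = x + y" "x \<in> X" "y \<in> Y" by (auto simp: set_plus_def)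
  then have "c *s u = c *s x + c *s y" "c *s x \<in> X" "c *s y \<in> Y"
    using assms by (auto simp: scale_right_distrib subspace_scale)
  then show "c *s u \<in> X + Y" by auto
qed

lemma plus_least: "subspace Z \<Longrightarrow> X \<subseteq> Z \<Longrightarrow> Y \<subseteq> Z \<Longrightarrow> X + Y \<subseteq> Z"
  by (auto simp: set_plus_def intro: subspace_add)

lemma plus_upper1: "subspace Y \<Longrightarrow> X \<subseteq> X + Y"
  by (metis add.right_neutral set_plus_intro subspace_0 subsetI)

lemma plus_upper2: "subspace X \<Longrightarrow> Y \<subseteq> X + Y"
  by (metis add.commute plus_upper1)

lemma plus_absorb: "subspace X \<Longrightarrow> subspace Y \<Longrightarrow> X \<subseteq> Y \<Longrightarrow> X + Y = Y"
  by (meson plus_least plus_upper2 subset_antisym subset_refl)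

text \<open>Modular law: if the sums agree, \<open>x\<close> in \<open>V\<close> is
  \<open>u + q\<close> with \<open>q = x - u\<close> in \<open>V \<inter> P\<close>; if the
  intersections agree as well, \<open>q\<close> and hence \<open>x\<close> lie in
  \<open>U\<close>.\<close>

lemma modular_strict:
  assumes "subspace U" "subspace V" "subspace P" "U \<subset> V"
  shows "U \<inter> P \<subset> V \<inter> P \<or> U + P \<subset> V + P"
proof (rule ccontr)
  assume neg: "\<not> ?thesis"
  have "U \<inter> P = V \<inter> P" "U + P = V + P"
    using neg assms(4) set_plus_mono2[of U V P P] by auto
  moreover obtain x where x: "x \<in> V" "x \<notin> U" using assms(4) by auto
  moreover have "x \<in> V + P" using x(1) plus_upper1[OF assms(3), of V] by auto
  ultimately have "x \<in> U + P" by simp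
  then obtain u q where u: "u \<in> U" "q \<in> P" "x = u + q" by (rule set_plus_elim)
  then have "q = x - u" by simp
  then have "q \<in> V" using x(1) u(1) assms by (auto intro: subspace_diff)
  then have "q \<in> U" using u(2) \<open>U \<inter> P = V \<inter> P\<close> by auto
  then show False using u x(2) assms by (auto intro: subspace_add)
qed

lemma strict_chain_append:
  "strict_chain n P S \<Longrightarrow> strict_chain m Q P \<Longrightarrow> strict_chain (m + n) Q S"
proof (induction rule: strict_chain.induct)
  case (strict_chain_0 Q P)
  then show ?case by (auto intro: strict_chain_mono)
next
  case (strict_chain_Suc n Q U P)
  then show ?case by (auto intro: strict_chain.intros)
qed

text \<open>By \<open>modular_strict\<close> each strict step survives in the intersection with
  \<open>P\<close> or in the sum with \<open>P\<close>, possibly in both. Hence only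
  \<open>n \<le> a + b\<close>; \<open>strict_chain_antimono\<close> trims the excess in
  \<open>len_add\<close>.\<close>

lemma strict_chain_split:
  "strict_chain n Q S \<Longrightarrow> subspace P \<Longrightarrow> Q \<subseteq> P \<Longrightarrow>
    \<exists>a b. n \<le> a + b \<and> strict_chain a Q (S \<inter> P) \<and> strict_chain b P (S + P)"
proof (induction rule: strict_chain.induct)
  case (strict_chain_0 Q S)
  have "strict_chain 0 Q (S \<inter> P)" "strict_chain 0 P (S + P)"
    using strict_chain_0 by (auto intro!: strict_chain.intros subspace_inter subspace_plus plus_upper2[THEN subsetD])
  then show ?case by blast
next
  case (strict_chain_Suc n Q U S)
  then obtain a b where ab: "n \<le> a + b" "strict_chain a Q (U \<inter> P)" "strict_chain b P (U + P)"
    by auto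
  have ss: "subspace U" "subspace S" "subspace P" using strict_chain_Suc strict_chain_imp by auto
  have sub: "U \<inter> P \<subseteq> S \<inter> P" "U + P \<subseteq> S + P"
    using strict_chain_Suc.hyps by (auto intro: set_plus_mono2[THEN subsetD])
  have s2: "subspace (S \<inter> P)" "subspace (S + P)" using ss by (auto intro: subspace_inter subspace_plus)
  have m: "strict_chain a Q (S \<inter> P)" "strict_chain b P (S + P)"
    using strict_chain_mono[OF ab(2) sub(1) s2(1)] strict_chain_mono[OF ab(3) sub(2) s2(2)] by auto
  from modular_strict[OF ss(1,2,3)] strict_chain_Suc.hyps(2)
  consider "U \<inter> P \<subset> S \<inter> P" | "U + P \<subset> S + P" by auto
  then show ?case
  proof cases
    case 1
    have "strict_chain (Suc a) Q (S \<inter> P)" using strict_chain.strict_chain_Suc[OF ab(2) 1 s2(1)] .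
    then show ?thesis using m ab(1) by (intro exI[of _ "Suc a"] exI[of _ b]) auto
  next
    case 2
    have "strict_chain (Suc b) P (S + P)" using strict_chain.strict_chain_Suc[OF ab(3) 2 s2(2)] .
    then show ?thesis using m ab(1) by (intro exI[of _ a] exI[of _ "Suc b"]) auto
  qed
qed

lemma len_add:
  assumes "subspace Q" "subspace P" "subspace S" "Q \<subseteq> P" "P \<subseteq> S"
  shows "len Q S = len Q P + len P S"
proof (rule enat_eqI)
  fix k
  have QS: "Q \<subseteq> S" using assms by auto
  have [simp]: "S \<inter> P = P" "S + P = S" using assms plus_absorb[of P S] by (auto simp: add.commute)
  show "enat k \<le> len Q S \<longleftrightarrow> enat k \<le> len Q P + len P S"
    unfolding enat_le_add_iff enat_le_len_iff[OF assms(1,3) QS] enat_le_len_iff[OF assms(1,2,4)]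
      enat_le_len_iff[OF assms(2,3,5)]
  proof
    assume "strict_chain k Q S"
    from strict_chain_split[OF this assms(2,4)] obtain a b where
      "k \<le> a + b" "strict_chain a Q P" "strict_chain b P S" by auto
    then show "\<exists>i j. k = i + j \<and> strict_chain i Q P \<and> strict_chain j P S"
      by (intro exI[of _ "min k a"] exI[of _ "k - min k a"]) (auto intro: strict_chain_antimono)
  next
    assume "\<exists>i j. k = i + j \<and> strict_chain i Q P \<and> strict_chain j P S"
    then show "strict_chain k Q S" using strict_chain_append by blast
  qed
qed

lemma strict_chain_pos: "strict_chain n Q P \<Longrightarrow> n \<noteq> 0 \<Longrightarrow> Q \<subset> P"
proof (induction rule: strict_chain.induct)
  case (strict_chain_Suc n Q U P)
  then show ?case using strict_chain_imp[of n Q U] by auto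
qed simp

lemma len_self [simp]: "len Q Q = 0"
proof -
  have "len Q Q \<le> 0"
    unfolding len_def
  proof (rule Sup_least)
    fix x assume "x \<in> {enat n | n. strict_chain n Q Q}"
    then show "x \<le> 0" using strict_chain_pos[of _ Q Q] by (auto simp: zero_enat_def)
  qed
  then show ?thesis by simp
qed

lemma len_pos:
  assumes "subspace Q" "subspace P" "Q \<subset> P"
  shows "1 \<le> len Q P"
proof -
  have "strict_chain (Suc 0) Q P"
    using strict_chain_Suc[OF strict_chain_0[OF assms(1) assms(1) subset_refl] assms(3,2)] .
  then have "enat (Suc 0) \<le> len Q P" using enat_le_len_iff assms by blast
  then show ?thesis by (simp add: one_enat_def)
qed

lemma len_mono2: "subspace Q \<Longrightarrow> subspace P \<Longrightarrow> subspace S \<Longrightarrow> Q \<subseteq> P \<Longrightarrow> P \<subseteq> S \<Longrightarrow> len Q P \<le> len Q S"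
  by (subst len_add[of Q P S]) auto

lemma len_eq_1:
  assumes "subspace Q" "subspace P" "Q \<subset> P"
    "\<And>U. subspace U \<Longrightarrow> Q \<subseteq> U \<Longrightarrow> U \<subseteq> P \<Longrightarrow> U = Q \<or> U = P"
  shows "len Q P = 1"
proof (rule antisym)
  show "1 \<le> len Q P" by (rule len_pos[OF assms(1-3)])
  have "\<not> enat 2 \<le> len Q P"
  proof
    assume "enat 2 \<le> len Q P"
    then have "strict_chain (Suc (Suc 0)) Q P"
      using enat_le_len_iff[of Q P 2] assms(1-3) by (simp add: numeral_2_eq_2 psubset_imp_subset)
    then obtain U where U: "strict_chain (Suc 0) Q U" "U \<subset> P" by (cases rule: strict_chain.cases) auto
    have "Q \<subset> U" using strict_chain_pos[OF U(1)] by simp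
    then show False using assms(4)[of U] U(2) strict_chain_imp[OF U(1)] by auto
  qed
  then show "len Q P \<le> 1" unfolding one_enat_def
    by (cases "len Q P") auto
qed

section \<open>Linear operators, correspondences and lengths of cokernels\<close>

definition linear_op :: "('b \<Rightarrow> 'b) \<Rightarrow> bool" where
  "linear_op T \<longleftrightarrow> (\<forall>x y. T (x + y) = T x + T y) \<and> (\<forall>c x. T (c *s x) = c *s T x)"

lemma
  assumes "linear_op T"
  shows linear_op_add: "T (x + y) = T x + T y" and linear_op_scale: "T (c *s x) = c *s T x"
    and linear_op_0: "T 0 = 0"
    and linear_op_diff: "T (x - y) = T x - T y"
proof -
  show a: "T (x + y) = T x + T y" for x y using assms by (auto simp: linear_op_def)
  show "T (c *s x) = c *s T x" for c x using assms by (auto simp: linear_op_def)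
  show z: "T 0 = 0" using a[of 0 0] by simp
  have m: "T (- x) = - T x" for x
  proof -
    have "T x + T (- x) = 0" using a[of x "- x"] z by simp
    then show ?thesis by (rule minus_unique[symmetric])
  qed
  show "T (x - y) = T x - T y" using a[of x "- y"] m by simp
qed

lemma linear_op_sum: "linear_op T \<Longrightarrow> T (\<Sum>i\<in>I. f i) = (\<Sum>i\<in>I. T (f i))"
  by (induct I rule: infinite_finite_induct) (simp_all add: linear_op_add linear_op_0)

lemma subspace_linear_image:
  assumes "linear_op T" "subspace X"
  shows "subspace (T ` X)"
proof (rule subspaceI)
  have "T 0 \<in> T ` X" using subspace_0[OF assms(2)] by simp
  then show "0 \<in> T ` X" by (simp add: linear_op_0[OF assms(1)])
next
  fix y y' assume "y \<in> T ` X" "y' \<in> T ` X"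
  then obtain x x' where "y = T x" "y' = T x'" "x \<in> X" "x' \<in> X" by auto
  then have "y + y' = T (x + x')" "x + x' \<in> X"
    by (simp_all add: linear_op_add[OF assms(1)] subspace_add[OF assms(2)])
  then show "y + y' \<in> T ` X" by simp
next
  fix c y assume "y \<in> T ` X"
  then obtain x where "y = T x" "x \<in> X" by auto
  then have "c *s y = T (c *s x)" "c *s x \<in> X"
    by (simp_all add: linear_op_scale[OF assms(1)] subspace_scale[OF assms(2)])
  then show "c *s y \<in> T ` X" by simp
qed

lemma linear_image_plus:
  assumes "linear_op T"
  shows "T ` (X + Y) = T ` X + T ` Y"
proof -
  have "T ` (X + Y) \<subseteq> T ` X + T ` Y"
    using linear_op_add[OF assms] by (auto simp: set_plus_def)
  moreover have "T ` X + T ` Y \<subseteq> T ` (X + Y)"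
  proof
    fix z assume "z \<in> T ` X + T ` Y"
    then obtain x y where "x \<in> X" "y \<in> Y" "z = T (x + y)"
      using linear_op_add[OF assms] by (auto simp: set_plus_def)
    then show "z \<in> T ` (X + Y)" by auto
  qed
  ultimately show ?thesis by auto
qed

text \<open>
  A submodule \<open>R\<close> of a product identifies subquotients of its two projections (Goursat); this
  transports lengths along isomorphisms of subquotients without forming quotients.
\<close>

definition correspondence :: "('b \<times> 'b) set \<Rightarrow> bool" where
  "correspondence R \<longleftrightarrow> (0, 0) \<in> R \<and>
     (\<forall>x y x' y'. (x, y) \<in> R \<longrightarrow> (x', y') \<in> R \<longrightarrow> (x + x', y + y') \<in> R) \<and>
     (\<forall>c x y. (x, y) \<in> R \<longrightarrow> (c *s x, c *s y) \<in> R)"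

lemma
  assumes "correspondence R"
  shows corr_0: "(0, 0) \<in> R" and corr_add: "(x, y) \<in> R \<Longrightarrow> (x', y') \<in> R \<Longrightarrow> (x + x', y + y') \<in> R"
    and corr_scale: "(x, y) \<in> R \<Longrightarrow> (c *s x, c *s y) \<in> R"
  using assms by (auto simp: correspondence_def)

lemma corr_diff:
  assumes "correspondence R" "(x, y) \<in> R" "(x', y') \<in> R"
  shows "(x - x', y - y') \<in> R"
  using corr_add[OF assms(1,2) corr_scale[OF assms(1,3), of "-1"]] by simp

lemma corr_converse: "correspondence R \<Longrightarrow> correspondence (R\<inverse>)"
  by (auto simp: correspondence_def)

lemma subspace_Image:
  assumes "correspondence R" "subspace X"
  shows "subspace (R `` X)"
proof (rule subspaceI)
  show "0 \<in> R `` X" using corr_0[OF assms(1)] subspace_0[OF assms(2)] by blast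
next
  fix y y' assume "y \<in> R `` X" "y' \<in> R `` X"
  then show "y + y' \<in> R `` X"
    using corr_add[OF assms(1)] subspace_add[OF assms(2)] by (meson Image_iff)
next
  fix c y assume "y \<in> R `` X"
  then show "c *s y \<in> R `` X"
    using corr_scale[OF assms(1)] subspace_scale[OF assms(2)] by (meson Image_iff)
qed

lemma corr_Image_Image:
  assumes "correspondence R" "subspace X" "X \<subseteq> Domain R" "{x. (x, 0) \<in> R} \<subseteq> X"
  shows "R\<inverse> `` (R `` X) = X"
proof
  show "R\<inverse> `` (R `` X) \<subseteq> X"
  proof
    fix x assume "x \<in> R\<inverse> `` (R `` X)"
    then obtain u y where u: "(x, y) \<in> R" "(u, y) \<in> R" "u \<in> X" by auto
    from corr_diff[OF assms(1) u(1,2)] have "x - u \<in> X" using assms(4) by auto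
    from subspace_add[OF assms(2) this u(3)] show "x \<in> X" by simp
  qed
  show "X \<subseteq> R\<inverse> `` (R `` X)" using assms(3) by (meson Domain_iff ImageI converseI subset_iff)
qed

text \<open>Strictness survives because \<open>corr_Image_Image\<close> recovers a submodule above
  the kernel from its image.\<close>

lemma strict_chain_Image:
  assumes "correspondence R" "{x. (x, 0) \<in> R} \<subseteq> X"
    "strict_chain n X Y" "Y \<subseteq> Domain R"
  shows "strict_chain n (R `` X) (R `` Y)"
  using assms(3,2,4)
proof (induction rule: strict_chain.induct)
  case (strict_chain_0 Q P)
  then show ?case using assms(1) by (auto intro!: strict_chain.intros subspace_Image)
next
  case (strict_chain_Suc n Q U P)
  have U: "subspace U" "Q \<subseteq> U" using strict_chain_imp[OF strict_chain_Suc.hyps(1)] by auto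
  have P: "subspace P" "P \<subseteq> Domain R" "U \<subseteq> P" using strict_chain_Suc by auto
  have QU: "{x. (x, 0) \<in> R} \<subseteq> U" using strict_chain_Suc.prems(1) U(2) by (rule subset_trans)
  have "R\<inverse> `` (R `` U) = U"
    by (rule corr_Image_Image[OF assms(1) U(1) subset_trans[OF P(3,2)] QU])
  moreover have "R\<inverse> `` (R `` P) = P"
    by (rule corr_Image_Image[OF assms(1) P(1,2) subset_trans[OF QU P(3)]])
  ultimately have UP: "U = P" if "R `` U = R `` P" using that by metis
  have "R `` U \<noteq> R `` P" using strict_chain_Suc.hyps(2) UP by auto
  then have "R `` U \<subset> R `` P" using strict_chain_Suc.hyps(2) by auto
  then show ?case using strict_chain_Suc assms(1)
    by (intro strict_chain.strict_chain_Suc[of n _ "R `` U"]) (auto intro: subspace_Image)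
qed

text \<open>The converse relation again satisfies the hypotheses of
  \<open>strict_chain_Image\<close>: its kernel lies in the image of \<open>X\<close> because 0 lies
  in \<open>X\<close>. So chains travel in both directions.\<close>

lemma len_Image:
  assumes R: "correspondence R" and "subspace X" "subspace Y" "X \<subseteq> Y" "Y \<subseteq> Domain R"
    and K: "{x. (x, 0) \<in> R} \<subseteq> X"
  shows "len (R `` X) (R `` Y) = len X Y"
proof (rule enat_eqI)
  fix k
  have "strict_chain k X Y" if "strict_chain k (R `` X) (R `` Y)"
  proof -
    have "strict_chain k (R\<inverse> `` (R `` X)) (R\<inverse> `` (R `` Y))"
      using that subspace_0[OF assms(2)]
      by (intro strict_chain_Image[OF corr_converse[OF R] _ that]) auto
    moreover have "R\<inverse> `` (R `` X) = X" "R\<inverse> `` (R `` Y) = Y"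
      by (rule corr_Image_Image[OF R]; use assms in blast)+
    ultimately show ?thesis by simp
  qed
  moreover have "strict_chain k (R `` X) (R `` Y)" if "strict_chain k X Y"
    using strict_chain_Image[OF R K that assms(5)] .
  moreover have "R `` X \<subseteq> R `` Y" using assms(4) by auto
  ultimately show "enat k \<le> len (R `` X) (R `` Y) \<longleftrightarrow> enat k \<le> len X Y"
    using assms by (subst (1 2) enat_le_len_iff) (auto intro: subspace_Image)
qed

text \<open>Second isomorphism theorem, read off the relation that sends \<open>y\<close> to its
  whole class \<open>y + X\<close>; its kernel is \<open>X \<inter> Y\<close>.\<close>

lemma len_plus:
  assumes "subspace X" "subspace Y"
  shows "len X (X + Y) = len (X \<inter> Y) Y"
proof -
  define R where "R = {(y, x + y) | x y. x \<in> X \<and> y \<in> Y}"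
  have R: "correspondence R"
    unfolding correspondence_def
  proof (intro conjI allI impI)
    show "(0, 0) \<in> R" using assms by (auto simp: R_def subspace_0 intro: exI[of _ 0])
  next
    fix x y x' y' assume "(x, y) \<in> R" "(x', y') \<in> R"
    then obtain a a' where a: "y = a + x" "y' = a' + x'" "a \<in> X" "a' \<in> X" "x \<in> Y" "x' \<in> Y"
      by (auto simp: R_def)
    have "y + y' = (a + a') + (x + x')" using a by (simp add: ac_simps)
    then show "(x + x', y + y') \<in> R" using a assms
      by (auto simp: R_def intro: subspace_add)
  next
    fix c x y assume "(x, y) \<in> R"
    then show "(c *s x, c *s y) \<in> R"
      using assms by (auto simp: R_def scale_right_distrib intro: subspace_scale)
  qed
  have "R `` (X \<inter> Y) = X"
  proof
    show "R `` (X \<inter> Y) \<subseteq> X" using assms by (auto simp: R_def intro: subspace_add)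
    show "X \<subseteq> R `` (X \<inter> Y)"
    proof
      fix x assume "x \<in> X"
      then have "(0, x) \<in> R" using subspace_0[OF assms(2)] unfolding R_def by force
      then show "x \<in> R `` (X \<inter> Y)" using assms by (auto simp: subspace_0)
    qed
  qed
  moreover have "R `` Y = X + Y" by (auto simp: R_def set_plus_def)
  moreover have "{x. (x, 0) \<in> R} \<subseteq> X \<inter> Y"
    using assms by (auto simp: R_def) (metis add_eq_0_iff subspace_neg)
  moreover have "Y \<subseteq> Domain R" using subspace_0[OF assms(1)] by (force simp: R_def)
  ultimately show ?thesis
    using len_Image[OF R, of "X \<inter> Y" Y] assms by (auto simp: subspace_inter)
qed

text \<open>The relation is the graph of \<open>T\<close> on \<open>W\<close> thickened by
  \<open>Y\<close>. Its kernel, the preimage of \<open>Y\<close>, lies in \<open>K\<close> by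
  \<open>inj\<close> and hence in both submodules to be compared.\<close>

lemma len_linear_image:
  assumes T: "linear_op T" and s: "subspace Y" "subspace W" "subspace U" "subspace V"
    and inj: "\<And>x. x \<in> W \<Longrightarrow> T x \<in> Y \<Longrightarrow> x \<in> K" and "K \<subseteq> U" "U \<subseteq> V" "V \<subseteq> W"
  shows "len (T ` U + Y) (T ` V + Y) = len U V"
proof -
  define R where "R = {(x, T x + y) | x y. x \<in> W \<and> y \<in> Y}"
  have R: "correspondence R"
    unfolding correspondence_def
  proof (intro conjI allI impI)
    show "(0, 0) \<in> R" unfolding R_def using s linear_op_0[OF T]
      by (auto simp: subspace_0 intro!: exI[of _ 0])
  next
    fix x y x' y' assume "(x, y) \<in> R" "(x', y') \<in> R"
    then obtain a a' where a: "y = T x + a" "y' = T x' + a'" "a \<in> Y" "a' \<in> Y" "x \<in> W" "x' \<in> W"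
      by (auto simp: R_def)
    have "y + y' = T (x + x') + (a + a')" using a by (simp add: ac_simps linear_op_add[OF T])
    moreover have "x + x' \<in> W" "a + a' \<in> Y" using a s by (auto intro: subspace_add)
    ultimately show "(x + x', y + y') \<in> R" unfolding R_def by blast
  next
    fix c x y assume "(x, y) \<in> R"
    then obtain a where a: "y = T x + a" "a \<in> Y" "x \<in> W" by (auto simp: R_def)
    have "c *s y = T (c *s x) + c *s a" using a by (simp add: scale_right_distrib linear_op_scale[OF T])
    moreover have "c *s x \<in> W" "c *s a \<in> Y" using a s by (auto intro: subspace_scale)
    ultimately show "(c *s x, c *s y) \<in> R" unfolding R_def by blast
  qed
  have im: "R `` Z = T ` Z + Y" if "Z \<subseteq> W" for Z using that by (auto simp: R_def set_plus_def)
  have "{x. (x, 0) \<in> R} \<subseteq> U"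
  proof
    fix x assume "x \<in> {x. (x, 0) \<in> R}"
    then obtain y where y: "T x + y = 0" "x \<in> W" "y \<in> Y" by (auto simp: R_def)
    then have "T x = - y" by (simp add: add_eq_0_iff2)
    then have "T x \<in> Y" using y s by (simp add: subspace_neg)
    then show "x \<in> U" using inj y assms by auto
  qed
  moreover have "V \<subseteq> Domain R" using subspace_0[OF s(1)] assms by (force simp: R_def)
  ultimately show ?thesis
    using len_Image[OF R, of U V] s im assms by auto
qed

text \<open>Below, \<open>len (T ` W + Y) W\<close> is the length of the cokernel of \<open>T\<close> on \<open>W / Y\<close>.\<close>

lemma len_coker_comp:
  assumes lin: "linear_op S" "linear_op T" and s: "subspace Y" "subspace W" and "Y \<subseteq> W"
    and "S ` W \<subseteq> W" "T ` W \<subseteq> W" "S ` Y \<subseteq> Y" and inj: "\<And>x. x \<in> W \<Longrightarrow> S x \<in> Y \<Longrightarrow> x \<in> Y"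
  shows "len (S ` T ` W + Y) W = len (S ` W + Y) W + len (T ` W + Y) W"
proof -
  have sub: "subspace (S ` T ` W + Y)" "subspace (S ` W + Y)" "subspace (T ` W + Y)"
    using lin s by (auto intro: subspace_plus subspace_linear_image)
  have "S ` (T ` W + Y) + Y = S ` T ` W + (S ` Y + Y)"
    by (simp add: linear_image_plus[OF lin(1)] add.assoc)
  also have "S ` Y + Y = Y" using assms by (intro plus_absorb subspace_linear_image)
  finally have eq: "S ` (T ` W + Y) + Y = S ` T ` W + Y" .
  \<comment> \<open>Being injective modulo \<open>Y\<close>, \<open>S\<close> identifies
    \<open>W\<close> modulo \<open>T W + Y\<close> with \<open>S W + Y\<close> modulo
    \<open>S T W + Y\<close>.\<close>
  have "len (S ` (T ` W + Y) + Y) (S ` W + Y) = len (T ` W + Y) W"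
    using assms sub plus_upper2[OF subspace_linear_image[OF lin(2) s(2)], of Y] plus_least[OF s(2), of "T ` W" Y]
    by (intro len_linear_image[where W = W and K = Y]) auto
  then have 1: "len (S ` T ` W + Y) (S ` W + Y) = len (T ` W + Y) W" by (simp add: eq)
  have "S ` T ` W \<subseteq> S ` W" using assms by auto
  then have "S ` T ` W + Y \<subseteq> S ` W + Y" by (intro set_plus_mono2) auto
  moreover have "S ` W + Y \<subseteq> W" using assms by (intro plus_least) auto
  ultimately have "len (S ` T ` W + Y) W = len (S ` T ` W + Y) (S ` W + Y) + len (S ` W + Y) W"
    using sub s by (intro len_add) auto
  then show ?thesis using 1 by (simp add: add.commute)
qed

text \<open>Snake lemma: \<open>inj\<close> says that \<open>T\<close> has no kernel on
  \<open>W / Y\<close>, so the cokernels on \<open>Y / X\<close>, \<open>W / X\<close> and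
  \<open>W / Y\<close> form a short exact sequence.\<close>

lemma len_coker_filtration:
  assumes T: "linear_op T" and s: "subspace X" "subspace Y" "subspace W" and "X \<subseteq> Y" "Y \<subseteq> W"
    and "T ` Y \<subseteq> Y" "T ` W \<subseteq> W" and inj: "\<And>x. x \<in> W \<Longrightarrow> T x \<in> Y \<Longrightarrow> x \<in> Y"
  shows "len (T ` W + X) W = len (T ` Y + X) Y + len (T ` W + Y) W"
proof -
  have sub: "subspace (T ` W + X)" "subspace (T ` W + Y)" "subspace (T ` Y + X)"
    using T s by (auto intro: subspace_plus subspace_linear_image)
  have le: "T ` W + X \<subseteq> T ` W + Y" "T ` W + Y \<subseteq> W"
    using assms by (simp_all add: set_plus_mono2 plus_least)
  have eq1: "(T ` W + X) + Y = T ` W + Y"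
    using plus_absorb[OF s(1,2)] assms by (simp add: add.assoc)
  have eq2: "(T ` W + X) \<inter> Y = T ` Y + X"
  proof
    show "T ` Y + X \<subseteq> (T ` W + X) \<inter> Y"
      using plus_least[OF s(2) assms(7,5)] set_plus_mono2[OF image_mono[OF assms(6)] subset_refl]
      by (meson Int_greatest)
    show "(T ` W + X) \<inter> Y \<subseteq> T ` Y + X"
    proof
      fix z assume z: "z \<in> (T ` W + X) \<inter> Y"
      then obtain w x where wx: "w \<in> W" "x \<in> X" "z = T w + x" by (auto simp: set_plus_def)
      then have "T w = z - x" by simp
      then have "T w \<in> Y" using subspace_diff[OF s(2), of z x] z wx(2) assms(5) by auto
      then have "w \<in> Y" using inj wx by auto
      then show "z \<in> T ` Y + X" using wx by auto
    qed
  qed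
  have "len (T ` W + X) W = len (T ` W + X) (T ` W + Y) + len (T ` W + Y) W"
    using sub s le by (intro len_add) auto
  also have "len (T ` W + X) (T ` W + Y) = len (T ` Y + X) Y"
    using len_plus[OF sub(1) s(2)] by (simp add: eq1 eq2)
  finally show ?thesis .
qed

end

text \<open>Without the alias, \<open>smult\<close> is the field of module records.\<close>

alias smult = Polynomial.smult

section \<open>Lattices over a discrete valuation ring\<close>

text \<open>
  The polynomials of degree below \<open>r\<close> serve as a model of \<open>R\<^sup>r\<close>; the degree filtration makes the
  freeness of submodules an induction.
\<close>

interpretation V: module_lengths "smult :: 'r::comm_ring_1 \<Rightarrow> 'r poly \<Rightarrow> 'r poly"
  by unfold_locales (simp_all add: smult_add_right smult_add_left)

definition comb :: "nat \<Rightarrow> (nat \<Rightarrow> 'r poly) \<Rightarrow> (nat \<Rightarrow> 'r) \<Rightarrow> 'r::comm_ring_1 poly" where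
  "comb t b c = (\<Sum>i<t. smult (c i) (b i))"

definition is_basis :: "nat \<Rightarrow> (nat \<Rightarrow> 'r poly) \<Rightarrow> 'r::comm_ring_1 poly set \<Rightarrow> bool" where
  "is_basis t b C \<longleftrightarrow> C = range (comb t b) \<and> (\<forall>c. comb t b c = 0 \<longrightarrow> (\<forall>i<t. c i = 0))"

text \<open>Determined only at indices below \<open>t\<close>; beyond them the choice is arbitrary,
  so statements on single coordinates carry \<open>i < t\<close>.\<close>

definition coord :: "nat \<Rightarrow> (nat \<Rightarrow> 'r poly) \<Rightarrow> 'r poly \<Rightarrow> nat \<Rightarrow> 'r::comm_ring_1" where
  "coord t b x = (SOME c. comb t b c = x)"

definition basis_trace :: "nat \<Rightarrow> (nat \<Rightarrow> 'r poly) \<Rightarrow> ('r poly \<Rightarrow> 'r poly) \<Rightarrow> 'r::comm_ring_1" where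
  "basis_trace t b X = (\<Sum>i<t. coord t b (X (b i)) i)"

definition below_degree :: "nat \<Rightarrow> 'r::comm_ring_1 poly set" where
  "below_degree r = {f. \<forall>i\<ge>r. coeff f i = 0}"

lemma comb_add: "comb t b (\<lambda>i. c i + d i) = comb t b c + comb t b d"
  by (simp add: comb_def smult_add_left sum.distrib)

lemma comb_diff: "comb t b (\<lambda>i. c i - d i) = comb t b c - comb t b d"
  by (simp add: comb_def smult_diff_left sum_subtractf)

lemma comb_smult: "comb t b (\<lambda>i. a * c i) = smult a (comb t b c)"
  by (simp add: comb_def V.scale_sum_right)

lemma comb_cong: "(\<And>i. i < t \<Longrightarrow> c i = d i) \<Longrightarrow> comb t b c = comb t b d"
  by (simp add: comb_def)

lemma comb_unit: "j < t \<Longrightarrow> comb t b (\<lambda>i. if i = j then 1 else 0) = b j"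
  by (simp add: comb_def if_distrib[of "\<lambda>c. smult c _"] cong: if_cong)

lemma linear_comb: "V.linear_op T \<Longrightarrow> T (comb t b c) = (\<Sum>i<t. smult (c i) (T (b i)))"
  by (simp add: comb_def V.linear_op_sum V.linear_op_scale)

lemma is_basis_subspace:
  assumes "is_basis t b C"
  shows "V.subspace C"
proof -
  have C: "C = range (comb t b)" using assms by (simp add: is_basis_def)
  show ?thesis
    unfolding C
  proof (rule V.subspaceI)
    have "comb t b (\<lambda>i. 0) = 0" by (simp add: comb_def)
    then show "0 \<in> range (comb t b)" by (metis rangeI)
    show "x + y \<in> range (comb t b)" if "x \<in> range (comb t b)" "y \<in> range (comb t b)" for x y
      using that by (auto simp: comb_add[symmetric])
    show "smult a x \<in> range (comb t b)" if "x \<in> range (comb t b)" for a x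
      using that by (auto simp: comb_smult[symmetric])
  qed
qed

context
  fixes t :: nat and b :: "nat \<Rightarrow> 'r::comm_ring_1 poly" and C
  assumes B: "is_basis t b C"
begin

lemma comb_coord: "x \<in> C \<Longrightarrow> comb t b (coord t b x) = x"
  unfolding coord_def by (rule someI_ex[of "\<lambda>c. comb t b c = x"]) (use B in \<open>auto simp: is_basis_def\<close>)

lemma comb_mem: "comb t b c \<in> C"
  using B by (auto simp: is_basis_def)

lemma basis_mem: "i < t \<Longrightarrow> b i \<in> C"
  using comb_mem comb_unit by metis

lemma comb_inj: "comb t b c = comb t b d \<Longrightarrow> i < t \<Longrightarrow> c i = d i"
  using B comb_diff[of t b c d] unfolding is_basis_def by (metis (no_types, lifting) right_minus_eq)

lemma coord_comb: "i < t \<Longrightarrow> coord t b (comb t b c) i = c i"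
  by (rule comb_inj[OF comb_coord[OF comb_mem]])

lemma coord_basis: "i < t \<Longrightarrow> j < t \<Longrightarrow> coord t b (b j) i = (if i = j then 1 else 0)"
  using coord_comb[of i "\<lambda>i. if i = j then 1 else 0"] comb_unit by metis

lemma coord_add: "x \<in> C \<Longrightarrow> y \<in> C \<Longrightarrow> i < t \<Longrightarrow> coord t b (x + y) i = coord t b x i + coord t b y i"
  using coord_comb[of i "\<lambda>i. coord t b x i + coord t b y i"] by (simp add: comb_add comb_coord)

lemma coord_smult: "x \<in> C \<Longrightarrow> i < t \<Longrightarrow> coord t b (smult a x) i = a * coord t b x i"
  using coord_comb[of i "\<lambda>i. a * coord t b x i"] by (simp add: comb_smult comb_coord)

lemma coord_0: "i < t \<Longrightarrow> coord t b 0 i = 0"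
  using coord_comb[of i "\<lambda>i. 0"] by (simp add: comb_def)

lemma coord_sum:
  assumes "\<And>k. k \<in> I \<Longrightarrow> f k \<in> C" "i < t"
  shows "coord t b (sum f I) i = (\<Sum>k\<in>I. coord t b (f k) i)"
  using assms
proof (induction I rule: infinite_finite_induct)
  case (insert k I)
  then have "sum f I \<in> C" by (intro V.subspace_sum is_basis_subspace[OF B]) auto
  then show ?case using insert by (simp add: coord_add)
qed (auto simp: coord_0)

end

lemma basis_trace_sum:
  assumes B: "is_basis t b C" and "\<And>k x. k \<in> I \<Longrightarrow> x \<in> C \<Longrightarrow> X k x \<in> C"
  shows "basis_trace t b (\<lambda>x. \<Sum>k\<in>I. smult (a k) (X k x)) = (\<Sum>k\<in>I. a k * basis_trace t b (X k))"
proof -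
  have sub: "smult (a k) (X k (b i)) \<in> C" if "k \<in> I" "i < t" for k i
    using that assms basis_mem[OF B] by (intro V.subspace_scale is_basis_subspace[OF B]) auto
  have "basis_trace t b (\<lambda>x. \<Sum>k\<in>I. smult (a k) (X k x)) = (\<Sum>i<t. \<Sum>k\<in>I. a k * coord t b (X k (b i)) i)"
    unfolding basis_trace_def
    by (intro sum.cong refl)
       (use sub assms(2) basis_mem[OF B] in \<open>simp add: coord_sum[OF B] coord_smult[OF B]\<close>)
  also have "\<dots> = (\<Sum>k\<in>I. a k * basis_trace t b (X k))"
    unfolding basis_trace_def sum_distrib_left by (rule sum.swap)
  finally show ?thesis .
qed

text \<open>Cyclic invariance of the trace. With \<open>P\<close> the inclusion of \<open>C\<close>,
  \<open>M\<close> the matrix of \<open>E\<close> and \<open>Y\<close> that of \<open>X\<close> on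
  \<open>C\<close>, the trace of \<open>P Y M\<close> is that of \<open>Y M P\<close> (up to
  transposition), and \<open>M P\<close> is the scalar \<open>a\<close>. It serves three times:
  \<open>E\<close> the identity gives independence of the basis, \<open>E\<close> a projection gives
  traces on components, \<open>E\<close> a sum of powers of \<open>g\<close> gives traces on fixed
  submodules.\<close>

lemma basis_trace_comp_projection:
  assumes L: "is_basis r b L" and C: "is_basis t c C" and "C \<subseteq> L"
    and X: "V.linear_op X" and E: "V.linear_op E"
    and XC: "\<And>x. x \<in> C \<Longrightarrow> X x \<in> C" and EL: "\<And>x. x \<in> L \<Longrightarrow> E x \<in> C"
    and EC: "\<And>x. x \<in> C \<Longrightarrow> E x = smult a x"
  shows "basis_trace r b (\<lambda>x. X (E x)) = a * basis_trace t c X"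
proof -
  define M where "M i j = coord t c (E (b i)) j" for i j
  define P where "P k i = coord r b (c k) i" for k i
  define Y where "Y j k = coord t c (X (c j)) k" for j k
  have cL: "c k \<in> L" if "k < t" for k using that basis_mem[OF C] assms(3) by auto
  have EP: "(\<Sum>i<r. P k i * M i j) = (if j = k then a else 0)" if "k < t" "j < t" for k j
  proof -
    have "E (c k) = (\<Sum>i<r. smult (P k i) (E (b i)))"
      using linear_comb[OF E, of r b "P k"] comb_coord[OF L cL[OF that(1)]] by (simp add: P_def[abs_def])
    moreover have Eb: "E (b i) \<in> C" if "i < r" for i using EL[OF basis_mem[OF L that]] .
    moreover have "coord t c (\<Sum>i<r. smult (P k i) (E (b i))) j = (\<Sum>i<r. coord t c (smult (P k i) (E (b i))) j)"
      by (rule coord_sum[OF C]) (use Eb V.subspace_scale[OF is_basis_subspace[OF C]] that in auto)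
    ultimately have "coord t c (E (c k)) j = (\<Sum>i<r. P k i * M i j)"
      using that by (simp add: coord_smult[OF C] M_def)
    moreover have "coord t c (E (c k)) j = (if j = k then a else 0)"
      using EC[of "c k"] basis_mem[OF C] that by (simp add: coord_smult[OF C] coord_basis[OF C])
    ultimately show ?thesis by simp
  qed
  have "coord r b (X (E (b i))) i = (\<Sum>j<t. \<Sum>k<t. M i j * Y j k * P k i)" if "i < r" for i
  proof -
    have "X (E (b i)) = (\<Sum>j<t. smult (M i j) (X (c j)))"
      using linear_comb[OF X, of t c "M i"] comb_coord[OF C, of "E (b i)"] EL[OF basis_mem[OF L that]]
      by (simp add: M_def[abs_def])
    also have "\<dots> = (\<Sum>j<t. smult (M i j) (\<Sum>k<t. smult (Y j k) (c k)))"
    proof (intro sum.cong refl)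
      fix j assume "j \<in> {..<t}"
      then have "X (c j) = comb t c (Y j)" using comb_coord[OF C, of "X (c j)"] XC basis_mem[OF C]
        by (simp add: Y_def[abs_def])
      then show "smult (M i j) (X (c j)) = smult (M i j) (\<Sum>k<t. smult (Y j k) (c k))"
        by (simp add: comb_def)
    qed
    also have "\<dots> = (\<Sum>j<t. \<Sum>k<t. smult (M i j * Y j k) (c k))"
      by (simp add: V.scale_sum_right)
    finally have "coord r b (X (E (b i))) i = coord r b (\<Sum>j<t. \<Sum>k<t. smult (M i j * Y j k) (c k)) i" by simp
    also have "\<dots> = (\<Sum>j<t. \<Sum>k<t. M i j * Y j k * P k i)"
    proof -
      have m: "smult (M i j * Y j k) (c k) \<in> L" if "k < t" for j k
        using cL[OF that] V.subspace_scale[OF is_basis_subspace[OF L]] by auto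
      then have "(\<Sum>k<t. smult (M i j * Y j k) (c k)) \<in> L" for j
        by (intro V.subspace_sum[OF is_basis_subspace[OF L]]) auto
      then have "coord r b (\<Sum>j<t. \<Sum>k<t. smult (M i j * Y j k) (c k)) i =
          (\<Sum>j<t. coord r b (\<Sum>k<t. smult (M i j * Y j k) (c k)) i)"
        by (intro coord_sum[OF L] that) auto
      also have "\<dots> = (\<Sum>j<t. \<Sum>k<t. coord r b (smult (M i j * Y j k) (c k)) i)"
        by (intro sum.cong refl coord_sum[OF L] that) (use m in auto)
      also have "(\<Sum>j<t. \<Sum>k<t. coord r b (smult (M i j * Y j k) (c k)) i) =
          (\<Sum>j<t. \<Sum>k<t. M i j * Y j k * P k i)"
        using cL that by (intro sum.cong refl) (simp add: coord_smult[OF L] P_def)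
      finally show ?thesis .
    qed
    finally show ?thesis .
  qed
  then have "basis_trace r b (\<lambda>x. X (E x)) = (\<Sum>i<r. \<Sum>j<t. \<Sum>k<t. M i j * Y j k * P k i)"
    unfolding basis_trace_def by (intro sum.cong) auto
  also have "\<dots> = (\<Sum>j<t. \<Sum>i<r. \<Sum>k<t. M i j * Y j k * P k i)" by (rule sum.swap)
  also have "\<dots> = (\<Sum>j<t. \<Sum>k<t. \<Sum>i<r. M i j * Y j k * P k i)"
    by (intro sum.cong refl sum.swap)
  also have "\<dots> = (\<Sum>j<t. \<Sum>k<t. Y j k * (\<Sum>i<r. P k i * M i j))"
    by (simp add: sum_distrib_left mult_ac)
  also have "\<dots> = (\<Sum>j<t. \<Sum>k<t. if j = k then Y j k * a else 0)"
    by (intro sum.cong refl) (auto simp: EP)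
  also have "\<dots> = (\<Sum>j<t. a * Y j j)" by (simp add: mult.commute)
  finally show ?thesis by (simp add: basis_trace_def Y_def sum_distrib_left)
qed

definition submodule_trace :: "'r::comm_ring_1 poly set \<Rightarrow> ('r poly \<Rightarrow> 'r poly) \<Rightarrow> 'r" where
  "submodule_trace C X = (let (t, b) = SOME (t, b). is_basis t b C in basis_trace t b X)"

lemma linear_op_id: "V.linear_op (\<lambda>x. x)"
  by (simp add: V.linear_op_def)

lemma linear_op_smult: "V.linear_op (smult (c :: 'r::comm_ring_1))"
  by (simp add: V.linear_op_def smult_add_right mult.commute)

lemma linear_op_comp: "V.linear_op S \<Longrightarrow> V.linear_op T \<Longrightarrow> V.linear_op (\<lambda>x. S (T x))"
  by (simp add: V.linear_op_def)

lemma submodule_trace_eq: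
  assumes B: "is_basis t b C" and X: "V.linear_op X" "\<And>x. x \<in> C \<Longrightarrow> X x \<in> C"
  shows "submodule_trace C X = basis_trace t b X"
proof -
  obtain t' b' where e: "(SOME (t, b). is_basis t b C) = (t', b')" by (cases "SOME (t, b). is_basis t b C")
  have "case (SOME (t, b). is_basis t b C) of (t, b) \<Rightarrow> is_basis t b C"
    by (rule someI_ex) (use B in auto)
  then have B': "is_basis t' b' C" by (simp add: e)
  have "basis_trace t' b' (\<lambda>x. X x) = 1 * basis_trace t b X"
    by (rule basis_trace_comp_projection[OF B' B]) (use X in \<open>auto simp: linear_op_id\<close>)
  then show ?thesis by (simp add: submodule_trace_def e)
qed

lemma submodule_trace_comp_projection:
  assumes "is_basis r b L" "is_basis t c C" "C \<subseteq> L" "V.linear_op X" "V.linear_op E"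
    and "\<And>x. x \<in> C \<Longrightarrow> X x \<in> C" "\<And>x. x \<in> L \<Longrightarrow> E x \<in> C" "\<And>x. x \<in> C \<Longrightarrow> E x = smult a x"
    and XE: "\<And>x. x \<in> L \<Longrightarrow> X (E x) \<in> L"
  shows "submodule_trace L (\<lambda>x. X (E x)) = a * submodule_trace C X"
  using basis_trace_comp_projection[OF assms(1-8)] submodule_trace_eq[OF assms(1) linear_op_comp[OF assms(4,5)] XE]
    submodule_trace_eq[OF assms(2,4,6)] by simp

lemma linear_op_sum_smult:
  "(\<And>k. k \<in> I \<Longrightarrow> V.linear_op (X k)) \<Longrightarrow> V.linear_op (\<lambda>x. \<Sum>k\<in>I. smult (a k) (X k x))"
  by (simp add: V.linear_op_def sum.distrib smult_add_right V.scale_sum_right mult.commute)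

lemma submodule_trace_sum:
  assumes "is_basis t b C" "\<And>k. k \<in> I \<Longrightarrow> V.linear_op (X k)" "\<And>k x. k \<in> I \<Longrightarrow> x \<in> C \<Longrightarrow> X k x \<in> C"
  shows "submodule_trace C (\<lambda>x. \<Sum>k\<in>I. smult (a k) (X k x)) = (\<Sum>k\<in>I. a k * submodule_trace C (X k))"
proof -
  have "(\<Sum>k\<in>I. smult (a k) (X k x)) \<in> C" if "x \<in> C" for x
    using that assms is_basis_subspace[OF assms(1)] by (intro V.subspace_sum V.subspace_scale) auto
  then have "submodule_trace C (\<lambda>x. \<Sum>k\<in>I. smult (a k) (X k x)) = basis_trace t b (\<lambda>x. \<Sum>k\<in>I. smult (a k) (X k x))"
    by (intro submodule_trace_eq[OF assms(1) linear_op_sum_smult[OF assms(2)]]) auto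
  also have "\<dots> = (\<Sum>k\<in>I. a k * basis_trace t b (X k))"
    using assms by (intro basis_trace_sum) auto
  also have "\<dots> = (\<Sum>k\<in>I. a k * submodule_trace C (X k))"
    using assms by (intro sum.cong refl) (simp add: submodule_trace_eq)
  finally show ?thesis .
qed

lemma is_basis_below_degree: "is_basis r (\<lambda>i. monom 1 i) (below_degree r :: 'r::comm_ring_1 poly set)"
proof -
  have c: "coeff (comb r (\<lambda>i. monom 1 i) c) i = (if i < r then c i else 0)" for c :: "nat \<Rightarrow> 'r" and i
    by (simp add: comb_def coeff_sum smult_monom if_distrib cong: if_cong)
  have "below_degree r = range (comb r (\<lambda>i. monom (1::'r) i))"
  proof (intro equalityI subsetI)
    fix f :: "'r poly" assume f: "f \<in> below_degree r"
    have "f = comb r (\<lambda>i. monom 1 i) (coeff f)"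
      using f by (intro poly_eqI) (auto simp: c below_degree_def)
    then show "f \<in> range (comb r (\<lambda>i. monom (1::'r) i))" by blast
  qed (auto simp: c below_degree_def)
  then show ?thesis unfolding is_basis_def using c by (metis coeff_0)
qed

section \<open>Bases and ranks over a ring with a uniformizer\<close>

locale dvr =
  fixes \<pi> :: "'r::idom"
  assumes uniformizer_nonzero: "\<pi> \<noteq> 0" and uniformizer_nonunit: "\<not> \<pi> dvd 1"
    and factorization: "x \<noteq> 0 \<Longrightarrow> \<exists>u k. u dvd 1 \<and> x = u * \<pi> ^ k"
begin

lemma not_dvd_imp_unit:
  assumes "\<not> \<pi> dvd c"
  shows "c dvd 1"
proof -
  have "c \<noteq> 0" using assms by auto
  then obtain u k where uk: "u dvd 1" "c = u * \<pi> ^ k" using factorization by blast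
  then have "k = 0" using assms by (cases k) auto
  then show ?thesis using uk by simp
qed

text \<open>An element of least valuation divides all the others; \<open>I\<close> may be any set,
  not only an ideal.\<close>

lemma exists_common_divisor:
  fixes I :: "'r set"
  assumes "x \<in> I" "x \<noteq> 0"
  shows "\<exists>y\<in>I. y \<noteq> 0 \<and> (\<forall>z\<in>I. y dvd z)"
proof -
  define P where "P k \<longleftrightarrow> (\<exists>u. u dvd 1 \<and> u * \<pi> ^ k \<in> I)" for k
  obtain k where "P k" using assms factorization[of x] unfolding P_def by blast
  define m where "m = (LEAST k. P k)"
  have "P m" unfolding m_def using \<open>P k\<close> by (rule LeastI)
  then obtain u where u: "u dvd 1" "u * \<pi> ^ m \<in> I" unfolding P_def by blast
  show ?thesis
  proof (intro bexI[of _ "u * \<pi> ^ m"] conjI ballI)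
    show "u * \<pi> ^ m \<noteq> 0" using u uniformizer_nonzero by auto
    fix z assume z: "z \<in> I"
    show "u * \<pi> ^ m dvd z"
    proof (cases "z = 0")
      case False
      then obtain w n where w: "w dvd 1" "z = w * \<pi> ^ n" using factorization by blast
      have "m \<le> n" unfolding m_def by (rule Least_le) (use w z P_def in blast)
      moreover have "u dvd w" using u(1) by (meson dvd_trans one_dvd)
      ultimately show ?thesis using w by (simp add: mult_dvd_mono le_imp_power_dvd)
    qed simp
  qed (use u in auto)
qed

text \<open>Induction on the degree bound: the part of degree below \<open>r\<close> is free, and an
  element whose coefficient at \<open>r\<close> has least valuation splits off one more basis
  vector.\<close>

theorem exists_basis:
  fixes C :: "'r poly set"
  assumes "V.subspace C" "C \<subseteq> below_degree r"
  shows "\<exists>t b. is_basis t b C"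
  using assms
proof (induction r arbitrary: C)
  case 0
  then have "C = {0}" using V.subspace_0[of C] by (auto simp: below_degree_def poly_eq_iff)
  then have "is_basis 0 (\<lambda>i. 0) C" by (auto simp: is_basis_def comb_def)
  then show ?case by blast
next
  case (Suc r)
  define C' where "C' = C \<inter> below_degree r"
  have "V.subspace (below_degree r :: 'r poly set)" by (rule is_basis_subspace[OF is_basis_below_degree])
  then have "V.subspace C'" unfolding C'_def by (intro V.subspace_inter Suc.prems)
  from Suc.IH[OF this] obtain t b where b: "is_basis t b C'" by (auto simp: C'_def)
  have top0: "f \<in> below_degree r" if "f \<in> C" "coeff f r = 0" for f
  proof -
    have "coeff f i = 0" if "i \<ge> Suc r" for i
      using \<open>f \<in> C\<close> Suc.prems(2) that by (auto simp: below_degree_def)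
    then have "coeff f i = 0" if "i \<ge> r" for i
      using that \<open>coeff f r = 0\<close> by (cases "i = r") auto
    then show ?thesis by (simp add: below_degree_def)
  qed
  show ?case
  proof (cases "\<exists>f\<in>C. coeff f r \<noteq> 0")
    case False
    then have "C = C'" unfolding C'_def using top0 by blast
    then show ?thesis using b by blast
  next
    case True
    then obtain y where y: "y \<in> (\<lambda>f. coeff f r) ` C" "y \<noteq> 0" "\<And>z. z \<in> (\<lambda>f. coeff f r) ` C \<Longrightarrow> y dvd z"
      using exists_common_divisor[of _ "(\<lambda>f. coeff f r) ` C"] by blast
    then obtain f where f: "f \<in> C" "coeff f r = y" by blast
    define b' where "b' = b(t := f)"
    have cb: "comb (Suc t) b' c = comb t b c + smult (c t) f" for c
      by (simp add: comb_def b'_def)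
    have bc: "coeff (comb t b c) r = 0" "comb t b c \<in> C" for c
      using comb_mem[OF b, of c] by (auto simp: C'_def below_degree_def)
    have "is_basis (Suc t) b' C"
      unfolding is_basis_def
    proof (intro conjI allI impI)
      show "C = range (comb (Suc t) b')"
      proof (intro equalityI subsetI)
        fix g assume g: "g \<in> C"
        obtain d where d: "coeff g r = y * d" using y(3)[of "coeff g r"] g by (auto elim: dvdE)
        have "g - smult d f \<in> C" using g f Suc.prems(1) by (intro V.subspace_diff V.subspace_scale)
        moreover have "coeff (g - smult d f) r = 0" using d f by simp
        ultimately have "g - smult d f \<in> C'" using top0 by (auto simp: C'_def)
        then have "comb t b (coord t b (g - smult d f)) = g - smult d f" by (rule comb_coord[OF b])
        moreover have "comb t b ((coord t b (g - smult d f))(t := d)) = comb t b (coord t b (g - smult d f))"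
          by (rule comb_cong) simp
        ultimately have "g = comb (Suc t) b' ((coord t b (g - smult d f))(t := d))"
          by (simp add: cb)
        then show "g \<in> range (comb (Suc t) b')" by blast
      next
        fix g assume "g \<in> range (comb (Suc t) b')"
        then show "g \<in> C" using bc(2) f(1) Suc.prems(1) by (auto simp: cb intro: V.subspace_add V.subspace_scale)
      qed
    next
      fix c i assume z: "comb (Suc t) b' c = 0" and i: "i < Suc t"
      have "coeff (comb (Suc t) b' c) r = c t * y" by (simp add: cb bc f)
      then have ct: "c t = 0" using z y(2) by simp
      then have "comb t b c = 0" using z by (simp add: cb)
      then show "c i = 0" using b ct i by (auto simp: is_basis_def less_Suc_eq)
    qed
    then show ?thesis by blast
  qed
qed

definition rk :: "'r poly set \<Rightarrow> enat" where
  "rk C = V.len (smult \<pi> ` C) C"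

theorem rk_eq:
  assumes B: "is_basis t b C"
  shows "rk C = enat t"
proof -
  \<comment> \<open>A filtration from \<open>\<pi> C\<close> up to \<open>C\<close> that frees one
    coordinate at a time from divisibility by \<open>\<pi>\<close>; each of its \<open>t\<close>
    steps has length 1.\<close>
  define M where "M j = {comb t b c | c. \<forall>i. j \<le> i \<longrightarrow> i < t \<longrightarrow> \<pi> dvd c i}" for j
  have M: "V.subspace (M j)" for j
  proof (rule V.subspaceI)
    have "comb t b (\<lambda>i. 0) = 0" by (simp add: comb_def)
    then show "0 \<in> M j" unfolding M_def by (intro CollectI exI[of _ "\<lambda>i. 0"]) simp
  next
    fix x y assume "x \<in> M j" "y \<in> M j"
    then obtain c d where "x = comb t b c" "y = comb t b d"
      "\<forall>i. j \<le> i \<longrightarrow> i < t \<longrightarrow> \<pi> dvd c i" "\<forall>i. j \<le> i \<longrightarrow> i < t \<longrightarrow> \<pi> dvd d i" unfolding M_def by blast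
    then have "x + y = comb t b (\<lambda>i. c i + d i)" "\<forall>i. j \<le> i \<longrightarrow> i < t \<longrightarrow> \<pi> dvd c i + d i"
      by (simp_all add: comb_add)
    then show "x + y \<in> M j" unfolding M_def by blast
  next
    fix a x assume "x \<in> M j"
    then obtain c where "x = comb t b c" "\<forall>i. j \<le> i \<longrightarrow> i < t \<longrightarrow> \<pi> dvd c i" unfolding M_def by blast
    then have "smult a x = comb t b (\<lambda>i. a * c i)" "\<forall>i. j \<le> i \<longrightarrow> i < t \<longrightarrow> \<pi> dvd a * c i"
      by (simp_all add: comb_smult)
    then show "smult a x \<in> M j" unfolding M_def by blast
  qed
  have mono: "M j \<subseteq> M (Suc j)" for j
  proof
    fix x assume "x \<in> M j"
    then obtain c where "x = comb t b c" "\<forall>i. j \<le> i \<longrightarrow> i < t \<longrightarrow> \<pi> dvd c i" unfolding M_def by blast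
    moreover from this have "\<forall>i. Suc j \<le> i \<longrightarrow> i < t \<longrightarrow> \<pi> dvd c i" by simp
    ultimately show "x \<in> M (Suc j)" unfolding M_def by blast
  qed
  have Mt: "M t = C" using B by (auto simp: M_def is_basis_def)
  have M0: "M 0 = smult \<pi> ` C"
  proof (intro equalityI subsetI)
    fix x assume "x \<in> M 0"
    then obtain c where c: "x = comb t b c" "\<forall>i<t. \<pi> dvd c i" by (auto simp: M_def)
    then have "\<forall>i<t. \<exists>d. c i = \<pi> * d" by (auto elim: dvdE)
    then obtain d where d: "\<And>i. i < t \<Longrightarrow> c i = \<pi> * d i" by metis
    then have "x = smult \<pi> (comb t b d)"
      unfolding c(1) comb_smult[symmetric] by (intro comb_cong) auto
    then show "x \<in> smult \<pi> ` C" using comb_mem[OF B] by blast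
  next
    fix x assume "x \<in> smult \<pi> ` C"
    then obtain c where "x = smult \<pi> (comb t b c)" using B by (auto simp: is_basis_def)
    then have "x = comb t b (\<lambda>i. \<pi> * c i)" by (simp add: comb_smult)
    then show "x \<in> M 0" unfolding M_def by auto
  qed
  have step: "V.len (M j) (M (Suc j)) = 1" if j: "j < t" for j
  proof (rule V.len_eq_1[OF M M])
    have ncoord: "\<not> \<pi> dvd c j" if "comb t b c \<notin> M j" "comb t b c \<in> M (Suc j)" for c
    proof
      assume d: "\<pi> dvd c j"
      from that(2) obtain c' where c': "comb t b c = comb t b c'" "\<forall>i. Suc j \<le> i \<longrightarrow> i < t \<longrightarrow> \<pi> dvd c' i"
        unfolding M_def by blast
      have "\<forall>i. j \<le> i \<longrightarrow> i < t \<longrightarrow> \<pi> dvd c i"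
        using c' comb_inj[OF B c'(1)] d by (metis Suc_leI le_neq_implies_less)
      then show False using that(1) unfolding M_def by blast
    qed
    have bj: "b j \<in> M (Suc j)"
      unfolding M_def using comb_unit[OF j, of b, symmetric] by (force intro: exI[of _ "\<lambda>i. if i = j then 1 else 0"])
    have "b j \<notin> M j"
    proof
      assume "b j \<in> M j"
      then obtain c where c: "b j = comb t b c" "\<forall>i. j \<le> i \<longrightarrow> i < t \<longrightarrow> \<pi> dvd c i" unfolding M_def by blast
      have "comb t b (\<lambda>i. if i = j then 1 else 0) = comb t b c" using c(1) comb_unit[OF j] by metis
      from comb_inj[OF B this j] have "c j = 1" by simp
      then show False using c(2) j uniformizer_nonunit by auto
    qed
    then show "M j \<subset> M (Suc j)" using mono bj by blast
    fix U assume U: "V.subspace U" "M j \<subseteq> U" "U \<subseteq> M (Suc j)"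
    show "U = M j \<or> U = M (Suc j)"
    proof (rule disjCI)
      assume "U \<noteq> M (Suc j)"
      show "U = M j"
      proof (rule ccontr)
        assume "U \<noteq> M j"
        then obtain x where x: "x \<in> U" "x \<notin> M j" using U(2) by blast
        then have "x \<in> M (Suc j)" using U(3) by auto
        then obtain c where c: "x = comb t b c" "\<forall>i. Suc j \<le> i \<longrightarrow> i < t \<longrightarrow> \<pi> dvd c i"
          unfolding M_def by auto
        \<comment> \<open>Modulo \<open>M j\<close> only coordinate \<open>j\<close> matters. A
          nonzero residue there comes from a unit, so \<open>x\<close> generates the whole
          step.\<close>
        have "c j dvd 1" using ncoord[of c] not_dvd_imp_unit x U(3) c(1) by blast
        then obtain w where w: "1 = c j * w" by (auto elim: dvdE)
        have red: "y \<in> U" if y: "y \<in> M (Suc j)" for y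
        proof -
          obtain d where d: "y = comb t b d" "\<forall>i. Suc j \<le> i \<longrightarrow> i < t \<longrightarrow> \<pi> dvd d i"
            using y unfolding M_def by blast
          define f where "f = (\<lambda>i. d i - d j * w * c i)"
          have "y - smult (d j * w) x = comb t b f"
            by (simp add: d c f_def comb_diff comb_smult)
          moreover have "\<forall>i. j \<le> i \<longrightarrow> i < t \<longrightarrow> \<pi> dvd f i"
          proof (intro allI impI)
            fix i assume i: "j \<le> i" "i < t"
            have "f j = d j * (1 - c j * w)" by (simp add: f_def algebra_simps)
            then have fj: "f j = 0" using w by simp
            show "\<pi> dvd f i"
            proof (cases "i = j")
              case False
              then have "\<pi> dvd c i" "\<pi> dvd d i" using i c(2) d(2) by auto
              then show ?thesis by (simp add: f_def)
            qed (simp add: fj)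
          qed
          ultimately have "y - smult (d j * w) x \<in> U" using U(2) unfolding M_def by blast
          then have "(y - smult (d j * w) x) + smult (d j * w) x \<in> U"
            using U(1) x(1) by (intro V.subspace_add V.subspace_scale)
          then show ?thesis by simp
        qed
        then show False using \<open>U \<noteq> M (Suc j)\<close> U(3) by blast
      qed
    qed
  qed
  have "V.len (M 0) (M j) = enat j" if "j \<le> t" for j
    using that
  proof (induction j)
    case 0
    then show ?case by (simp add: zero_enat_def)
  next
    case (Suc j)
    have "M 0 \<subseteq> M j" by (rule lift_Suc_mono_le[of M]) (use mono in auto)
    then have "V.len (M 0) (M (Suc j)) = V.len (M 0) (M j) + V.len (M j) (M (Suc j))"
      by (intro V.len_add M mono)
    then show ?case using Suc step[of j] by (simp add: one_enat_def)
  qed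
  from this[of t] show ?thesis by (simp add: rk_def Mt M0)
qed

end

section \<open>Polynomials in an operator\<close>

text \<open>Polynomials play two roles: \<open>f\<close> is a polynomial in the operator
  \<open>T\<close>, while \<open>x\<close> is a vector of the lattice model. The fold is Horner's
  scheme.\<close>

definition poly_act :: "'r::comm_ring_1 poly \<Rightarrow> ('r poly \<Rightarrow> 'r poly) \<Rightarrow> 'r poly \<Rightarrow> 'r poly" where
  "poly_act f T x = fold_coeffs (\<lambda>a y. smult a x + T y) f 0"

lemma poly_act_0 [simp]: "poly_act 0 T x = 0"
  by (simp add: poly_act_def)

context
  fixes T :: "'r::comm_ring_1 poly \<Rightarrow> 'r poly"
  assumes T: "V.linear_op T"
begin

lemma poly_act_pCons: "poly_act (pCons a f) T x = smult a x + T (poly_act f T x)"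
  using V.linear_op_0[OF T] by (cases "f = 0 \<and> a = 0") (auto simp: poly_act_def)

lemma poly_act_add: "poly_act (f + g) T x = poly_act f T x + poly_act g T x"
  by (induction f g rule: poly_induct2)
     (simp_all add: poly_act_pCons V.linear_op_add[OF T] smult_add_left algebra_simps)

lemma poly_act_smult: "poly_act (smult a f) T x = smult a (poly_act f T x)"
  by (induction f) (simp_all add: poly_act_pCons V.linear_op_scale[OF T] smult_add_right)

lemma poly_act_diff: "poly_act (f - g) T x = poly_act f T x - poly_act g T x"
  using poly_act_add[of "f - g" g x] by (simp add: eq_diff_eq)

lemma linear_poly_act: "V.linear_op (poly_act f T)"
proof (induction f)
  case 0
  then show ?case by (simp add: V.linear_op_def)
next
  case (pCons a f)
  then show ?case
    by (simp add: V.linear_op_def poly_act_pCons V.linear_op_add[OF T] V.linear_op_scale[OF T]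
        smult_add_right mult.commute algebra_simps)
qed

lemma poly_act_mult: "poly_act (f * g) T x = poly_act f T (poly_act g T x)"
  by (induction f) (simp_all add: poly_act_pCons poly_act_add poly_act_smult)

lemma poly_act_1 [simp]: "poly_act 1 T x = x"
  by (simp add: one_pCons poly_act_pCons V.linear_op_0[OF T])

lemma poly_act_monom: "poly_act (monom a k) T x = smult a ((T ^^ k) x)"
  by (induction k) (simp_all add: monom_0 monom_Suc poly_act_pCons V.linear_op_0[OF T] V.linear_op_scale[OF T])

lemma poly_act_const: "poly_act [:a:] T x = smult a x"
  by (simp add: poly_act_pCons V.linear_op_0[OF T])

lemma poly_act_sum: "poly_act (sum f I) T x = (\<Sum>i\<in>I. poly_act (f i) T x)"
  by (induct I rule: infinite_finite_induct) (simp_all add: poly_act_add)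

lemma poly_act_commute:
  "V.linear_op S \<Longrightarrow> (\<And>x. S (T x) = T (S x)) \<Longrightarrow> poly_act f T (S x) = S (poly_act f T x)"
  by (induction f) (simp_all add: poly_act_pCons V.linear_op_add V.linear_op_scale V.linear_op_0)

lemma poly_act_mem:
  "V.subspace C \<Longrightarrow> (\<And>x. x \<in> C \<Longrightarrow> T x \<in> C) \<Longrightarrow> x \<in> C \<Longrightarrow> poly_act f T x \<in> C"
  by (induction f) (auto simp: poly_act_pCons V.subspace_0 intro!: V.subspace_add V.subspace_scale)

end

section \<open>The trace of an operator annihilated by an irreducible polynomial\<close>

text \<open>Minus the sum of the roots of a monic polynomial. Reading it off the reflected
  polynomial gives 0 in degree 0 and reduces the product rule to the two lowest
  coefficients.\<close>

abbreviation second_coeff :: "'r::idom poly \<Rightarrow> 'r" where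
  "second_coeff f \<equiv> coeff (reflect_poly f) 1"

lemma coeff_mult_1: "coeff (f * g) 1 = coeff f 0 * coeff g 1 + coeff f 1 * coeff g 0"
  by (simp add: coeff_mult numeral_eq_Suc)

lemma second_coeff_mult:
  "lead_coeff f = 1 \<Longrightarrow> lead_coeff g = 1 \<Longrightarrow> second_coeff (f * g) = second_coeff f + second_coeff g"
  using coeff_mult_1[of "reflect_poly f" "reflect_poly g"] by (simp add: reflect_poly_mult)

lemma second_coeff_power:
  "lead_coeff f = 1 \<Longrightarrow> second_coeff (f ^ n) = of_nat n * second_coeff f"
proof (induction n)
  case (Suc n)
  have "lead_coeff (f ^ n) = 1" using Suc.prems by (simp add: lead_coeff_power)
  then show ?case using Suc second_coeff_mult[of f "f ^ n"] by (simp add: algebra_simps)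
qed simp

lemma second_coeff_prod_linear:
  "second_coeff (\<Prod>i<(t::nat). [:- a i, 1:]) = - (\<Sum>i<t. a i)"
proof (induction t)
  case (Suc t)
  have "lead_coeff (\<Prod>i<t. [:- a i, 1:]) = 1" by (simp add: lead_coeff_prod)
  moreover have "second_coeff [:- a t, 1:] = - a t" by (simp add: coeff_reflect_poly)
  ultimately show ?case using Suc second_coeff_mult[of "\<Prod>i<t. [:- a i, 1:]" "[:- a t, 1:]"]
    by (simp add: mult.commute)
qed simp

lemma char_poly_matrix_index:
  "A \<in> carrier_mat t t \<Longrightarrow> i < t \<Longrightarrow> j < t \<Longrightarrow>
    char_poly_matrix A $$ (i, j) = (if i = j then [:- A $$ (i, j), 1:] else [:- A $$ (i, j):])"
  by (simp add: char_poly_matrix_def)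

lemma second_coeff_char_poly:
  fixes A :: "'r::idom mat"
  assumes A: "A \<in> carrier_mat t t"
  shows "second_coeff (char_poly A) = - (\<Sum>i<t. A $$ (i, i))"
proof (cases "t = 0")
  case True
  then have "char_poly A = 1" using A by (simp add: char_poly_def char_poly_matrix_def)
  then show ?thesis using True by simp
next
  case t0: False
  define P where "P \<sigma> = (\<Prod>i = 0..<t. char_poly_matrix A $$ (i, \<sigma> i))" for \<sigma>
  have deg: "degree (char_poly A) = t" using degree_monic_char_poly[OF A] by simp
  \<comment> \<open>A permutation other than the identity moves at least the two indices
    \<open>i\<close> and \<open>\<sigma> i\<close>, so its product loses two factors of degree 1 and
    has degree at most \<open>t - 2\<close>.\<close>
  have low: "coeff (P \<sigma>) (t - 1) = 0" if \<sigma>: "\<sigma> permutes {0..<t}" "\<sigma> \<noteq> id" for \<sigma>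
  proof -
    obtain i where i: "\<sigma> i \<noteq> i" using \<sigma>(2) by (auto simp: fun_eq_iff)
    then have it: "i < t" using \<sigma>(1) by (metis permutes_def atLeast0LessThan lessThan_iff)
    have j: "\<sigma> (\<sigma> i) \<noteq> \<sigma> i" using i permutes_inj[OF \<sigma>(1)] by (auto dest: injD)
    have jt: "\<sigma> i < t" using permutes_in_image[OF \<sigma>(1), of i] it by simp
    have "degree (P \<sigma>) \<le> (\<Sum>k = 0..<t. degree (char_poly_matrix A $$ (k, \<sigma> k)))"
      unfolding P_def using degree_prod_sum_le[of "{0..<t}"] by (simp add: o_def)
    also have "\<dots> \<le> (\<Sum>k = 0..<t. if \<sigma> k = k then 1 else 0)"
    proof (rule sum_mono)
      fix k assume k: "k \<in> {0..<t}"
      then have "\<sigma> k < t" using permutes_in_image[OF \<sigma>(1), of k] by simp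
      then show "degree (char_poly_matrix A $$ (k, \<sigma> k)) \<le> (if \<sigma> k = k then 1 else 0)"
        using k by (auto simp: char_poly_matrix_index[OF A])
    qed
    also have "\<dots> = card {k \<in> {0..<t}. \<sigma> k = k}" by (simp add: sum.If_cases Int_def)
    also have "\<dots> \<le> card ({0..<t} - {i, \<sigma> i})" by (rule card_mono) (use i j in auto)
    also have "\<dots> = t - 2" using i it jt by (subst card_Diff_subset) auto
    finally have "degree (P \<sigma>) \<le> t - 2" .
    moreover have "t \<ge> 2" using i it jt by linarith
    ultimately show ?thesis by (intro coeff_eq_0) auto
  qed
  have "char_poly A = (\<Sum>\<sigma> | \<sigma> permutes {0..<t}. signof \<sigma> * P \<sigma>)"
    unfolding char_poly_def P_def by (rule det_def') (use A in simp)
  then have "coeff (char_poly A) (t - 1) = (\<Sum>\<sigma> | \<sigma> permutes {0..<t}. coeff (signof \<sigma> * P \<sigma>) (t - 1))"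
    by (simp add: coeff_sum)
  also have "\<dots> = (\<Sum>\<sigma> | \<sigma> permutes {0..<t}. if \<sigma> = id then coeff (P id) (t - 1) else 0)"
  proof (intro sum.cong refl)
    fix \<sigma> assume "\<sigma> \<in> {\<sigma>. \<sigma> permutes {0..<t}}"
    then show "coeff (signof \<sigma> * P \<sigma>) (t - 1) = (if \<sigma> = id then coeff (P id) (t - 1) else 0)"
      using low[of \<sigma>] by (cases \<sigma> rule: sign_cases) (auto simp: sign_id)
  qed
  also have "\<dots> = coeff (P id) (t - 1)"
    by (simp add: finite_permutations permutes_id)
  finally have c: "coeff (char_poly A) (t - 1) = coeff (P id) (t - 1)" .
  have Pid: "P id = (\<Prod>i<t. [:- A $$ (i, i), 1:])"
    unfolding P_def atLeast0LessThan by (intro prod.cong) (auto simp: char_poly_matrix_index[OF A])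
  have "degree (P id) = t" unfolding Pid by (subst degree_prod_eq_sum_degree) auto
  then have "coeff (P id) (t - 1) = second_coeff (P id)" using t0 by (simp add: coeff_reflect_poly)
  moreover have "coeff (char_poly A) (t - 1) = second_coeff (char_poly A)"
    using t0 deg by (simp add: coeff_reflect_poly)
  ultimately show ?thesis using c second_coeff_prod_linear[of "\<lambda>i. A $$ (i, i)" t] by (simp add: Pid)
qed

text \<open>If \<open>f(X) = 0\<close>, then \<open>f(x) = f(x) - f(X)\<close> is a multiple of \<open>x - X\<close>.\<close>

lemma char_poly_dvd_power:
  assumes B: "is_basis t b C" and X: "V.linear_op X" and XC: "\<And>x. x \<in> C \<Longrightarrow> X x \<in> C"
    and f: "\<And>x. x \<in> C \<Longrightarrow> poly_act f X x = 0"
  shows "char_poly (mat t t (\<lambda>(i, j). coord t b (X (b j)) i)) dvd f ^ t"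
proof -
  define M where "M i j = coord t b (X (b j)) i" for i j
  define N where "N f i j = coord t b (poly_act f X (b j)) i" for f i j
  have C: "V.subspace C" by (rule is_basis_subspace[OF B])
  have N: "N (pCons a f) i j = (if i = j then a else 0) + (\<Sum>k<t. M i k * N f k j)" if "i < t" "j < t" for a f i j
  proof -
    define y where "y = poly_act f X (b j)"
    have y: "y \<in> C" unfolding y_def by (rule poly_act_mem[OF X C XC basis_mem[OF B that(2)]])
    have "X y = (\<Sum>k<t. smult (coord t b y k) (X (b k)))"
      using linear_comb[OF X, of t b "coord t b y"] comb_coord[OF B y] by simp
    then have "coord t b (X y) i = (\<Sum>k<t. coord t b (smult (coord t b y k) (X (b k))) i)"
      using coord_sum[OF B, of "{..<t}" "\<lambda>k. smult (coord t b y k) (X (b k))" i] that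
        V.subspace_scale[OF C XC[OF basis_mem[OF B]]] by simp
    also have "\<dots> = (\<Sum>k<t. M i k * N f k j)"
      using that XC basis_mem[OF B] by (intro sum.cong refl) (simp add: coord_smult[OF B] M_def N_def y_def)
    finally have "coord t b (X y) i = (\<Sum>k<t. M i k * N f k j)" .
    moreover have "N (pCons a f) i j = coord t b (smult a (b j)) i + coord t b (X y) i"
      unfolding N_def poly_act_pCons[OF X] y_def[symmetric]
      using that y XC V.subspace_scale[OF C basis_mem[OF B]] by (intro coord_add[OF B]) auto
    moreover have "coord t b (smult a (b j)) i = (if i = j then a else 0)"
      using that basis_mem[OF B] by (simp add: coord_smult[OF B] coord_basis[OF B])
    ultimately show ?thesis by simp
  qed
  \<comment> \<open>\<open>G\<close> is the quotient of \<open>f(x) - f(X)\<close> by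
    \<open>x - X\<close> as a matrix of polynomials, built along Horner's scheme.\<close>
  have "\<exists>G. \<forall>i<t. \<forall>j<t. [:0, 1:] * G i j - (\<Sum>k<t. [:M i k:] * G k j) =
      (if i = j then f else 0) - [:N f i j:]" for f
  proof (induction f)
    case 0
    have "\<forall>i<t. \<forall>j<t. N 0 i j = 0" by (simp add: N_def coord_0[OF B])
    then show ?case by (intro exI[of _ "\<lambda>_ _. 0"]) simp
  next
    case (pCons a f)
    then obtain G where G: "\<And>i j. i < t \<Longrightarrow> j < t \<Longrightarrow>
        [:0, 1:] * G i j - (\<Sum>k<t. [:M i k:] * G k j) = (if i = j then f else 0) - [:N f i j:]" by blast
    \<comment> \<open>For \<open>a + x f\<close> the quotient is \<open>x G + f(X)\<close>, because
      \<open>x f(x) - X f(X) = x (f(x) - f(X)) + (x - X) f(X)\<close>.\<close>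
    define H where "H i j = [:0, 1:] * G i j + [:N f i j:]" for i j
    have "[:0, 1:] * H i j - (\<Sum>k<t. [:M i k:] * H k j) =
        (if i = j then pCons a f else 0) - [:N (pCons a f) i j:]" if "i < t" "j < t" for i j
    proof -
      have s: "(\<Sum>k<t. [:M i k * N f k j:]) = [:\<Sum>k<t. M i k * N f k j:]"
        by (induction t) (simp_all)
      have "[:0, 1:] * H i j - (\<Sum>k<t. [:M i k:] * H k j) =
          [:0, 1:] * ([:0, 1:] * G i j - (\<Sum>k<t. [:M i k:] * G k j)) + [:0, 1:] * [:N f i j:] -
          (\<Sum>k<t. [:M i k * N f k j:])"
        by (simp add: H_def sum.distrib algebra_simps sum_distrib_left del: mult_pCons_left mult_pCons_right)
           (simp add: mult.commute)
      also have "\<dots> = [:0, 1:] * (if i = j then f else 0) - [:\<Sum>k<t. M i k * N f k j:]"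
        unfolding G[OF that] s by (simp add: right_diff_distrib)
      also have "\<dots> = (if i = j then pCons a f else 0) - [:N (pCons a f) i j:]"
        using N[OF that, of a f] by simp
      finally show ?thesis .
    qed
    then show ?case by blast
  qed
  then obtain G where G: "\<And>i j. i < t \<Longrightarrow> j < t \<Longrightarrow>
      [:0, 1:] * G i j - (\<Sum>k<t. [:M i k:] * G k j) = (if i = j then f else 0) - [:N f i j:]" by blast
  have N0: "N f i j = 0" if "i < t" "j < t" for i j
    using that f[OF basis_mem[OF B]] by (simp add: N_def coord_0[OF B])
  define A where "A = mat t t (\<lambda>(i, j). M i j)"
  define Gm where "Gm = mat t t (\<lambda>(i, j). G i j)"
  have A: "A \<in> carrier_mat t t" and Gm: "Gm \<in> carrier_mat t t" by (auto simp: A_def Gm_def)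
  have AM: "A $$ (i, j) = M i j" if "i < t" "j < t" for i j using that by (simp add: A_def)
  have "char_poly_matrix A * Gm = f \<cdot>\<^sub>m 1\<^sub>m t"
  proof (rule eq_matI)
    fix i j assume "i < dim_row (f \<cdot>\<^sub>m 1\<^sub>m t)" "j < dim_col (f \<cdot>\<^sub>m 1\<^sub>m t)"
    then have ij: "i < t" "j < t" by auto
    have "(char_poly_matrix A * Gm) $$ (i, j) = (\<Sum>k = 0..<t. char_poly_matrix A $$ (i, k) * Gm $$ (k, j))"
      using ij char_poly_matrix_closed[OF A] Gm by (simp add: scalar_prod_def)
    also have "\<dots> = (\<Sum>k<t. ((if i = k then [:0, 1:] else 0) - [:M i k:]) * G k j)"
      unfolding atLeast0LessThan
      by (intro sum.cong refl) (use ij AM in \<open>auto simp: char_poly_matrix_index[OF A] Gm_def\<close>)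
    also have "\<dots> = (\<Sum>k<t. (if i = k then [:0, 1:] * G k j else 0)) - (\<Sum>k<t. [:M i k:] * G k j)"
      unfolding sum_subtractf[symmetric] by (intro sum.cong refl) (simp add: left_diff_distrib)
    also have "\<dots> = [:0, 1:] * G i j - (\<Sum>k<t. [:M i k:] * G k j)" using ij by simp
    also have "\<dots> = (f \<cdot>\<^sub>m 1\<^sub>m t) $$ (i, j)" using G[OF ij] N0[OF ij] ij by simp
    finally show "(char_poly_matrix A * Gm) $$ (i, j) = (f \<cdot>\<^sub>m 1\<^sub>m t) $$ (i, j)" .
  qed (use char_poly_matrix_closed[OF A] Gm in auto)
  \<comment> \<open>Determinants turn the matrix identity \<open>(x - X) G = f\<close> into a
    factorization of \<open>f ^ t\<close>.\<close>
  then have "det (char_poly_matrix A) * det Gm = f ^ t"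
    using det_mult[OF char_poly_matrix_closed[OF A] Gm] by (simp add: det_smult)
  then have "char_poly A dvd f ^ t" unfolding char_poly_def by (metis dvd_triv_left)
  then show ?thesis by (simp add: A_def M_def)
qed

text \<open>Primality lets one factor \<open>f\<close> at a time be cancelled from \<open>p\<close>
  or from \<open>q\<close>.\<close>

lemma prime_elem_power_factor:
  fixes f :: "'a::idom"
  assumes f: "prime_elem f" and "p * q = f ^ t"
  shows "\<exists>u s. u dvd 1 \<and> p = u * f ^ s"
  using assms(2)
proof (induction t arbitrary: p q)
  case 0
  then have "p dvd 1" by (metis dvd_triv_left power_0)
  then show ?case by (intro exI[of _ p] exI[of _ 0]) simp
next
  case (Suc t)
  have "f dvd p * q" using Suc.prems by simp
  with f consider "f dvd p" | "f dvd q" by (auto dest: prime_elem_dvd_multD)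
  then show ?case
  proof cases
    case 1
    then obtain p' where p': "p = f * p'" by (auto elim: dvdE)
    then have "p' * q = f ^ t" using Suc.prems f by (simp add: mult.assoc prime_elem_not_zeroI)
    from Suc.IH[OF this] obtain u s where "u dvd 1" "p' = u * f ^ s" by blast
    then show ?thesis using p' by (intro exI[of _ u] exI[of _ "Suc s"]) (simp add: mult_ac)
  next
    case 2
    then obtain q' where q': "q = f * q'" by (auto elim: dvdE)
    then have "f * (p * q') = f * f ^ t" using Suc.prems by (simp add: mult_ac)
    then have "p * q' = f ^ t" using f by (simp add: prime_elem_not_zeroI)
    from Suc.IH[OF this] show ?thesis .
  qed
qed

text \<open>Over the fraction field \<open>f\<close> is prime, so \<open>p\<close> is a unit times a
  power of \<open>f\<close>. Both are monic, so the unit is 1, and the equation descends because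
  \<open>fract_poly\<close> is injective.\<close>

lemma monic_dvd_irreducible_power:
  fixes f p :: "'r::idom poly"
  assumes "irreducible (fract_poly f)" "lead_coeff f = 1" "lead_coeff p = 1" "p dvd f ^ t"
  shows "\<exists>s. p = f ^ s"
proof -
  obtain q where q: "p * q = f ^ t" using assms(4) by (metis dvdE)
  have fp: "fract_poly (f ^ k) = fract_poly f ^ k" for k by (induction k) simp_all
  have "fract_poly p * fract_poly q = fract_poly f ^ t" using q by (simp flip: fp fract_poly_mult)
  then obtain u s where u: "u dvd 1" "fract_poly p = u * fract_poly f ^ s"
    using prime_elem_power_factor[OF field_poly_irreducible_imp_prime[OF assms(1)]] by blast
  obtain c where c: "u = [:c:]" using u(1) by (meson is_unit_poly_iff)
  have lf: "lead_coeff (fract_poly g) = to_fract (lead_coeff g)" for g :: "'r poly"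
    by (simp add: coeff_map_poly degree_map_poly)
  have "lead_coeff (fract_poly p) = c * lead_coeff (fract_poly f) ^ s"
    unfolding u(2) c by (simp add: lead_coeff_mult lead_coeff_power)
  then have "c = 1" using assms by (simp add: lf)
  then have "fract_poly p = fract_poly (f ^ s)" using u(2) c fp by simp
  then show ?thesis by auto
qed

text \<open>The characteristic polynomial is monic and divides \<open>f ^ t\<close>, hence equals
  \<open>f ^ s\<close> with \<open>t = s * degree f\<close>, and its second coefficient is
  \<open>s\<close> times that of \<open>f\<close>. Multiplying by the degree keeps the identity in
  R.\<close>

theorem trace_annihilated:
  fixes f :: "'r::idom poly"
  assumes B: "is_basis t b C" and X: "V.linear_op X" and XC: "\<And>x. x \<in> C \<Longrightarrow> X x \<in> C"
    and "irreducible (fract_poly f)" "lead_coeff f = 1" "\<And>x. x \<in> C \<Longrightarrow> poly_act f X x = 0"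
  shows "of_nat (degree f) * submodule_trace C X = of_nat t * - second_coeff f"
proof -
  define A where "A = mat t t (\<lambda>(i, j). coord t b (X (b j)) i)"
  have A: "A \<in> carrier_mat t t" by (simp add: A_def)
  have "char_poly A dvd f ^ t" unfolding A_def by (rule char_poly_dvd_power[OF B X XC assms(6)])
  then obtain s where s: "char_poly A = f ^ s"
    using monic_dvd_irreducible_power[OF assms(4,5)] degree_monic_char_poly[OF A] by metis
  have "f \<noteq> 0" using assms(5) by auto
  then have t: "t = s * degree f"
    using degree_monic_char_poly[OF A] s by (simp add: degree_power_eq mult.commute)
  have "submodule_trace C X = (\<Sum>i<t. A $$ (i, i))"
    using submodule_trace_eq[OF B X XC] by (simp add: basis_trace_def A_def)
  also have "\<dots> = - second_coeff (char_poly A)" using second_coeff_char_poly[OF A] by simp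
  also have "\<dots> = of_nat s * - second_coeff f"
    using second_coeff_power[OF assms(5), of s] by (simp add: s)
  finally show ?thesis by (simp add: t)
qed

section \<open>Isotypic decomposition\<close>

context dvr
begin

lemma prime_uniformizer: "prime_elem \<pi>"
proof (rule prime_elemI)
  fix a b assume "\<pi> dvd a * b"
  show "\<pi> dvd a \<or> \<pi> dvd b"
  proof (rule ccontr)
    assume "\<not> ?thesis"
    then have "a dvd 1" "b dvd 1" using not_dvd_imp_unit by auto
    then have "a * b dvd 1" by simp
    then show False using \<open>\<pi> dvd a * b\<close> uniformizer_nonunit dvd_trans by blast
  qed
qed (use uniformizer_nonzero uniformizer_nonunit in auto)

lemma to_fract_eq_1: "to_fract (x :: 'r) = 1 \<longleftrightarrow> x = 1"
  by (metis to_fract_1 to_fract_eq_iff)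

lemma fract_poly_pCons: "fract_poly (pCons (x :: 'r) y) = pCons (to_fract x) (fract_poly y)"
  by (intro poly_eqI) (simp add: coeff_pCons coeff_map_poly split: nat.split)

lemma fract_poly_power_smult:
  "fract_poly (smult (\<pi> ^ k) f) = smult (to_fract \<pi> ^ k) (fract_poly f)"
proof -
  have "to_fract (\<pi> ^ k) = to_fract \<pi> ^ k" by (induction k) simp_all
  then show ?thesis by simp
qed

lemma clear_denominators:
  fixes a :: "'r fract poly"
  shows "\<exists>k a1. smult (to_fract \<pi> ^ k) a = fract_poly a1"
proof (induction a)
  case 0
  then show ?case by (intro exI[of _ 0]) simp
next
  case (pCons c a)
  then obtain k a1 where a1: "smult (to_fract \<pi> ^ k) a = fract_poly a1" by blast
  obtain n d where nd: "c = Fract n d" "d \<noteq> 0" by (cases c)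
  obtain u l where u: "u dvd 1" "d = u * \<pi> ^ l" using factorization[OF nd(2)] by blast
  obtain w where w: "1 = u * w" using u(1) by (auto elim: dvdE)
  have tp: "to_fract (\<pi> ^ j) = to_fract \<pi> ^ j" for j by (induction j) simp_all
  have "n * (u * w) = n" using w by simp
  then have "to_fract \<pi> ^ l * c = to_fract (w * n)"
    unfolding tp[symmetric] nd(1) using nd(2) u(2)
    using uniformizer_nonzero by (simp add: to_fract_def eq_fract mult_ac)
  then have c: "to_fract \<pi> ^ (k + l) * c = to_fract (\<pi> ^ k * (w * n))"
    by (simp add: power_add mult.assoc tp)
  have "smult (to_fract \<pi> ^ (k + l)) a = smult (to_fract \<pi> ^ l) (smult (to_fract \<pi> ^ k) a)"
    by (simp add: power_add mult.commute)
  also have "\<dots> = fract_poly (smult (\<pi> ^ l) a1)" by (simp only: a1 fract_poly_power_smult)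
  finally have "smult (to_fract \<pi> ^ (k + l)) (pCons c a) = fract_poly (pCons (\<pi> ^ k * (w * n)) (smult (\<pi> ^ l) a1))"
    using c by (simp add: fract_poly_pCons)
  then show ?case by blast
qed

text \<open>If \<open>\<pi>\<close> divided the numerator at the least exponent, a smaller exponent
  would do, unless the exponent is already 0.\<close>

lemma minimal_denominator:
  fixes a :: "'r fract poly"
  shows "\<exists>k a1. smult (to_fract \<pi> ^ k) a = fract_poly a1 \<and> (k = 0 \<or> \<not> [:\<pi>:] dvd a1)"
proof -
  define P where "P k \<longleftrightarrow> (\<exists>a1. smult (to_fract \<pi> ^ k) a = fract_poly a1)" for k
  define k where "k = (LEAST k. P k)"
  have "\<exists>k. P k" using clear_denominators[of a] by (auto simp: P_def)
  then have "P k" unfolding k_def by (rule LeastI_ex)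
  then obtain a1 where a1: "smult (to_fract \<pi> ^ k) a = fract_poly a1" by (auto simp: P_def)
  have "\<not> [:\<pi>:] dvd a1" if "k \<noteq> 0"
  proof
    assume "[:\<pi>:] dvd a1"
    then obtain a2 where "a1 = smult \<pi> a2" by (auto elim: dvdE)
    then have "smult (to_fract \<pi>) (smult (to_fract \<pi> ^ (k - 1)) a) = smult (to_fract \<pi>) (fract_poly a2)"
      using a1 that by (simp add: power_eq_if)
    then have "P (k - 1)" unfolding P_def using uniformizer_nonzero
      by (metis smult_cancel to_fract_eq_0_iff)
    then have "k \<le> k - 1" unfolding k_def by (rule Least_le)
    then show False using that by simp
  qed
  then show ?thesis using a1 by (intro exI[of _ k] exI[of _ a1]) auto
qed

text \<open>Up to units, denominators are powers of \<open>\<pi>\<close>, which stays prime in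
  \<open>R[x]\<close>. The cleared factors are not divisible by \<open>\<pi>\<close>, hence neither
  is their product, which is \<open>\<pi> ^ (k + l)\<close> times \<open>f\<close>; so
  \<open>k + l = 0\<close>.\<close>

lemma Gauss_monic:
  fixes a b :: "'r fract poly" and f :: "'r poly"
  assumes "a * b = fract_poly f" "lead_coeff a = 1" "lead_coeff b = 1"
  shows "\<exists>a1. a = fract_poly a1"
proof -
  obtain k a1 where a1: "smult (to_fract \<pi> ^ k) a = fract_poly a1" "k = 0 \<or> \<not> [:\<pi>:] dvd a1"
    using minimal_denominator by blast
  obtain l b1 where b1: "smult (to_fract \<pi> ^ l) b = fract_poly b1" "l = 0 \<or> \<not> [:\<pi>:] dvd b1"
    using minimal_denominator by blast
  have "fract_poly (a1 * b1) = smult (to_fract \<pi> ^ (k + l)) (a * b)"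
    by (simp add: a1(1)[symmetric] b1(1)[symmetric] power_add mult.commute)
  also have "\<dots> = fract_poly (smult (\<pi> ^ (k + l)) f)" by (simp only: assms fract_poly_power_smult)
  finally have ab: "a1 * b1 = smult (\<pi> ^ (k + l)) f" by (simp only: fract_poly_eq_iff)
  \<comment> \<open>At exponent 0 minimality says nothing; there the leading coefficient 1 excludes
    divisibility by \<open>\<pi>\<close>.\<close>
  have unit: "\<not> [:\<pi>:] dvd c" if "smult (to_fract \<pi> ^ 0) d = fract_poly c" "lead_coeff d = 1" for c d
  proof
    assume "[:\<pi>:] dvd c"
    then have "\<pi> dvd coeff c (degree c)" by (auto elim!: dvdE)
    moreover have "to_fract (lead_coeff c) = lead_coeff (fract_poly c)"
      by (simp add: coeff_map_poly degree_map_poly)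
    then have "to_fract (lead_coeff c) = 1" using that by simp
    then have "lead_coeff c = 1" unfolding to_fract_eq_1 .
    ultimately show False using uniformizer_nonunit by simp
  qed
  have "\<not> [:\<pi>:] dvd a1" "\<not> [:\<pi>:] dvd b1"
    using a1 b1 unit assms by metis+
  then have "\<not> [:\<pi>:] dvd a1 * b1"
    using lift_prime_elem_poly[OF prime_uniformizer] prime_elem_dvd_multD by blast
  moreover have "[:\<pi>:] dvd smult (\<pi> ^ Suc j) f" for j
    by (rule dvdI[of _ _ "smult (\<pi> ^ j) f"]) (simp add: mult.commute)
  ultimately have "k + l = 0" unfolding ab by (metis not0_implies_Suc)
  then show ?thesis using a1 by auto
qed

theorem monic_factorization:
  fixes F :: "'r poly"
  assumes "lead_coeff F = 1"
  shows "\<exists>fs. F = prod_list fs \<and> (\<forall>f\<in>set fs. lead_coeff f = 1 \<and> irreducible (fract_poly f))"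
  using assms
proof (induction "degree F" arbitrary: F rule: less_induct)
  case less
  have lf: "lead_coeff (fract_poly g) = to_fract (lead_coeff g)" for g :: "'r poly"
    by (simp add: coeff_map_poly degree_map_poly)
  have df: "degree (fract_poly g) = degree g" for g :: "'r poly" by (simp add: degree_map_poly)
  have F0: "F \<noteq> 0" using less.prems by auto
  show ?case
  proof (cases "degree F = 0 \<or> irreducible (fract_poly F)")
    case True
    then show ?thesis
    proof
      assume "degree F = 0"
      then have "F = 1" using less.prems by (auto elim!: degree_eq_zeroE simp: one_pCons)
      then show ?thesis by (intro exI[of _ "[]"]) simp
    next
      assume "irreducible (fract_poly F)"
      then show ?thesis using less.prems by (intro exI[of _ "[F]"]) simp
    qed
  next
    case False
    have "\<not> fract_poly F dvd 1"
      using False F0 df[of F] by (auto simp: poly_dvd_1)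
    with False F0 obtain a b where ab: "fract_poly F = a * b" "\<not> a dvd 1" "\<not> b dvd 1"
      unfolding irreducible_def by auto
    have nz: "a \<noteq> 0" "b \<noteq> 0" using ab(1) F0 by auto
    have deg: "degree a > 0" "degree b > 0" using ab nz by (auto simp: poly_dvd_1)
    define a' where "a' = smult (inverse (lead_coeff a)) a"
    define b' where "b' = smult (inverse (lead_coeff b)) b"
    have "lead_coeff a * lead_coeff b = 1"
      using lf[of F] less.prems by (simp add: ab(1) lead_coeff_mult)
    then have "inverse (lead_coeff a) * inverse (lead_coeff b) = 1"
      by (metis inverse_1 inverse_mult_distrib mult.commute)
    then have prod: "a' * b' = fract_poly F" by (simp add: a'_def b'_def ab(1) mult.commute)
    have m: "lead_coeff a' = 1" "lead_coeff b' = 1" using nz by (auto simp: a'_def b'_def)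
    obtain a1 where a1: "a' = fract_poly a1" using Gauss_monic[OF prod m] by blast
    obtain b1 where b1: "b' = fract_poly b1"
      using Gauss_monic[of b' a' F] prod m by (auto simp: mult.commute)
    have "to_fract (lead_coeff a1) = 1" "to_fract (lead_coeff b1) = 1"
      using lf[of a1] lf[of b1] m unfolding a1 b1 by simp_all
    then have m1: "lead_coeff a1 = 1" "lead_coeff b1 = 1" unfolding to_fract_eq_1 .
    have "fract_poly (a1 * b1) = fract_poly F" using prod unfolding a1 b1 by simp
    then have F: "F = a1 * b1" by (metis fract_poly_eq_iff)
    have "degree a1 > 0" "degree b1 > 0"
      using deg df[of a1] df[of b1] nz unfolding a1[symmetric] b1[symmetric] a'_def b'_def by simp_all
    moreover have "degree F = degree a1 + degree b1" unfolding F using m1 by (intro degree_mult_eq) auto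
    ultimately have "degree a1 < degree F" "degree b1 < degree F" by simp_all
    from less.hyps[OF this(1) m1(1)] less.hyps[OF this(2) m1(2)] obtain fs gs where
      "a1 = prod_list fs" "b1 = prod_list gs"
      "\<forall>f\<in>set fs. lead_coeff f = 1 \<and> irreducible (fract_poly f)"
      "\<forall>f\<in>set gs. lead_coeff f = 1 \<and> irreducible (fract_poly f)" by blast
    then show ?thesis using F by (intro exI[of _ "fs @ gs"]) auto
  qed
qed

end

section \<open>Idempotents attached to the monic factors of \<open>x^m - 1\<close>\<close>

locale factored_order = dvr \<pi> for \<pi> :: "'r::idom" +
  fixes m s :: nat and w :: 'r and f :: "nat \<Rightarrow> 'r poly"
  assumes w: "w * of_nat m = 1"
    and prod_f: "(\<Prod>i<s. f i) = monom 1 m - 1"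
    and monic: "i < s \<Longrightarrow> lead_coeff (f i) = 1"
    and irred: "i < s \<Longrightarrow> irreducible (fract_poly (f i))"
    and char_0: "n > 0 \<Longrightarrow> of_nat n \<noteq> (0 :: 'r)"
begin

text \<open>
  Differentiating \<open>x\<^sup>m - 1 = \<Prod>\<^sub>i f\<^sub>i\<close> and multiplying by \<open>x / m\<close> expresses \<open>x\<^sup>m\<close>, hence \<open>1\<close>
  modulo \<open>x\<^sup>m - 1\<close>, as the sum of the following polynomials.
\<close>

definition idem :: "nat \<Rightarrow> 'r poly" where
  "idem i = smult w (monom 1 1 * (pderiv (f i) * (\<Prod>j\<in>{..<s} - {i}. f j)))"

lemma m_pos: "m > 0"
  using w by (cases m) auto

lemma prod_f_remove: "i < s \<Longrightarrow> f i * (\<Prod>j\<in>{..<s} - {i}. f j) = monom 1 m - 1"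
  unfolding prod_f[symmetric] by (subst prod.remove[of _ i]) auto

text \<open>The right side is \<open>monom 1 m\<close>, written so as to show that the
  \<open>idem i\<close> sum to 1 modulo \<open>x^m - 1\<close>.\<close>

lemma sum_idem: "(\<Sum>i<s. idem i) = 1 + (monom 1 m - 1)"
proof -
  have "(\<Sum>i<s. idem i) = smult w (monom 1 1 * pderiv (monom 1 m - 1))"
    unfolding prod_f[symmetric] pderiv_prod idem_def
    by (simp add: V.scale_sum_right sum_distrib_left mult.commute)
  also have "\<dots> = smult w (monom (of_nat m) m)"
    using m_pos by (simp add: pderiv_diff pderiv_monom mult_monom)
  also have "\<dots> = monom 1 m" using w by (simp add: smult_monom)
  finally show ?thesis by simp
qed

lemma dvd_f_idem: "i < s \<Longrightarrow> monom 1 m - 1 dvd f i * idem i"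
proof -
  assume i: "i < s"
  have "f i * idem i = smult w (monom 1 1 * pderiv (f i)) * (f i * (\<Prod>j\<in>{..<s} - {i}. f j))"
    by (simp add: idem_def mult_ac)
  then show ?thesis unfolding prod_f_remove[OF i] by (metis dvd_triv_right)
qed

text \<open>\<open>idem i\<close> contains every factor \<open>f j\<close> with
  \<open>j \<noteq> i\<close>, and \<open>f j * idem j\<close> is already a multiple of
  \<open>x^m - 1\<close>.\<close>

lemma dvd_idem_idem:
  assumes "i < s" "j < s" "i \<noteq> j"
  shows "monom 1 m - 1 dvd idem i * idem j"
proof -
  have "f j dvd (\<Prod>j\<in>{..<s} - {i}. f j)" using assms by (intro dvd_prodI) auto
  then have "f j dvd idem i" unfolding idem_def by (intro dvd_smult dvd_mult)
  then have "f j * idem j dvd idem i * idem j" by (rule mult_dvd_mono) simp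
  then show ?thesis using dvd_f_idem[OF assms(2)] dvd_trans by blast
qed

end

locale factored_order_op = factored_order +
  fixes h :: "'a poly \<Rightarrow> 'a poly"
  assumes h: "V.linear_op h" and h_order: "(h ^^ m) x = x"
begin

definition E :: "nat \<Rightarrow> 'a poly \<Rightarrow> 'a poly" where
  "E i = poly_act (idem i) h"

lemma linear_E: "V.linear_op (E i)"
  unfolding E_def by (rule linear_poly_act[OF h])

lemma act_multiple_0: "monom 1 m - 1 dvd q \<Longrightarrow> poly_act q h x = 0"
proof -
  assume "monom 1 m - 1 dvd q"
  then obtain q' where q: "q = q' * (monom 1 m - 1)" by (metis dvdE mult.commute)
  have "poly_act (monom 1 m - 1) h x = 0"
    by (simp add: poly_act_diff[OF h] poly_act_monom[OF h] poly_act_1[OF h] h_order)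
  then show ?thesis unfolding q poly_act_mult[OF h] using V.linear_op_0[OF linear_poly_act[OF h]] by simp
qed

lemma sum_E: "(\<Sum>i<s. E i x) = x"
proof -
  have "(\<Sum>i<s. E i x) = poly_act (\<Sum>i<s. idem i) h x" by (simp add: E_def poly_act_sum[OF h])
  also have "\<dots> = x"
    unfolding sum_idem using act_multiple_0[of "monom 1 m - 1" x]
    by (simp only: poly_act_add[OF h] poly_act_1[OF h] dvd_refl simp_thms add_0_right)
  finally show ?thesis .
qed

lemma E_orth: "i < s \<Longrightarrow> j < s \<Longrightarrow> i \<noteq> j \<Longrightarrow> E i (E j x) = 0"
  unfolding E_def poly_act_mult[OF h, symmetric] by (rule act_multiple_0[OF dvd_idem_idem])

lemma E_idem: "i < s \<Longrightarrow> E i (E i x) = E i x"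
proof -
  assume i: "i < s"
  have "E i (E i x) = (\<Sum>j<s. E j (E i x))"
    using i by (subst sum.remove[of _ i]) (auto simp: E_orth)
  then show ?thesis by (simp add: sum_E)
qed

lemma f_E: "i < s \<Longrightarrow> poly_act (f i) h (E i x) = 0"
  unfolding E_def poly_act_mult[OF h, symmetric] by (rule act_multiple_0[OF dvd_f_idem])

lemma E_commute: "V.linear_op T \<Longrightarrow> (\<And>x. T (h x) = h (T x)) \<Longrightarrow> E i (T x) = T (E i x)"
  unfolding E_def by (rule poly_act_commute[OF h])

lemma h_E: "h (E i x) = E i (h x)"
  by (rule E_commute[OF h, symmetric]) simp

definition stable :: "'a poly set \<Rightarrow> bool" where
  "stable P \<longleftrightarrow> V.subspace P \<and> h ` P \<subseteq> P"

lemma stableD: "stable P \<Longrightarrow> V.subspace P" "stable P \<Longrightarrow> x \<in> P \<Longrightarrow> h x \<in> P"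
  by (auto simp: stable_def)

lemma E_mem: "stable P \<Longrightarrow> x \<in> P \<Longrightarrow> E i x \<in> P"
  unfolding E_def using poly_act_mem[OF h, of P] by (auto simp: stable_def)

lemma E_image_subset: "stable P \<Longrightarrow> E i ` P \<subseteq> P"
  using E_mem by auto

lemma E_fix: "i < s \<Longrightarrow> x \<in> E i ` P \<Longrightarrow> E i x = x"
  using E_idem by auto

lemma stable_E_image: "stable P \<Longrightarrow> stable (E i ` P)"
  using V.subspace_linear_image[OF linear_E] by (auto simp: stable_def h_E)

lemma E_image_Int:
  assumes "stable Q" "Q \<subseteq> P" "i < s"
  shows "Q \<inter> E i ` P = E i ` Q"
proof (intro equalityI subsetI)
  fix x assume "x \<in> Q \<inter> E i ` P"
  then have "x = E i x" "x \<in> Q" using E_fix[OF assms(3), of x P] by simp_all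
  then show "x \<in> E i ` Q" by (rule image_eqI)
next
  fix x assume "x \<in> E i ` Q"
  then show "x \<in> Q \<inter> E i ` P" using E_image_subset[OF assms(1)] assms(2) by blast
qed

text \<open>The \<open>i\<close>-th component of \<open>P / Q\<close> seen in two ways;
  \<open>E_image_Int\<close> computes the intersection in the second isomorphism theorem.\<close>

lemma len_E_image:
  assumes "stable Q" "stable P" "Q \<subseteq> P" "i < s"
  shows "V.len Q (E i ` P + Q) = V.len (E i ` Q) (E i ` P)"
  using V.len_plus[OF stableD(1)[OF assms(1)] stableD(1)[OF stable_E_image[OF assms(2)]]]
    E_image_Int[OF assms(1,3,4)] by (simp add: add.commute)

text \<open>The mean of the roots of \<open>f i\<close>, that is the average eigenvalue of
  \<open>h\<close> on a lattice killed by \<open>f i(h)\<close>.\<close>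

definition \<kappa> :: "nat \<Rightarrow> 'a fract" where
  "\<kappa> i = to_fract (- second_coeff (f i)) / of_nat (degree (f i))"

lemma of_nat_to_fract: "to_fract (of_nat n) = of_nat n"
  by (induction n) simp_all

lemma to_fract_sum: "to_fract (sum g I) = (\<Sum>i\<in>I. to_fract (g i))"
  by (induct I rule: infinite_finite_induct) simp_all

theorem trace_decomposition:
  assumes P: "stable P" "P \<subseteq> below_degree r"
  shows "to_fract (submodule_trace P h) = (\<Sum>i<s. \<kappa> i * of_nat (the_enat (rk (E i ` P))))"
proof -
  obtain t b where B: "is_basis t b P" using exists_basis[OF stableD(1)[OF P(1)] P(2)] by blast
  have "(\<lambda>x. \<Sum>i<s. smult 1 (h (E i x))) = h"
    using sum_E by (simp add: V.linear_op_sum[OF h, symmetric] fun_eq_iff)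
  then have "submodule_trace P h = submodule_trace P (\<lambda>x. \<Sum>i<s. smult 1 (h (E i x)))" by simp
  also have "\<dots> = (\<Sum>i<s. 1 * submodule_trace P (\<lambda>x. h (E i x)))"
    by (rule submodule_trace_sum[OF B]) (use P linear_op_comp[OF h linear_E] E_mem stableD in auto)
  finally have "to_fract (submodule_trace P h) = (\<Sum>i<s. to_fract (submodule_trace P (\<lambda>x. h (E i x))))"
    by (simp add: to_fract_sum)
  also have "\<dots> = (\<Sum>i<s. \<kappa> i * of_nat (the_enat (rk (E i ` P))))"
  proof (intro sum.cong refl)
    fix i assume "i \<in> {..<s}"
    then have i: "i < s" by simp
    have st: "stable (E i ` P)" "E i ` P \<subseteq> P" using stable_E_image E_image_subset P by auto
    obtain c d where C: "is_basis c d (E i ` P)"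
      using exists_basis[OF stableD(1)[OF st(1)], of r] st(2) P(2) by blast
    have "submodule_trace P (\<lambda>x. h (E i x)) = 1 * submodule_trace (E i ` P) h"
    proof (rule submodule_trace_comp_projection[OF B C st(2) h linear_E])
      show "h x \<in> E i ` P" if "x \<in> E i ` P" for x using stableD(2)[OF st(1) that] .
      show "E i x \<in> E i ` P" if "x \<in> P" for x using that by (rule imageI)
      show "E i x = smult 1 x" if "x \<in> E i ` P" for x using E_fix[OF i that] by simp
      show "h (E i x) \<in> P" if "x \<in> P" for x using stableD(2)[OF P(1) E_mem[OF P(1) that]] .
    qed
    then have eq: "submodule_trace P (\<lambda>x. h (E i x)) = submodule_trace (E i ` P) h" by simp
    have "of_nat (degree (f i)) * submodule_trace (E i ` P) h = of_nat c * - second_coeff (f i)"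
      by (rule trace_annihilated[OF C h _ irred[OF i] monic[OF i]]) (use st f_E[OF i] stableD in auto)
    then have "to_fract (of_nat (degree (f i)) * submodule_trace (E i ` P) h) =
        to_fract (of_nat c * - second_coeff (f i))" by simp
    then have tr: "of_nat (degree (f i)) * to_fract (submodule_trace (E i ` P) h) =
        of_nat c * to_fract (- second_coeff (f i))"
      by (simp only: to_fract_mult of_nat_to_fract)
    \<comment> \<open>A monic constant is 1 and not irreducible; characteristic 0 then keeps the
      denominator of \<open>\<kappa> i\<close> nonzero.\<close>
    have "degree (f i) \<noteq> 0"
    proof
      assume "degree (f i) = 0"
      then have "f i = 1" using monic[OF i] by (auto elim!: degree_eq_zeroE simp: one_pCons)
      then show False using irred[OF i] by simp
    qed
    then have "of_nat (degree (f i)) \<noteq> (0 :: 'a fract)"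
      using char_0[of "degree (f i)"] by (metis of_nat_to_fract to_fract_eq_0_iff gr0I)
    then show "to_fract (submodule_trace P (\<lambda>x. h (E i x))) = \<kappa> i * of_nat (the_enat (rk (E i ` P)))"
      using tr by (simp add: eq \<kappa>_def rk_eq[OF C] field_simps)
  qed
  finally show ?thesis .
qed

end

section \<open>A congruence for cyclotomic polynomials\<close>

text \<open>Expand \<open>u = (u - v) + v\<close>; the inner binomial coefficients are divisible by
  \<open>p\<close>. Keeping \<open>u - v\<close> as a summand avoids the sign of
  \<open>(- v) ^ p\<close>, which would single out \<open>p = 2\<close>.\<close>

lemma prime_dvd_freshman:
  fixes u v :: "'a::comm_ring_1"
  assumes p: "prime p"
  shows "of_nat p dvd u ^ p - (u - v) ^ p - v ^ p"
proof -
  have p0: "p > 0" using p by (simp add: prime_gt_0_nat)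
  define a where "a = u - v"
  have "(a + v) ^ p = (\<Sum>k\<le>p. of_nat (p choose k) * a ^ k * v ^ (p - k))" by (rule binomial_ring)
  also have "{..p} = insert 0 (insert p {1..<p})" using p0 by auto
  also have "(\<Sum>k\<in>\<dots>. of_nat (p choose k) * a ^ k * v ^ (p - k)) =
      v ^ p + (a ^ p + (\<Sum>k = 1..<p. of_nat (p choose k) * a ^ k * v ^ (p - k)))"
    using p0 by (subst sum.insert; simp)+
  finally have eq: "(a + v) ^ p - a ^ p - v ^ p = (\<Sum>k = 1..<p. of_nat (p choose k) * a ^ k * v ^ (p - k))"
    by simp
  have "of_nat p dvd (of_nat (p choose k) * a ^ k * v ^ (p - k))" if "k \<in> {1..<p}" for k
  proof -
    have "p dvd (p choose k)" using that p by (intro dvd_choose_prime) auto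
    then have "(of_nat p :: 'a) dvd of_nat (p choose k)" by (metis dvdE dvd_triv_left of_nat_mult)
    then show ?thesis by (simp add: mult.assoc)
  qed
  then have "of_nat p dvd (a + v) ^ p - a ^ p - v ^ p" unfolding eq by (rule dvd_sum)
  then show ?thesis by (simp add: a_def)
qed

lemma prime_dvd_freshman_power:
  fixes u v :: "'a::comm_ring_1"
  assumes p: "prime p"
  shows "of_nat p dvd (u - v) ^ p ^ l - (u ^ p ^ l - v ^ p ^ l)"
proof (induction l)
  case (Suc l)
  define A B C where "A = (u - v) ^ p ^ l" and "B = u ^ p ^ l" and "C = v ^ p ^ l"
  have "(A - (B - C)) dvd A ^ p - (B - C) ^ p"
    by (simp add: power_diff_sumr2[of A p "B - C"])
  then have "of_nat p dvd A ^ p - (B - C) ^ p"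
    using Suc dvd_trans unfolding A_def B_def C_def by blast
  moreover have "of_nat p dvd B ^ p - (B - C) ^ p - C ^ p" by (rule prime_dvd_freshman[OF p])
  ultimately have "of_nat p dvd (A ^ p - (B - C) ^ p) - (B ^ p - (B - C) ^ p - C ^ p)"
    by (rule dvd_diff)
  also have "\<dots> = A ^ p - (B ^ p - C ^ p)" by simp
  finally show ?case by (simp add: A_def B_def C_def power_mult[symmetric] mult.commute)
qed simp

text \<open>With \<open>x = monom 1 1\<close>, the sum is the cyclotomic polynomial of order
  \<open>p^(l+1)\<close> and the exponent is its degree. Modulo \<open>p\<close> the power and the
  sum both agree with \<open>(x^q - 1)^(p-1)\<close>. At \<open>x = 1\<close> the power vanishes and
  the sum is \<open>p\<close>, so their difference divided by \<open>p\<close> takes the value -1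
  there. Over the integers \<open>p\<close> is prime in the polynomial ring, which allows cancelling
  \<open>x^q - 1\<close>.\<close>

lemma cyclotomic_congruence_int:
  fixes q :: nat
  assumes p: "prime p" and q: "q = p ^ l"
  shows "\<exists>w :: int poly. (monom 1 1 - 1) ^ (q * (p - 1)) =
    (\<Sum>j<p. monom 1 (q * j)) + of_nat p * ((monom 1 1 - 1) * w - 1)"
proof -
  define x where "x = (monom 1 1 :: int poly)"
  define y where "y = x ^ q"
  have p1: "p > 1" using p by (rule prime_gt_1_nat)
  then have q0: "q > 0" using q by simp
  have prim: "prime_elem (of_nat p :: int poly)"
    using p by (simp add: of_nat_poly lift_prime_elem_poly)
  have 1: "of_nat p dvd (x - 1) ^ q - (y - 1)"
    using prime_dvd_freshman_power[OF p, of x 1 l] by (simp add: q y_def)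
  have "((x - 1) ^ q - (y - 1)) dvd ((x - 1) ^ q) ^ (p - 1) - (y - 1) ^ (p - 1)"
    by (simp add: power_diff_sumr2[of "(x - 1) ^ q"])
  then have 2: "of_nat p dvd (x - 1) ^ (q * (p - 1)) - (y - 1) ^ (p - 1)"
    using 1 dvd_trans by (simp add: power_mult) blast
  have geo: "(y - 1) * (\<Sum>j<p. y ^ j) = y ^ p - 1" by (simp add: power_diff_1_eq)
  have "(y - 1) * (y - 1) ^ (p - 1) = (y - 1) ^ p" using p1 by (simp add: power_eq_if)
  then have "(y - 1) * ((y - 1) ^ (p - 1) - (\<Sum>j<p. y ^ j)) = (y - 1) ^ p - (y ^ p - 1)"
    using geo by (simp only: right_diff_distrib)
  also have "of_nat p dvd \<dots>" using prime_dvd_freshman_power[OF p, of y 1 1] by simp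
  finally have "of_nat p dvd (y - 1) * ((y - 1) ^ (p - 1) - (\<Sum>j<p. y ^ j))" .
  moreover have "\<not> (of_nat p :: int poly) dvd y - 1"
  proof
    assume "(of_nat p :: int poly) dvd y - 1"
    then obtain z where "y - 1 = [:int p:] * z" by (auto simp: of_nat_poly)
    then have "coeff (y - 1) 0 = int p * coeff z 0" by simp
    moreover have "coeff (y - 1) 0 = -1" using q0 by (simp add: y_def x_def monom_power)
    ultimately have "int p dvd -1" by (metis dvd_triv_left)
    then show False using p1 by (simp add: zdvd1_eq)
  qed
  ultimately have "of_nat p dvd (y - 1) ^ (p - 1) - (\<Sum>j<p. y ^ j)"
    using prim by (auto dest: prime_elem_dvd_multD)
  from dvd_add[OF 2 this] have "of_nat p dvd (x - 1) ^ (q * (p - 1)) - (\<Sum>j<p. y ^ j)" by simp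
  then obtain u where u: "(x - 1) ^ (q * (p - 1)) - (\<Sum>j<p. y ^ j) = of_nat p * u" by (auto elim: dvdE)
  then have u': "(x - 1) ^ (q * (p - 1)) = (\<Sum>j<p. y ^ j) + of_nat p * u" by (simp add: algebra_simps)
  have "poly ((x - 1) ^ (q * (p - 1))) 1 = poly ((\<Sum>j<p. y ^ j) + of_nat p * u) 1" by (simp only: u')
  moreover have px: "poly x 1 = 1" by (simp add: x_def poly_monom)
  have "poly (\<Sum>j<p. y ^ j) 1 = int p" unfolding poly_sum by (simp add: y_def px)
  then have "poly ((\<Sum>j<p. y ^ j) + of_nat p * u) 1 = int p + int p * poly u 1" by simp
  moreover have "poly ((x - 1) ^ (q * (p - 1))) 1 = 0" using q0 p1 by (simp add: px power_0_left)
  ultimately have "0 = int p + int p * poly u 1" by (simp only:)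
  then have "int p * (1 + poly u 1) = 0" by (simp add: algebra_simps)
  then have "poly (u + 1) 1 = 0" using p1 by simp
  then have "[:- 1, 1:] dvd u + 1" unfolding poly_eq_0_iff_dvd .
  moreover have "[:- 1, 1:] = x - 1" by (simp add: x_def monom_altdef one_pCons)
  ultimately obtain w where "u + 1 = (x - 1) * w" by (auto elim: dvdE)
  then have w: "u = (x - 1) * w - 1" by (simp add: algebra_simps)
  have "(\<Sum>j<p. y ^ j) = (\<Sum>j<p. monom 1 (q * j))"
    by (simp add: y_def x_def monom_power)
  then show ?thesis using u' unfolding w x_def by metis
qed

text \<open>The integral identity maps to any commutative ring, also to a ramified R, in which
  \<open>p\<close> is not a prime element.\<close>

lemma cyclotomic_congruence:
  fixes q :: nat
  assumes p: "prime p" and q: "q = p ^ l"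
  shows "\<exists>w :: 'r::comm_ring_1 poly. (monom 1 1 - 1) ^ (q * (p - 1)) =
    (\<Sum>j<p. monom 1 (q * j)) + of_nat p * ((monom 1 1 - 1) * w - 1)"
proof -
  obtain w :: "int poly" where w: "(monom 1 1 - 1) ^ (q * (p - 1)) =
    (\<Sum>j<p. monom 1 (q * j)) + of_nat p * ((monom 1 1 - 1) * w - 1)"
    using cyclotomic_congruence_int[OF assms] by blast
  have "(of_int_poly ((monom 1 1 - 1) ^ (q * (p - 1))) :: 'r poly) =
    of_int_poly ((\<Sum>j<p. monom 1 (q * j)) + of_nat p * ((monom 1 1 - 1) * w - 1))" by (simp only: w)
  then have "(monom 1 1 - 1) ^ (q * (p - 1)) =
    (\<Sum>j<p. monom 1 (q * j)) + of_nat p * ((monom 1 1 - 1) * (of_int_poly w :: 'r poly) - 1)"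
    by (simp add: hom_distribs)
  then show ?thesis by blast
qed

section \<open>The Herbrand quotient of a lattice with an action of a cyclic group\<close>

text \<open>Here \<open>N\<close> is the prime-to-\<open>p\<close> factor of the exponent of
  \<open>g\<close>, with inverse \<open>w\<close> in R, and \<open>e\<close> is the exponent of
  \<open>\<pi>\<close> in \<open>p\<close>. The lattice \<open>C\<close> will be the whole module or
  one of its components.\<close>

locale cyclic_lattice = dvr \<pi> for \<pi> :: "'r::idom" +
  fixes p n N e r :: nat and u w :: 'r and g :: "'r poly \<Rightarrow> 'r poly" and C :: "'r poly set"
  assumes p: "prime p" and u: "u dvd 1" and p_eq: "of_nat p = u * \<pi> ^ e"
    and w: "w * of_nat N = 1" and char_0: "k > 0 \<Longrightarrow> of_nat k \<noteq> (0 :: 'r)"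
    and g: "V.linear_op g" and g_order: "(g ^^ (p ^ n * N)) x = x"
    and C: "V.subspace C" and gC: "x \<in> C \<Longrightarrow> g x \<in> C" and C_below: "C \<subseteq> below_degree r"
begin

definition D :: "'r poly \<Rightarrow> 'r poly" where "D x = g x - x"

definition Norm :: "'r poly \<Rightarrow> 'r poly" where "Norm x = (\<Sum>i<p ^ n * N. (g ^^ i) x)"

definition F :: "nat \<Rightarrow> 'r poly set" where "F l = {x \<in> C. (g ^^ (p ^ l)) x = x}"

text \<open>\<open>F 0\<close> and \<open>B\<close> are the kernels of \<open>D\<close> and
  \<open>Norm\<close> on \<open>C\<close>, so the Tate groups are \<open>F 0\<close> modulo
  \<open>Norm C\<close> and \<open>B\<close> modulo \<open>D C\<close>.\<close>

definition B :: "'r poly set" where "B = {x \<in> C. Norm x = 0}"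

lemma linear_g: "V.linear_op (g ^^ k)"
  by (induction k) (auto simp: V.linear_op_def V.linear_op_add[OF g] V.linear_op_scale[OF g])

lemma gC_pow: "x \<in> C \<Longrightarrow> (g ^^ k) x \<in> C"
  by (induction k) (auto simp: gC)

lemma g_pow_commute: "(g ^^ k) (g x) = g ((g ^^ k) x)"
  by (simp add: funpow_swap1)

lemma linear_D: "V.linear_op D"
  using g by (simp add: V.linear_op_def D_def smult_diff_right)

lemma linear_Norm: "V.linear_op Norm"
  using linear_op_sum_smult[of "{..<p ^ n * N}" "\<lambda>i. g ^^ i" "\<lambda>_. 1"] linear_g by (simp add: Norm_def[abs_def])

lemma DC: "x \<in> C \<Longrightarrow> D x \<in> C"
  unfolding D_def by (intro V.subspace_diff C gC)

lemma NormC: "x \<in> C \<Longrightarrow> Norm x \<in> C"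
  unfolding Norm_def by (intro V.subspace_sum C gC_pow)

lemma F_subset: "F l \<subseteq> C"
  by (auto simp: F_def)

lemma subspace_F: "V.subspace (F l)"
  using C unfolding F_def V.subspace_def
  by (auto simp: V.linear_op_add[OF linear_g] V.linear_op_scale[OF linear_g] V.linear_op_0[OF linear_g])

lemma subspace_B: "V.subspace B"
  using C unfolding B_def V.subspace_def
  by (auto simp: V.linear_op_add[OF linear_Norm] V.linear_op_scale[OF linear_Norm] V.linear_op_0[OF linear_Norm])

lemma gF: "x \<in> F l \<Longrightarrow> g x \<in> F l"
  by (auto simp: F_def gC g_pow_commute)

lemma DF: "x \<in> F l \<Longrightarrow> D x \<in> F l"
  unfolding D_def by (intro V.subspace_diff subspace_F gF)

lemma DF_image: "D ` F l \<subseteq> F l"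
  by (rule image_subsetI) (rule DF)

lemma g_pow_fixed: "(g ^^ a) x = x \<Longrightarrow> (g ^^ (a * b)) x = x"
  by (induction b) (simp_all add: funpow_add)

lemma F_mono: "F l \<subseteq> F (Suc l)"
  using g_pow_fixed[of "p ^ l" _ p] by (auto simp: F_def mult.commute)

lemma F_mono': "k \<le> l \<Longrightarrow> F k \<subseteq> F l"
  by (rule lift_Suc_mono_le[of F]) (rule F_mono)

lemma smult_of_nat_cancel: "k > 0 \<Longrightarrow> smult (of_nat k) x = 0 \<Longrightarrow> x = (0 :: 'r poly)"
  using char_0[of k] by simp

text \<open>The element \<open>y = (g^a - 1) x\<close> is fixed by \<open>g\<close>, so
  \<open>g^(a k) x = x + k y\<close>; finite order gives \<open>b y = 0\<close>, and there is no
  torsion. Thus \<open>D\<close> is injective on each layer of the filtration.\<close>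

lemma D_fixed_imp_fixed:
  assumes "(g ^^ a) (D x) = D x" "(g ^^ (a * b)) x = x" "b > 0"
  shows "(g ^^ a) x = x"
proof -
  define y where "y = (g ^^ a) x - x"
  have "g y = y"
    using assms(1) by (simp add: y_def D_def V.linear_op_diff[OF linear_g] V.linear_op_diff[OF g] g_pow_commute algebra_simps)
  then have gy: "(g ^^ k) y = y" for k by (induction k) simp_all
  have "(g ^^ (a * k)) x - x = smult (of_nat k) y" for k
  proof (induction k)
    case (Suc k)
    have "(g ^^ (a * Suc k)) x - (g ^^ (a * k)) x = (g ^^ (a * k)) y"
      by (simp add: y_def V.linear_op_diff[OF linear_g] funpow_add[symmetric, THEN fun_cong, simplified o_def] add.commute)
    then show ?case using Suc gy by (simp add: smult_add_left algebra_simps)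
  qed simp
  from this[of b] assms(2) have "smult (of_nat b) y = 0" by simp
  then have "y = 0" by (rule smult_of_nat_cancel[OF assms(3)])
  then show ?thesis by (simp add: y_def)
qed

lemma N_pos: "N > 0"
  using w by (cases N) auto

lemma p_pos: "p > 0"
  using p by (rule prime_gt_0_nat)

lemma D_mem_F: "x \<in> F (Suc l) \<Longrightarrow> D x \<in> F l \<Longrightarrow> x \<in> F l"
  using D_fixed_imp_fixed[of "p ^ l" x p] p_pos by (auto simp: F_def mult.commute)

lemma D_mem_F_top: "x \<in> C \<Longrightarrow> D x \<in> F n \<Longrightarrow> x \<in> F n"
  using D_fixed_imp_fixed[of "p ^ n" x N] N_pos g_order by (auto simp: F_def)

text \<open>Sum over a cyclic orbit: applying \<open>g ^^ a\<close> only permutes the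
  \<open>Suc k\<close> terms.\<close>

lemma sum_shift: "(g ^^ a) ((g ^^ (a * k)) x) = x \<Longrightarrow>
    (g ^^ a) (\<Sum>i<Suc k. (g ^^ (a * i)) x) = (\<Sum>i<Suc k. (g ^^ (a * i)) x)"
proof -
  assume 1: "(g ^^ a) ((g ^^ (a * k)) x) = x"
  have "(g ^^ a) (\<Sum>i<Suc k. (g ^^ (a * i)) x) = (\<Sum>i<Suc k. (g ^^ (a * Suc i)) x)"
    by (simp only: V.linear_op_sum[OF linear_g] mult_Suc_right funpow_add o_apply)
  also have "\<dots> = (\<Sum>i<k. (g ^^ (a * Suc i)) x) + x" using 1 by (simp add: funpow_add)
  also have "\<dots> = (\<Sum>i<Suc k. (g ^^ (a * i)) x)" by (subst sum.lessThan_Suc_shift) simp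
  finally show ?thesis .
qed

lemma g_Norm: "g (Norm x) = Norm x"
proof -
  obtain k where k: "p ^ n * N = Suc k" using N_pos p_pos by (metis gr0_implies_Suc nat_0_less_mult_iff zero_less_power)
  have "g ((g ^^ k) x) = x" using g_order[of x] by (simp add: k)
  then show ?thesis using sum_shift[of 1 k x] by (simp add: Norm_def k)
qed

lemma Norm_F0: "x \<in> F 0 \<Longrightarrow> Norm x = smult (of_nat (p ^ n * N)) x"
proof -
  assume "x \<in> F 0"
  then have "(g ^^ i) x = x" for i by (induction i) (auto simp: F_def)
  then show ?thesis by (simp add: Norm_def of_nat_poly)
qed

lemma Norm_D: "Norm (D x) = 0"
proof -
  have "(g ^^ i) (g x) = g ((g ^^ i) x)" for i by (rule g_pow_commute)
  then have "Norm (g x) = g (Norm x)" by (simp add: Norm_def V.linear_op_sum[OF g])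
  then show ?thesis by (simp add: D_def V.linear_op_diff[OF linear_Norm] g_Norm)
qed

lemma diff_mem_D: "x \<in> C \<Longrightarrow> x - (g ^^ k) x \<in> D ` C"
proof (induction k)
  case 0
  have "D 0 \<in> D ` C" using V.subspace_0[OF C] by blast
  then show ?case by (simp add: V.linear_op_0[OF linear_D])
next
  case (Suc k)
  have "(x - (g ^^ k) x) - D ((g ^^ k) x) \<in> D ` C"
    using Suc.IH[OF Suc.prems] gC_pow[OF Suc.prems]
    by (rule V.subspace_diff[OF V.subspace_linear_image[OF linear_D C] _ imageI])
  then show ?case by (simp add: D_def)
qed

text \<open>The \<open>N\<close>-th power of \<open>g ^^ (p ^ n)\<close> is the identity and
  \<open>N\<close> is a unit, so averaging over its powers projects \<open>C\<close> onto
  \<open>F n\<close>. An element differs from its average by a combination of differences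
  \<open>x - g^k x\<close>, all in \<open>D C\<close>. So the top layer \<open>C / F n\<close> has
  no cokernel.\<close>

lemma D_plus_F: "D ` C + F n = C"
proof
  show "D ` C + F n \<subseteq> C" using DC F_subset by (intro V.plus_least C) auto
  show "C \<subseteq> D ` C + F n"
  proof
    fix x assume x: "x \<in> C"
    define S where "S = (\<Sum>i<N. (g ^^ (p ^ n * i)) x)"
    obtain k where k: "N = Suc k" using N_pos by (metis gr0_implies_Suc)
    have "(g ^^ (p ^ n)) ((g ^^ (p ^ n * k)) x) = x" using g_order[of x] by (simp add: k funpow_add)
    from sum_shift[OF this] have "(g ^^ (p ^ n)) S = S" by (simp add: S_def k)
    moreover have "S \<in> C" unfolding S_def by (intro V.subspace_sum C gC_pow x)
    ultimately have S: "smult w S \<in> F n" by (intro V.subspace_scale subspace_F) (simp add: F_def)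
    have "smult (of_nat N) x - S = (\<Sum>i<N. x - (g ^^ (p ^ n * i)) x)"
      by (simp add: S_def sum_subtractf of_nat_poly)
    also have "\<dots> \<in> D ` C"
      by (intro V.subspace_sum V.subspace_linear_image linear_D C diff_mem_D x)
    finally have "smult w (smult (of_nat N) x - S) \<in> D ` C"
      by (intro V.subspace_scale V.subspace_linear_image linear_D C)
    moreover have "smult w (smult (of_nat N) x - S) = x - smult w S" using w by (simp add: smult_diff_right)
    ultimately have "(x - smult w S) + smult w S \<in> D ` C + F n" using S by (intro set_plus_intro) simp_all
    then show "x \<in> D ` C + F n" by simp
  qed
qed

definition \<delta> :: "nat \<Rightarrow> enat" where
  "\<delta> l = V.len (D ` F (Suc l) + F l) (F (Suc l))"

lemma zero_plus [simp]: "X + {0} = (X :: 'r poly set)"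
  by (auto simp: set_plus_def)

text \<open>\<open>D\<close> vanishes on \<open>F 0\<close>, so the sum starts empty; each layer
  adds its cokernel by \<open>len_coker_filtration\<close>.\<close>

lemma len_D_F: "V.len (D ` F l + F 0) (F l) = (\<Sum>k<l. \<delta> k)"
proof (induction l)
  case 0
  have "D ` F 0 \<subseteq> {0}" by (auto simp: D_def F_def)
  then have "D ` F 0 + F 0 = F 0"
    using V.subspace_0[OF subspace_F] by (intro V.plus_absorb V.subspace_linear_image linear_D subspace_F) auto
  then show ?case by simp
next
  case (Suc l)
  have "V.len (D ` F (Suc l) + F 0) (F (Suc l)) = V.len (D ` F l + F 0) (F l) + \<delta> l"
    unfolding \<delta>_def
    by (rule V.len_coker_filtration[OF linear_D subspace_F subspace_F subspace_F F_mono' F_mono _ _ D_mem_F])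
       (auto simp: DF)
  then show ?case using Suc by simp
qed

lemma len_D_C: "V.len (D ` C + F 0) C = (\<Sum>k<n. \<delta> k)"
proof -
  have "V.len (D ` C + F 0) C = V.len (D ` F n + F 0) (F n) + V.len (D ` C + F n) C"
    by (rule V.len_coker_filtration[OF linear_D subspace_F subspace_F C F_mono' F_subset _ _ D_mem_F_top])
       (auto simp: DF DC)
  then show ?thesis by (simp add: len_D_F D_plus_F)
qed

lemma len_coker_power:
  assumes S: "V.linear_op S" and s: "V.subspace Y" "V.subspace W" "Y \<subseteq> W" "S ` W \<subseteq> W" "S ` Y \<subseteq> Y"
    and inj: "\<And>x. x \<in> W \<Longrightarrow> S x \<in> Y \<Longrightarrow> x \<in> Y"
  shows "V.len ((S ^^ k) ` W + Y) W = of_nat k * V.len (S ` W + Y) W"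
proof (induction k)
  case 0
  have "id ` W + Y = W" using V.plus_absorb[of Y W] s by (simp add: add.commute)
  then show ?case by (simp add: id_def)
next
  case (Suc k)
  have lin: "V.linear_op (S ^^ k)"
    by (induction k) (auto simp: V.linear_op_def V.linear_op_add[OF S] V.linear_op_scale[OF S])
  have W: "(S ^^ k) ` W \<subseteq> W" using s(4) by (induction k) auto
  have "V.len (S ` (S ^^ k) ` W + Y) W = V.len (S ` W + Y) W + V.len ((S ^^ k) ` W + Y) W"
    by (rule V.len_coker_comp[OF S lin s(1,2,3,4) W s(5) inj])
  then show ?case using Suc by (simp add: image_image distrib_right)
qed

lemma smult_mem_F: "a \<noteq> 0 \<Longrightarrow> x \<in> C \<Longrightarrow> smult a x \<in> F l \<Longrightarrow> x \<in> F l"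
proof -
  assume a: "a \<noteq> 0" "x \<in> C" "smult a x \<in> F l"
  then have "smult a ((g ^^ (p ^ l)) x - x) = 0" by (simp add: F_def V.linear_op_scale[OF linear_g] smult_diff_right)
  then show ?thesis using a by (simp add: F_def)
qed

lemma smult_mem_F': "a \<noteq> 0 \<Longrightarrow> x \<in> F k \<Longrightarrow> smult a x \<in> F l \<Longrightarrow> x \<in> F l"
  using smult_mem_F F_subset by blast

lemma smult_image_subset: "V.subspace X \<Longrightarrow> smult a ` X \<subseteq> (X :: 'r poly set)"
  by (auto intro: V.subspace_scale)

lemma smult_p_image: "V.subspace X \<Longrightarrow> smult (of_nat p) ` X = (smult \<pi> ^^ e) ` X"
proof -
  assume X: "V.subspace X"
  have pe: "(smult \<pi> ^^ k) x = smult (\<pi> ^ k) x" for k x by (induction k) simp_all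
  obtain u' where u': "1 = u * u'" using u by (auto elim: dvdE)
  have "of_nat p * u' = \<pi> ^ e" unfolding p_eq using u' by (metis mult.assoc mult.commute mult_1)
  then have "smult (\<pi> ^ e) x = smult (of_nat p) (smult u' x)" for x by simp
  then have "smult (\<pi> ^ e) ` X \<subseteq> smult (of_nat p) ` X"
    using smult_image_subset[OF X, of u'] by blast
  moreover have "smult (of_nat p) x = smult (\<pi> ^ e) (smult u x)" for x
    by (simp add: p_eq mult.commute)
  then have "smult (of_nat p) ` X \<subseteq> smult (\<pi> ^ e) ` X"
    using smult_image_subset[OF X, of u] by blast
  ultimately show ?thesis by (simp add: pe)
qed

lemma len_smult_p:
  assumes "V.subspace Y" "V.subspace W" "Y \<subseteq> W" "\<And>a x. a \<noteq> 0 \<Longrightarrow> x \<in> W \<Longrightarrow> smult a x \<in> Y \<Longrightarrow> x \<in> Y"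
  shows "V.len (smult (of_nat p) ` W + Y) W = of_nat e * V.len (smult \<pi> ` W + Y) W"
  unfolding smult_p_image[OF assms(2)]
  by (rule len_coker_power[OF linear_op_smult assms(1-3)]) (use assms smult_image_subset uniformizer_nonzero in auto)

text \<open>
  Modulo \<open>F l\<close> the cyclotomic polynomial of order \<open>p\<^sup>l\<^sup>+\<^sup>1\<close> annihilates \<open>F (l + 1)\<close>, so there
  \<open>D\<close> to the power \<open>\<phi>(p\<^sup>l\<^sup>+\<^sup>1)\<close> equals \<open>p (D v - 1)\<close> for some polynomial \<open>v\<close> in \<open>g\<close>. Modulo this
  power of \<open>D\<close> the factor \<open>D v - 1\<close> is invertible because \<open>D v\<close> is nilpotent.
\<close>

lemma D_power_image:
  "(D ^^ (p ^ l * (p - 1))) ` F (Suc l) + F l = smult (of_nat p) ` F (Suc l) + F l"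
proof -
  define k where "k = p ^ l * (p - 1)"
  have k0: "k > 0" using p prime_gt_1_nat[OF p] by (simp add: k_def)
  have Dk: "(D ^^ j) x = poly_act ((monom 1 1 - 1) ^ j) g x" for j x
  proof (induction j)
    case (Suc j)
    then show ?case
      by (simp add: poly_act_mult[OF g] poly_act_diff[OF g] poly_act_monom[OF g] poly_act_1[OF g] D_def)
  qed (simp add: poly_act_1[OF g])
  obtain v :: "'r poly" where v: "(monom 1 1 - 1) ^ k =
      (\<Sum>j<p. monom 1 (p ^ l * j)) + of_nat p * ((monom 1 1 - 1) * v - 1)"
    using cyclotomic_congruence[OF p refl, of l] unfolding k_def by blast
  define \<Phi> where "\<Phi> x = poly_act (\<Sum>j<p. monom 1 (p ^ l * j)) g x" for x
  define U where "U = (D ^^ k) ` F (Suc l) + F l"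
  have actF: "poly_act q g x \<in> F (Suc l)" if "x \<in> F (Suc l)" for q x
    by (rule poly_act_mem[OF g subspace_F gF that])
  \<comment> \<open>\<open>\<Phi> x\<close> is an orbit sum of \<open>g ^^ (p ^ l)\<close>, whose
    \<open>p\<close>-th power fixes \<open>x\<close>.\<close>
  have \<Phi>: "\<Phi> x \<in> F l" if x: "x \<in> F (Suc l)" for x
  proof -
    have \<Phi>x: "\<Phi> x = (\<Sum>j<p. (g ^^ (p ^ l * j)) x)"
      by (simp add: \<Phi>_def poly_act_sum[OF g] poly_act_monom[OF g])
    obtain m where m: "p = Suc m" using p_pos by (metis gr0_implies_Suc)
    have "(g ^^ (p ^ l)) ((g ^^ (p ^ l * m)) x) = (g ^^ (p ^ l * p)) x"
      unfolding funpow_add[THEN fun_cong, unfolded o_apply, symmetric] by (simp add: m)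
    also have "\<dots> = x" using x by (simp add: F_def mult.commute)
    finally have "(g ^^ (p ^ l)) (\<Phi> x) = \<Phi> x" unfolding \<Phi>x m by (intro sum_shift) (simp add: m)
    moreover have "\<Phi> x \<in> C" using actF[OF x] F_subset by (auto simp: \<Phi>_def)
    ultimately show ?thesis by (simp add: F_def)
  qed
  have linDk: "V.linear_op (D ^^ k)" unfolding Dk by (rule linear_poly_act[OF g])
  have U: "V.subspace U" unfolding U_def by (intro V.subspace_plus V.subspace_linear_image linDk subspace_F)
  have inU: "F l \<subseteq> U" "(D ^^ k) ` F (Suc l) \<subseteq> U"
    unfolding U_def by (intro V.plus_upper2 V.plus_upper1 V.subspace_linear_image linDk subspace_F)+
  have Dk_eq: "(D ^^ k) x = \<Phi> x + smult (of_nat p) (poly_act ((monom 1 1 - 1) * v - 1) g x)" for x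
    unfolding Dk v \<Phi>_def by (simp only: poly_act_add[OF g] poly_act_mult[OF g] of_nat_poly poly_act_const[OF g])
  have "U \<subseteq> smult (of_nat p) ` F (Suc l) + F l"
  proof -
    have "(D ^^ k) x \<in> smult (of_nat p) ` F (Suc l) + F l" if x: "x \<in> F (Suc l)" for x
      unfolding Dk_eq add.commute[of "\<Phi> x"] by (intro set_plus_intro imageI actF \<Phi> x)
    then show ?thesis unfolding U_def
      by (intro V.plus_least V.subspace_plus V.subspace_linear_image linear_op_smult subspace_F V.plus_upper2) auto
  qed
  moreover have "smult (of_nat p) ` F (Suc l) + F l \<subseteq> U"
  proof (rule V.plus_least[OF U _ inU(1)], rule image_subsetI)
    fix z assume z: "z \<in> F (Suc l)"
    define t where "t = (monom 1 1 - 1) * v"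
    define s where "s = (\<Sum>i<k. t ^ i)"
    define y where "y = poly_act s g z"
    have y: "y \<in> F (Suc l)" unfolding y_def by (rule actF[OF z])
    have "(t - 1) * s = t ^ k - 1" unfolding s_def by (simp add: power_diff_1_eq)
    \<comment> \<open>Finite geometric series in place of the inverse: modulo the multiples of
      \<open>(monom 1 1 - 1) ^ k\<close>, which act into the image of \<open>D ^^ k\<close>, the
      polynomial \<open>- s\<close> inverts \<open>t - 1\<close>.\<close>
    then have "1 = (monom 1 1 - 1) ^ k * v ^ k - (t - 1) * s" by (simp add: t_def power_mult_distrib)
    then have "z = poly_act ((monom 1 1 - 1) ^ k * v ^ k - (t - 1) * s) g z" using poly_act_1[OF g, of z] by metis
    then have "z = (D ^^ k) (poly_act (v ^ k) g z) - poly_act (t - 1) g y"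
      by (simp only: poly_act_diff[OF g] poly_act_mult[OF g] Dk y_def)
    then have "smult (of_nat p) z = smult (of_nat p) ((D ^^ k) (poly_act (v ^ k) g z)) -
        smult (of_nat p) (poly_act (t - 1) g y)" by (metis smult_diff_right)
    also have "\<dots> = (D ^^ k) (smult (of_nat p) (poly_act (v ^ k) g z)) - ((D ^^ k) y - \<Phi> y)"
      using Dk_eq[of y] by (simp add: V.linear_op_scale[OF linDk] t_def)
    also have "\<dots> \<in> U"
    proof (intro V.subspace_diff[OF U])
      show "(D ^^ k) (smult (of_nat p) (poly_act (v ^ k) g z)) \<in> U"
        by (rule subsetD[OF inU(2) imageI[OF V.subspace_scale[OF subspace_F actF[OF z]]]])
      show "(D ^^ k) y \<in> U" by (rule subsetD[OF inU(2) imageI[OF y]])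
      show "\<Phi> y \<in> U" by (rule subsetD[OF inU(1) \<Phi>[OF y]])
    qed
    finally show "smult (of_nat p) z \<in> U" .
  qed
  ultimately show ?thesis unfolding U_def k_def by (rule antisym)
qed

text \<open>The layer is torsion free, so \<open>\<pi>\<close> acts injectively on it and
  \<open>len_coker_filtration\<close> makes ranks additive.\<close>

lemma rk_F: "rk (F (Suc l)) = rk (F l) + V.len (smult \<pi> ` F (Suc l) + F l) (F (Suc l))"
proof -
  have "V.len (smult \<pi> ` F (Suc l) + {0}) (F (Suc l)) =
      V.len (smult \<pi> ` F l + {0}) (F l) + V.len (smult \<pi> ` F (Suc l) + F l) (F (Suc l))"
  proof (rule V.len_coker_filtration[OF linear_op_smult V.subspace_single_0 subspace_F subspace_F _ F_mono])
    show "{0} \<subseteq> F l" using V.subspace_0[OF subspace_F] by simp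
    show "smult \<pi> ` F l \<subseteq> F l" "smult \<pi> ` F (Suc l) \<subseteq> F (Suc l)"
      by (rule smult_image_subset[OF subspace_F])+
    show "x \<in> F l" if "x \<in> F (Suc l)" "smult \<pi> x \<in> F l" for x
      using smult_mem_F'[OF uniformizer_nonzero that] .
  qed
  then show ?thesis by (simp add: rk_def)
qed

text \<open>The cokernel of the power of \<open>D\<close> on a layer is measured twice: by iteration
  as a multiple of the cokernel of \<open>D\<close>, and through \<open>D_power_image\<close> as the
  cokernel of \<open>p\<close>.\<close>

lemma len_delta:
  "of_nat (p ^ l * (p - 1)) * \<delta> l = of_nat e * V.len (smult \<pi> ` F (Suc l) + F l) (F (Suc l))"
proof -
  have "of_nat (p ^ l * (p - 1)) * \<delta> l = V.len ((D ^^ (p ^ l * (p - 1))) ` F (Suc l) + F l) (F (Suc l))"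
    unfolding \<delta>_def
    by (rule len_coker_power[OF linear_D subspace_F subspace_F F_mono DF_image DF_image D_mem_F, symmetric])
  also have "\<dots> = of_nat e * V.len (smult \<pi> ` F (Suc l) + F l) (F (Suc l))"
    unfolding D_power_image
    by (rule len_smult_p[OF subspace_F subspace_F F_mono smult_mem_F'])
  finally show ?thesis .
qed

section \<open>Comparison of the two Tate groups\<close>

lemma Norm_mem_F0: "Norm ` C \<subseteq> F 0"
  using NormC g_Norm by (auto simp: F_def)

lemma D_mem_B: "D ` C \<subseteq> B"
  using DC Norm_D by (auto simp: B_def)

lemma B_Int_F0: "x \<in> B \<Longrightarrow> x \<in> F 0 \<Longrightarrow> x = 0"
  using Norm_F0[of x] smult_of_nat_cancel[of "p ^ n * N" x] N_pos p_pos by (simp add: B_def)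

lemma subspace_Norm_C: "V.subspace (Norm ` C)" and subspace_D_C: "V.subspace (D ` C)"
  by (intro V.subspace_linear_image linear_Norm linear_D C)+

text \<open>Two filtrations are compared: \<open>Norm F 0\<close>, \<open>Norm C\<close>,
  \<open>F 0\<close> and \<open>D C + F 0\<close>, \<open>B + F 0\<close>, \<open>C\<close>.
  \<open>Norm\<close> identifies \<open>C / (B + F 0)\<close> with \<open>Norm C / Norm F 0\<close>,
  and \<open>B \<inter> F 0 = 0\<close> identifies \<open>(B + F 0) / (D C + F 0)\<close> with
  \<open>B / D C\<close>. The form is additive because finiteness is not yet known.\<close>

lemma len_Herbrand:
  "V.len (Norm ` C) (F 0) + V.len (D ` C + F 0) C = V.len (smult (of_nat (p ^ n * N)) ` F 0) (F 0) + V.len (D ` C) B"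
proof -
  have NF: "Norm ` F 0 = smult (of_nat (p ^ n * N)) ` F 0"
    by (intro image_cong refl Norm_F0)
  have NB: "Norm ` B + {0} = {0}"
  proof -
    have "0 \<in> B" by (rule V.subspace_0[OF subspace_B])
    then have "Norm ` B = {0}" unfolding B_def by force
    then show ?thesis by simp
  qed
  have BF: "B + F 0 \<subseteq> C" by (intro V.plus_least C F_subset) (auto simp: B_def)
  have sBF: "V.subspace (B + F 0)" by (intro V.subspace_plus subspace_B subspace_F)
  have sDF: "V.subspace (D ` C + F 0)" by (intro V.subspace_plus subspace_D_C subspace_F)
  have "V.len (Norm ` (B + F 0) + {0}) (Norm ` C + {0}) = V.len (B + F 0) C"
    by (rule V.len_linear_image[OF linear_Norm V.subspace_single_0 C sBF C, of B])
       (use BF V.plus_upper1[OF subspace_F, of B] in \<open>auto simp: B_def\<close>)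
  moreover have "Norm ` (B + F 0) + {0} = Norm ` F 0"
    using NB by (simp add: V.linear_image_plus[OF linear_Norm])
  ultimately have 1: "V.len (Norm ` F 0) (Norm ` C) = V.len (B + F 0) C" by simp
  have "D ` C + F 0 + B = B + F 0"
  proof -
    have "D ` C + B = B" by (rule V.plus_absorb[OF subspace_D_C subspace_B D_mem_B])
    then show ?thesis by (metis add.assoc add.commute)
  qed
  moreover have "(D ` C + F 0) \<inter> B = D ` C"
  proof
    show "D ` C \<subseteq> (D ` C + F 0) \<inter> B" using D_mem_B V.plus_upper1[OF subspace_F] by blast
    show "(D ` C + F 0) \<inter> B \<subseteq> D ` C"
    proof
      fix x assume x: "x \<in> (D ` C + F 0) \<inter> B"
      then have "x \<in> D ` C + F 0" by simp
      then obtain y z where yz: "y \<in> D ` C" "z \<in> F 0" "x = y + z" by (rule set_plus_elim)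
      then have "z = x - y" by simp
      then have "z \<in> B" using x yz(1) D_mem_B V.subspace_diff[OF subspace_B, of x y] by auto
      then have "z = 0" using B_Int_F0 yz by auto
      then show "x \<in> D ` C" using yz by simp
    qed
  qed
  ultimately have 2: "V.len (D ` C + F 0) (B + F 0) = V.len (D ` C) B"
    using V.len_plus[OF sDF subspace_B] by simp
  have "V.len (D ` C + F 0) C = V.len (D ` C + F 0) (B + F 0) + V.len (B + F 0) C"
    by (rule V.len_add[OF sDF sBF C _ BF]) (intro set_plus_mono2 D_mem_B order_refl)
  moreover have "V.len (Norm ` F 0) (F 0) = V.len (Norm ` F 0) (Norm ` C) + V.len (Norm ` C) (F 0)"
    by (rule V.len_add[OF V.subspace_linear_image[OF linear_Norm subspace_F] subspace_Norm_C subspace_F _ Norm_mem_F0])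
       (intro image_mono F_subset)
  ultimately show ?thesis using 1 2 NF by (simp add: add_ac)
qed

lemma len_smult_order: "V.len (smult (of_nat (p ^ n * N)) ` F 0) (F 0) = of_nat (n * e) * rk (F 0)"
proof -
  have inj: "x \<in> {0}" if "a \<noteq> 0" "smult a x \<in> {0}" for a and x :: "'r poly" using that by simp
  have im: "(smult (of_nat p) ^^ n) ` F 0 = smult (of_nat (p ^ n * N)) ` F 0"
  proof -
    have pe: "(smult (of_nat p) ^^ k) x = smult (of_nat p ^ k) x" for k and x :: "'r poly" by (induction k) simp_all
    have "of_nat (p ^ n * N) * w = of_nat p ^ n"
      using w by (simp add: mult.assoc mult.commute[of "of_nat N" w])
    then have "smult (of_nat p ^ n) x = smult (of_nat (p ^ n * N)) (smult w x)" for x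
      by (metis smult_smult)
    then have "smult (of_nat p ^ n) ` F 0 \<subseteq> smult (of_nat (p ^ n * N)) ` F 0"
      using smult_image_subset[OF subspace_F, of w] by blast
    moreover have "smult (of_nat (p ^ n * N)) x = smult (of_nat p ^ n) (smult (of_nat N) x)" for x :: "'r poly" by simp
    then have "smult (of_nat (p ^ n * N)) ` F 0 \<subseteq> smult (of_nat p ^ n) ` F 0"
      using smult_image_subset[OF subspace_F, of "of_nat N"] by blast
    ultimately show ?thesis by (simp add: pe)
  qed
  have "of_nat p \<noteq> (0 :: 'r)" using char_0[OF p_pos] .
  then have "V.len ((smult (of_nat p) ^^ n) ` F 0 + {0}) (F 0) = of_nat n * V.len (smult (of_nat p) ` F 0 + {0}) (F 0)"
    by (intro len_coker_power linear_op_smult V.subspace_single_0 subspace_F smult_image_subset)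
       (use V.subspace_0[OF subspace_F] in auto)
  also have "V.len (smult (of_nat p) ` F 0 + {0}) (F 0) = of_nat e * V.len (smult \<pi> ` F 0 + {0}) (F 0)"
    by (intro len_smult_p V.subspace_single_0 subspace_F) (use V.subspace_0[OF subspace_F] in auto)
  finally show ?thesis by (simp add: im rk_def mult.assoc)
qed

lemma exists_rank: "V.subspace X \<Longrightarrow> X \<subseteq> C \<Longrightarrow> \<exists>t. rk X = enat t"
  using exists_basis[of X r] C_below rk_eq by blast

definition rank :: "nat \<Rightarrow> nat" where
  "rank l = the_enat (rk (F l))"

lemma rk_rank: "rk (F l) = enat (rank l)"
  using exists_rank[OF subspace_F F_subset] by (metis rank_def the_enat.simps)

text \<open>Finiteness enters here: the Tate group in degree 0 is a quotient of \<open>F 0\<close>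
  modulo the exponent of \<open>g\<close>, each \<open>\<delta> l\<close> has a finite positive
  multiple, and \<open>len_Herbrand\<close> then bounds the other Tate group. The equations avoid
  subtraction of naturals.\<close>

theorem Herbrand_quotient:
  obtains a b :: nat and d :: "nat \<Rightarrow> nat"
  where "V.len (Norm ` C) (F 0) = enat a" "V.len (D ` C) B = enat b"
    "\<And>l. p ^ l * (p - 1) * d l + e * rank l = e * rank (Suc l)"
    "a + (\<Sum>l<n. d l) = n * e * rank 0 + b"
proof -
  have "\<exists>d. \<delta> l = enat d \<and> p ^ l * (p - 1) * d + e * rank l = e * rank (Suc l)" for l
  proof -
    obtain c where c: "V.len (smult \<pi> ` F (Suc l) + F l) (F (Suc l)) = enat c"
      using rk_F[of l] unfolding rk_rank by (cases "V.len (smult \<pi> ` F (Suc l) + F l) (F (Suc l))") auto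
    have rc: "rank (Suc l) = rank l + c" using rk_F[of l] unfolding rk_rank c by simp
    have "p ^ l * (p - 1) > 0" using p_pos prime_gt_1_nat[OF p] by simp
    moreover have "of_nat (p ^ l * (p - 1)) * \<delta> l = enat (e * c)"
      using len_delta[of l] by (simp add: c of_nat_eq_enat)
    ultimately obtain d where d: "\<delta> l = enat d"
      by (cases "\<delta> l") (auto simp: of_nat_eq_enat imult_is_infinity zero_enat_def)
    then have "p ^ l * (p - 1) * d = e * c"
      using \<open>of_nat (p ^ l * (p - 1)) * \<delta> l = enat (e * c)\<close> by (simp add: of_nat_eq_enat)
    then show ?thesis using d rc by (simp add: distrib_left)
  qed
  then obtain d where d: "\<And>l. \<delta> l = enat (d l)"
    "\<And>l. p ^ l * (p - 1) * d l + e * rank l = e * rank (Suc l)" by metis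
  have sd: "(\<Sum>l<k. \<delta> l) = enat (\<Sum>l<k. d l)" for k
    by (induction k) (simp_all add: d(1) zero_enat_def)
  have DC: "V.len (D ` C + F 0) C = enat (\<Sum>l<n. d l)" by (simp only: len_D_C sd)
  have NF: "smult (of_nat (p ^ n * N)) ` F 0 = Norm ` F 0"
    by (intro image_cong refl Norm_F0[symmetric])
  have "V.len (Norm ` C) (F 0) \<le> V.len (smult (of_nat (p ^ n * N)) ` F 0) (F 0)"
    unfolding NF
      V.len_add[OF V.subspace_linear_image[OF linear_Norm subspace_F] subspace_Norm_C subspace_F
        image_mono[OF F_subset] Norm_mem_F0] by simp
  also have "\<dots> = enat (n * e * rank 0)"
    unfolding len_smult_order by (simp add: rk_rank of_nat_eq_enat)
  finally obtain a where a: "V.len (Norm ` C) (F 0) = enat a" by (cases "V.len (Norm ` C) (F 0)") auto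
  have H: "enat a + enat (\<Sum>l<n. d l) = enat (n * e * rank 0) + V.len (D ` C) B"
    using len_Herbrand unfolding a DC len_smult_order by (simp add: rk_rank of_nat_eq_enat)
  then obtain b where b: "V.len (D ` C) B = enat b" by (cases "V.len (D ` C) B") auto
  have "a + (\<Sum>l<n. d l) = n * e * rank 0 + b" using H by (simp add: b)
  with that[OF a b d(2)] show ?thesis .
qed

end

section \<open>The coefficients\<close>

text \<open>The divisors prime to \<open>p\<close> are those of \<open>N\<close>; the totient of
  \<open>p ^ n\<close> splits off and the remaining totients sum to \<open>N\<close>. This evaluates
  the denominator of the coefficients.\<close>

lemma sum_totient_coprime:
  assumes p: "prime p" and N: "coprime p N" "N > 0" and n: "n > 0"
  shows "(\<Sum>d | d dvd p ^ n * N \<and> coprime p d. totient (p ^ n * N div d)) = p ^ (n - 1) * (p - 1) * N"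
proof -
  have "{d. d dvd p ^ n * N \<and> coprime p d} = {d. d dvd N}"
  proof (intro equalityI subsetI)
    fix d assume "d \<in> {d. d dvd p ^ n * N \<and> coprime p d}"
    then have d: "d dvd p ^ n * N" "coprime d (p ^ n)" by (auto simp: coprime_commute)
    then show "d \<in> {d. d dvd N}" using coprime_dvd_mult_right_iff[OF d(2)] by simp
  next
    fix d assume "d \<in> {d. d dvd N}"
    then show "d \<in> {d. d dvd p ^ n * N \<and> coprime p d}"
      using N(1) coprime_divisors[of p p d N] by auto
  qed
  moreover have "totient (p ^ n * N div d) = totient (p ^ n) * totient (N div d)" if "d dvd N" for d
  proof -
    have "p ^ n * N div d = p ^ n * (N div d)" using that by (simp add: div_mult_swap)
    moreover have "coprime (p ^ n) (N div d)"
      using N(1) that coprime_divisors[of "p ^ n" "p ^ n" "N div d" N] by (auto elim: dvdE)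
    ultimately show ?thesis by (simp add: totient_mult_coprime)
  qed
  ultimately have "(\<Sum>d | d dvd p ^ n * N \<and> coprime p d. totient (p ^ n * N div d)) =
      totient (p ^ n) * (\<Sum>d | d dvd N. totient (N div d))"
    by (simp add: sum_distrib_left)
  also have "(\<Sum>d | d dvd N. totient (N div d)) = (\<Sum>d | d dvd N. totient d)"
    by (rule sum.reindex_bij_witness[of _ "\<lambda>d. N div d" "\<lambda>d. N div d"]) (use N(2) in \<open>auto simp: dvd_div_eq_mult\<close>)
  also have "\<dots> = N" by (rule totient_divisor_sum)
  also have "totient (p ^ n) = p ^ (n - 1) * (p - 1)" using totient_prime_power[OF p n] by simp
  finally show ?thesis .
qed

text \<open>The coefficient of an index with exact \<open>p\<close>-adic valuation
  \<open>l < n\<close>; \<open>N\<close> is the part of the order prime to \<open>p\<close>.\<close>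

definition coeff_level :: "nat \<Rightarrow> nat \<Rightarrow> nat \<Rightarrow> nat \<Rightarrow> 'k::field" where
  "coeff_level p n N l =
     (of_nat n - of_nat l - (of_nat n - of_nat l - 1) / of_nat p) / of_nat (p ^ (n - 1) * (p - 1) * N)"

text \<open>The difference of the two indicators singles out the level at which \<open>l\<close> is
  the exact valuation of \<open>k\<close>. If \<open>p ^ n\<close> divides \<open>k\<close>, in
  particular for \<open>k = 0\<close>, no level matches.\<close>

lemma tate_coeff_eq:
  assumes p: "prime p" and N: "coprime p N" "N > 0" and n: "n > 0"
  shows "(tate_coeff (p ^ n * N) p k :: 'k::field) =
    (\<Sum>l<n. coeff_level p n N l * (of_bool (p ^ l dvd k) - of_bool (p ^ Suc l dvd k)))"
proof -
  have mult: "multiplicity p (p ^ n * N) = n"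
  proof -
    have "\<not> p dvd N" using N(1) p prime_nat_iff by (metis coprime_absorb_left not_prime_unit)
    then show ?thesis using p N(2)
      by (intro multiplicity_eqI) (auto simp: mult.assoc prime_gt_0_nat)
  qed
  obtain l where l: "gcd k (p ^ n) = p ^ l" "l \<le> n"
    using p by (metis divides_primepow_nat gcd_dvd2)
  have dvd_iff: "p ^ j dvd k \<longleftrightarrow> j \<le> l" if "j \<le> n" for j
  proof -
    have "p ^ j dvd k \<longleftrightarrow> p ^ j dvd gcd k (p ^ n)" using that by (simp add: le_imp_power_dvd)
    also have "\<dots> \<longleftrightarrow> j \<le> l" using p l by (simp add: dvd_power_iff_le prime_ge_2_nat)
    finally show ?thesis .
  qed
  have p1: "p > 1" using p by (rule prime_gt_1_nat)
  have "(\<Sum>j<n. coeff_level p n N j * (of_bool (p ^ j dvd k) - of_bool (p ^ Suc j dvd k))) =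
      (\<Sum>j<n. if j = l then coeff_level p n N l else (0 :: 'k))"
  proof (intro sum.cong refl)
    fix j assume "j \<in> {..<n}"
    then have "p ^ j dvd k \<longleftrightarrow> j \<le> l" "p ^ Suc j dvd k \<longleftrightarrow> Suc j \<le> l" using dvd_iff[of j] dvd_iff[of "Suc j"] by auto
    then show "coeff_level p n N j * (of_bool (p ^ j dvd k) - of_bool (p ^ Suc j dvd k)) =
        (if j = l then coeff_level p n N l else (0 :: 'k))" by auto
  qed
  also have "\<dots> = (if l < n then coeff_level p n N l else 0)" by simp
  also have "\<dots> = tate_coeff (p ^ n * N) p k"
  proof -
    have ml: "multiplicity p (p ^ l) = l" using p by simp
    have c: "(\<Sum>d | d dvd p ^ n * N \<and> coprime p d. of_nat (totient (p ^ n * N div d))) =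
        (of_nat (p ^ (n - 1) * (p - 1) * N) :: 'k)"
      using sum_totient_coprime[OF assms] by (metis of_nat_sum)
    have "p ^ l = p ^ n \<longleftrightarrow> \<not> l < n" using p1 l(2) by auto
    then show ?thesis
      by (simp only: tate_coeff_def mult l(1) ml Let_def coeff_level_def c if_not_P) (simp only: times_divide_eq_left mult_1 split: if_split, simp)
  qed
  finally show ?thesis ..
qed

lemma sum_multiples:
  fixes t :: "nat \<Rightarrow> 'a::comm_monoid_add"
  assumes "q > 0"
  shows "(\<Sum>k | k < q * M \<and> q dvd k. t k) = (\<Sum>j<M. t (q * j))"
  by (rule sum.reindex_bij_witness[of _ "\<lambda>j. q * j" "\<lambda>k. k div q"]) (use assms in \<open>auto simp: less_mult_imp_div_less mult.commute\<close>)

lemma sum_tate_coeff: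
  fixes t :: "nat \<Rightarrow> 'k::field"
  assumes p: "prime p" and N: "coprime p N" "N > 0" and n: "n > 0"
  defines "S \<equiv> \<lambda>l. \<Sum>j<p ^ (n - l) * N. t (p ^ l * j)"
  shows "(\<Sum>k = 1..p ^ n * N - 1. tate_coeff (p ^ n * N) p k * t k) =
    (\<Sum>l<n. coeff_level p n N l * (S l - S (Suc l)))"
proof -
  define M where "M = p ^ n * N"
  have p0: "p > 0" using p by (rule prime_gt_0_nat)
  have M: "M > 0" using p0 N by (simp add: M_def)
  \<comment> \<open>The vanishing coefficient lets the sum start at 0, so that the multiples of
    \<open>p ^ l\<close> fill a full period.\<close>
  have "tate_coeff M p 0 = (0 :: 'k)" by (simp add: tate_coeff_eq[OF p N n] M_def)
  moreover have "{..<M} = insert 0 {1..M - 1}" using M by auto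
  ultimately have "(\<Sum>k = 1..M - 1. tate_coeff M p k * t k) = (\<Sum>k<M. tate_coeff M p k * t k)" by simp
  also have "\<dots> = (\<Sum>k<M. \<Sum>l<n. coeff_level p n N l * (of_bool (p ^ l dvd k) * t k - of_bool (p ^ Suc l dvd k) * t k))"
    by (simp add: M_def tate_coeff_eq[OF p N n] sum_distrib_right mult.assoc left_diff_distrib)
  also have "\<dots> = (\<Sum>l<n. coeff_level p n N l *
      ((\<Sum>k<M. of_bool (p ^ l dvd k) * t k) - (\<Sum>k<M. of_bool (p ^ Suc l dvd k) * t k)))"
    by (subst sum.swap) (simp add: sum_distrib_left[symmetric] sum_subtractf)
  also have "\<dots> = (\<Sum>l<n. coeff_level p n N l * (S l - S (Suc l)))"
  proof -
    have SS: "(\<Sum>k<M. of_bool (p ^ l dvd k) * t k) = S l" if "l \<le> n" for l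
    proof -
      have "(\<Sum>k<M. of_bool (p ^ l dvd k) * t k) = (\<Sum>k | k < M \<and> p ^ l dvd k. t k)"
        by (rule sum.mono_neutral_cong_right) auto
      moreover have "M = p ^ l * (p ^ (n - l) * N)" using that by (simp add: M_def mult.assoc[symmetric] power_add[symmetric])
      ultimately show ?thesis using sum_multiples[where q = "p ^ l" and M = "p ^ (n - l) * N" and t = t] p0 by (simp add: S_def)
    qed
    show ?thesis by (intro sum.cong refl) (simp only: SS lessThan_iff less_imp_le Suc_leI)
  qed
  finally show ?thesis by (simp add: M_def)
qed

text \<open>\<open>x l\<close> stands for the rank of \<open>F l\<close>: on the left is the
  Herbrand quotient divided by \<open>e\<close>, on the right the coefficients against the traces.
  Once the left sum is moved to the right, the \<open>l\<close>-th summand is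
  \<open>G l - G (Suc l)\<close>, where \<open>G 0\<close> is the leading term and
  \<open>G n = 0\<close>.\<close>

lemma Herbrand_telescope:
  fixes x :: "nat \<Rightarrow> 'k::field"
  assumes p: "(of_nat p :: 'k) \<noteq> 0" "(of_nat (p - 1) :: 'k) \<noteq> 0" "p > 1" and N: "(of_nat N :: 'k) \<noteq> 0" and n: "n > 0"
  shows "of_nat n * x 0 - (\<Sum>l<n. (x (Suc l) - x l) / of_nat (p ^ l * (p - 1))) =
    (\<Sum>l<n. coeff_level p n N l * (of_nat (p ^ (n - l) * N) * x l - of_nat (p ^ (n - Suc l) * N) * x (Suc l)))"
proof -
  define P where "P = (of_nat p :: 'k)"
  have P: "P \<noteq> 0" "P - 1 \<noteq> 0" "of_nat (p - 1) = P - 1" using p by (auto simp: P_def of_nat_diff)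
  define G where "G l = of_nat (n - l) * x l / P ^ l" for l
  have step: "coeff_level p n N l * (of_nat (p ^ (n - l) * N) * x l - of_nat (p ^ (n - Suc l) * N) * x (Suc l)) +
      (x (Suc l) - x l) / of_nat (p ^ l * (p - 1)) = G l - G (Suc l)" if l: "l < n" for l
  proof -
    obtain k where k: "n = Suc (l + k)" using l less_imp_Suc_add by blast
    have c: "coeff_level p n N l = (of_nat (Suc k) - of_nat k / P) / (P ^ (l + k) * (P - 1) * of_nat N)"
      using P(3) by (simp add: coeff_level_def k P_def[symmetric])
    have a: "of_nat (p ^ (n - l) * N) = P * P ^ k * of_nat N" "of_nat (p ^ (n - Suc l) * N) = P ^ k * of_nat N"
      by (simp_all add: k P_def Suc_diff_le)
    have G: "G l = of_nat (Suc k) * x l / P ^ l" "G (Suc l) = of_nat k * x (Suc l) / (P * P ^ l)"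
      by (simp_all add: G_def k Suc_diff_le)
    have d: "of_nat (p ^ l * (p - 1)) = P ^ l * (P - 1)" using P(3) by (simp add: P_def[symmetric])
    have "P ^ l \<noteq> 0" "P ^ k \<noteq> 0" using P by auto
    \<comment> \<open>Independent letters, \<open>Y\<close> for \<open>p ^ l\<close>,
      \<open>Z\<close> for \<open>p ^ k\<close>, \<open>V\<close> for \<open>N\<close>,
      \<open>W\<close> for \<open>p - 1\<close> and \<open>K\<close> for \<open>k\<close>, turn the
      claim into an identity of rational functions.\<close>
    moreover have e: "(K + 1 - K / P) / (Y * Z * W * V) * (P * Z * V * x l - Z * V * x (Suc l)) +
      (x (Suc l) - x l) / (Y * W) = (K + 1) * x l / Y - K * x (Suc l) / (P * Y)"
      if "Y \<noteq> 0" "Z \<noteq> 0" "V \<noteq> 0" "W \<noteq> 0" "W = P - 1" for Y Z W V K :: 'k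
    proof -
      have PW: "P = W + 1" using that by simp
      have f1: "(K + 1 - K / P) / (Y * Z * W * V) * (P * Z * V * x l - Z * V * x (Suc l)) =
          ((K + 1) * P - K) * (P * x l - x (Suc l)) / (P * Y * W)"
        using that P(1) by (simp add: divide_simps) (simp add: algebra_simps)
      have f2: "(x (Suc l) - x l) / (Y * W) = P * (x (Suc l) - x l) / (P * Y * W)"
        using P(1) by simp
      have f3: "(K + 1) * x l / Y - K * x (Suc l) / (P * Y) = ((K + 1) * x l * P - K * x (Suc l)) * W / (P * Y * W)"
        using that P(1) by (simp add: divide_simps)
      have f4: "((K + 1) * P - K) * (P * x l - x (Suc l)) + P * (x (Suc l) - x l) =
          ((K + 1) * x l * P - K * x (Suc l)) * W"
        unfolding PW by (simp add: algebra_simps)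
      show ?thesis unfolding f1 f2 f3 unfolding f4[symmetric] by (rule add_divide_distrib[symmetric])
    qed
    ultimately show ?thesis
      unfolding c a G d using e[of "P ^ l" "P ^ k" "of_nat N" "P - 1" "of_nat k"] N P
      by (simp add: power_add add.commute mult.commute[of "P ^ k" "P ^ l"])
  qed
  have "(\<Sum>l<n. coeff_level p n N l * (of_nat (p ^ (n - l) * N) * x l - of_nat (p ^ (n - Suc l) * N) * x (Suc l))) +
      (\<Sum>l<n. (x (Suc l) - x l) / of_nat (p ^ l * (p - 1))) = (\<Sum>l<n. G l - G (Suc l))"
    unfolding sum.distrib[symmetric] by (rule sum.cong[OF refl], rule step) simp
  also have "\<dots> = G 0 - G n" by (rule sum_lessThan_telescope')
  finally show ?thesis by (simp add: G_def algebra_simps)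
qed

section \<open>The trace formula for lattices\<close>

locale tate_lattice = factored_order_op \<pi> m s w f h
  for \<pi> :: "'r::idom" and m s :: nat and w :: 'r and f :: "nat \<Rightarrow> 'r poly" and h :: "'r poly \<Rightarrow> 'r poly" +
  fixes p n N e r :: nat and u w' :: 'r and g :: "'r poly \<Rightarrow> 'r poly"
  assumes p: "prime p" and u: "u dvd 1" and p_eq: "of_nat p = u * \<pi> ^ e" and e: "e > 0"
    and w': "w' * of_nat N = 1" and n: "n > 0" and p_N: "coprime p N"
    and g: "V.linear_op g" and g_order: "(g ^^ (p ^ n * N)) x = x"
    and gL: "x \<in> below_degree r \<Longrightarrow> g x \<in> below_degree r"
    and hL: "x \<in> below_degree r \<Longrightarrow> h x \<in> below_degree r"
    and g_h: "g (h x) = h (g x)"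
begin

abbreviation L :: "'r poly set" where "L \<equiv> below_degree r"

lemma E_g: "E i (g x) = g (E i x)"
  by (rule E_commute[OF g g_h])

lemma subspace_L: "V.subspace L"
  by (rule is_basis_subspace[OF is_basis_below_degree])

lemma stable_L: "stable L"
  using hL subspace_L by (auto simp: stable_def)

sublocale cyclic_lattice \<pi> p n N e r u w' g L
  by unfold_locales (use p u p_eq w' char_0 g g_order gL subspace_L in auto)

lemma E_g_pow: "E i ((g ^^ k) x) = (g ^^ k) (E i x)"
  by (induction k) (simp_all add: E_g)

lemma E_D: "E i (D x) = D (E i x)"
  by (simp add: D_def E_g V.linear_op_diff[OF linear_E])

lemma E_Norm: "E i (Norm x) = Norm (E i x)"
  by (simp add: Norm_def E_g_pow V.linear_op_sum[OF linear_E])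

lemma h_g_pow: "h ((g ^^ k) x) = (g ^^ k) (h x)"
  by (induction k) (simp_all add: g_h[symmetric])

lemma h_D: "h (D x) = D (h x)"
  by (simp add: D_def g_h V.linear_op_diff[OF h])

lemma h_Norm: "h (Norm x) = Norm (h x)"
  by (simp add: Norm_def h_g_pow V.linear_op_sum[OF h])

lemma stable_F: "stable (F l)"
  using subspace_F hL by (auto simp: stable_def F_def h_g_pow[symmetric])

lemma stable_B: "stable B"
  using subspace_B hL by (auto simp: stable_def B_def h_Norm[symmetric] V.linear_op_0[OF h])

lemma stable_Norm_L: "stable (Norm ` L)"
  using subspace_Norm_C hL by (auto simp: stable_def h_Norm)

lemma stable_D_L: "stable (D ` L)"
  using subspace_D_C hL by (auto simp: stable_def h_D)

text \<open>As \<open>E i\<close> commutes with \<open>g\<close>, each component of \<open>L\<close>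
  is a lattice of the same kind, so the Herbrand quotient is available component by
  component.\<close>

lemma cyclic_lattice_E: "cyclic_lattice \<pi> p n N e r u w' g (E i ` L)"
proof unfold_locales
  show "V.subspace (E i ` L)" by (rule V.subspace_linear_image[OF linear_E subspace_L])
  show "E i ` L \<subseteq> L" by (rule E_image_subset[OF stable_L])
  show "g x \<in> E i ` L" if "x \<in> E i ` L" for x using that gL by (auto simp: E_g[symmetric])
qed (use p u p_eq w' char_0 g g_order in auto)

lemma E_image_F: "i < s \<Longrightarrow> E i ` F l = cyclic_lattice.F p g (E i ` L) l"
proof -
  assume i: "i < s"
  interpret Ci: cyclic_lattice \<pi> p n N e r u w' g "E i ` L" by (rule cyclic_lattice_E)
  show ?thesis
  proof (intro equalityI subsetI)
    fix x assume "x \<in> E i ` F l"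
    then show "x \<in> Ci.F l" by (auto simp: F_def Ci.F_def E_g_pow[symmetric])
  next
    fix x assume x: "x \<in> Ci.F l"
    then have "x = E i x" using E_fix[OF i, of x L] by (simp add: Ci.F_def)
    moreover have "x \<in> F l" using x E_image_subset[OF stable_L, of i] by (auto simp: F_def Ci.F_def)
    ultimately show "x \<in> E i ` F l" by (rule image_eqI)
  qed
qed

lemma E_image_B: "i < s \<Longrightarrow> E i ` B = cyclic_lattice.B p n N g (E i ` L)"
proof -
  assume i: "i < s"
  interpret Ci: cyclic_lattice \<pi> p n N e r u w' g "E i ` L" by (rule cyclic_lattice_E)
  show ?thesis
  proof (intro equalityI subsetI)
    fix x assume "x \<in> E i ` B"
    then show "x \<in> Ci.B" by (auto simp: B_def Ci.B_def E_Norm[symmetric] V.linear_op_0[OF linear_E])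
  next
    fix x assume x: "x \<in> Ci.B"
    then have "x = E i x" using E_fix[OF i, of x L] by (simp add: Ci.B_def)
    moreover have "x \<in> B" using x E_image_subset[OF stable_L, of i] by (auto simp: B_def Ci.B_def)
    ultimately show "x \<in> E i ` B" by (rule image_eqI)
  qed
qed

text \<open>The length over R of the \<open>i\<close>-th component of the Tate group in degree 0,
  not the multiplicity of a simple module.\<close>

definition multiplicity0 :: "nat \<Rightarrow> nat" where
  "multiplicity0 i = the_enat (V.len (E i ` Norm ` L) (E i ` F 0))"

definition multiplicity1 :: "nat \<Rightarrow> nat" where
  "multiplicity1 i = the_enat (V.len (E i ` D ` L) (E i ` B))"

definition rank_E :: "nat \<Rightarrow> nat \<Rightarrow> nat" where
  "rank_E i l = the_enat (rk (E i ` F l))"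

lemma of_nat_fract_nonzero: "k > 0 \<Longrightarrow> of_nat k \<noteq> (0 :: 'r fract)"
  using char_0[of k] by (metis of_nat_to_fract to_fract_eq_0_iff)

lemma multiplicity_diff:
  assumes i: "i < s"
  shows "(of_nat (multiplicity0 i) - of_nat (multiplicity1 i) :: 'r fract) / of_nat e =
    (\<Sum>l<n. coeff_level p n N l *
      (of_nat (p ^ (n - l) * N) * of_nat (rank_E i l) - of_nat (p ^ (n - Suc l) * N) * of_nat (rank_E i (Suc l))))"
proof -
  interpret Ci: cyclic_lattice \<pi> p n N e r u w' g "E i ` L" by (rule cyclic_lattice_E)
  have im: "E i ` Norm ` L = Norm ` E i ` L" "E i ` D ` L = D ` E i ` L"
    by (simp_all add: image_image E_Norm E_D)
  obtain a b d where H: "V.len (Norm ` E i ` L) (Ci.F 0) = enat a" "V.len (D ` E i ` L) Ci.B = enat b"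
    "\<And>l. p ^ l * (p - 1) * d l + e * Ci.rank l = e * Ci.rank (Suc l)"
    "a + (\<Sum>l<n. d l) = n * e * Ci.rank 0 + b"
    using Ci.Herbrand_quotient by metis
  have ab: "multiplicity0 i = a" "multiplicity1 i = b"
    unfolding multiplicity0_def multiplicity1_def im E_image_F[OF i] E_image_B[OF i] H(1,2) by simp_all
  have rank: "rank_E i l = Ci.rank l" for l by (simp add: rank_E_def Ci.rank_def E_image_F[OF i])
  have p1: "p > 1" using p by (rule prime_gt_1_nat)
  have E0: "(of_nat e :: 'r fract) \<noteq> 0" using e by (rule of_nat_fract_nonzero)
  have "of_nat (d l) / (of_nat e :: 'r fract) =
      (of_nat (rank_E i (Suc l)) - of_nat (rank_E i l)) / of_nat (p ^ l * (p - 1))" for l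
  proof -
    have nz: "of_nat (p ^ l * (p - 1)) \<noteq> (0 :: 'r fract)" using p1 by (intro of_nat_fract_nonzero) simp
    have "of_nat (p ^ l * (p - 1) * d l + e * rank_E i l) = (of_nat (e * rank_E i (Suc l)) :: 'r fract)"
      by (simp only: H(3) rank)
    then have "of_nat (p ^ l * (p - 1)) * of_nat (d l) =
        (of_nat e * (of_nat (rank_E i (Suc l)) - of_nat (rank_E i l)) :: 'r fract)"
      by (simp only: of_nat_add of_nat_mult[of _ "d l"] of_nat_mult[of e] right_diff_distrib eq_diff_eq)
    then show ?thesis using E0 nz by (simp add: frac_eq_eq mult.commute)
  qed
  then have d: "(\<Sum>l<n. of_nat (d l) / (of_nat e :: 'r fract)) =
      (\<Sum>l<n. (of_nat (rank_E i (Suc l)) - of_nat (rank_E i l)) / of_nat (p ^ l * (p - 1)))" by simp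
  have "of_nat (a + (\<Sum>l<n. d l)) = (of_nat (n * e * rank_E i 0 + b) :: 'r fract)" by (simp only: H(4) rank)
  then have "(of_nat a - of_nat b :: 'r fract) = of_nat e * (of_nat n * of_nat (rank_E i 0)) - (\<Sum>l<n. of_nat (d l))"
    by (simp add: algebra_simps)
  then have "(of_nat a - of_nat b :: 'r fract) / of_nat e =
      of_nat n * of_nat (rank_E i 0) - (\<Sum>l<n. of_nat (d l) / of_nat e)"
    using E0 by (simp add: diff_divide_distrib sum_divide_distrib)
  also have "\<dots> = of_nat n * of_nat (rank_E i 0) -
      (\<Sum>l<n. (of_nat (rank_E i (Suc l)) - of_nat (rank_E i l)) / of_nat (p ^ l * (p - 1)))" by (simp only: d)
  also have "\<dots> = (\<Sum>l<n. coeff_level p n N l *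
      (of_nat (p ^ (n - l) * N) * of_nat (rank_E i l) - of_nat (p ^ (n - Suc l) * N) * of_nat (rank_E i (Suc l))))"
  proof (rule Herbrand_telescope[OF _ _ p1 _ n])
    show "of_nat p \<noteq> (0 :: 'r fract)" "of_nat (p - 1) \<noteq> (0 :: 'r fract)" "of_nat N \<noteq> (0 :: 'r fract)"
      using p1 N_pos by (intro of_nat_fract_nonzero; simp)+
  qed
  finally show ?thesis by (simp only: ab)
qed

text \<open>The sum \<open>Q\<close> of the powers of \<open>g ^^ (p ^ l)\<close> maps
  \<open>L\<close> into \<open>F l\<close> and multiplies \<open>F l\<close> by the number of terms,
  so \<open>submodule_trace_comp_projection\<close> applies.\<close>

lemma trace_F:
  assumes l: "l \<le> n"
  shows "(\<Sum>j<p ^ (n - l) * N. submodule_trace L (\<lambda>x. (g ^^ (p ^ l * j)) (h x))) =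
    of_nat (p ^ (n - l) * N) * submodule_trace (F l) h"
proof -
  define Q where "Q x = (\<Sum>j<p ^ (n - l) * N. smult 1 ((g ^^ (p ^ l * j)) x))" for x
  have Q: "V.linear_op Q" unfolding Q_def[abs_def] by (rule linear_op_sum_smult[OF linear_g])
  have "V.subspace (F l)" "F l \<subseteq> L" by (rule subspace_F, rule F_subset)
  then obtain t c where F: "is_basis t c (F l)" using exists_basis by blast
  have "submodule_trace L (\<lambda>x. h (Q x)) = of_nat (p ^ (n - l) * N) * submodule_trace (F l) h"
  proof (rule submodule_trace_comp_projection[OF is_basis_below_degree F F_subset h Q])
    show "h x \<in> F l" if "x \<in> F l" for x using stableD(2)[OF stable_F that] .
    show QF: "Q x \<in> F l" if x: "x \<in> L" for x
    proof -
      obtain k where k: "p ^ (n - l) * N = Suc k"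
        using N_pos p_pos by (metis gr0_implies_Suc nat_0_less_mult_iff zero_less_power)
      have "(g ^^ (p ^ l)) ((g ^^ (p ^ l * k)) x) = (g ^^ (p ^ l * Suc k)) x" by (simp add: funpow_add)
      also have "p ^ l * Suc k = p ^ n * N" using l by (simp add: k[symmetric] mult.assoc[symmetric] power_add[symmetric])
      finally have "(g ^^ (p ^ l)) (Q x) = Q x" unfolding Q_def smult_1_left k by (intro sum_shift) (simp add: g_order)
      moreover have "Q x \<in> L" unfolding Q_def smult_1_left by (intro V.subspace_sum subspace_L gC_pow x)
      ultimately show ?thesis by (simp add: F_def)
    qed
    show "Q x = smult (of_nat (p ^ (n - l) * N)) x" if "x \<in> F l" for x
      using that g_pow_fixed[of "p ^ l" x] by (simp add: Q_def F_def of_nat_poly)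
    show "h (Q x) \<in> L" if "x \<in> L" for x using QF[OF that] F_subset hL by blast
  qed
  moreover have "(\<lambda>x. h (Q x)) = (\<lambda>x. \<Sum>j<p ^ (n - l) * N. smult 1 ((g ^^ (p ^ l * j)) (h x)))"
    by (simp add: Q_def V.linear_op_sum[OF h] h_g_pow fun_eq_iff)
  moreover have "submodule_trace L (\<lambda>x. \<Sum>j<p ^ (n - l) * N. smult 1 ((g ^^ (p ^ l * j)) (h x))) =
      (\<Sum>j<p ^ (n - l) * N. 1 * submodule_trace L (\<lambda>x. (g ^^ (p ^ l * j)) (h x)))"
    by (rule submodule_trace_sum[OF is_basis_below_degree]) (auto intro: linear_op_comp linear_g h gC_pow hL)
  ultimately show ?thesis by simp
qed

text \<open>Both sides split over the components with weights \<open>\<kappa> i\<close>;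
  \<open>multiplicity_diff\<close> matches the inner sums.\<close>

theorem tate_trace_formula:
  "1 / of_nat e * ((\<Sum>i<s. \<kappa> i * of_nat (multiplicity0 i)) - (\<Sum>i<s. \<kappa> i * of_nat (multiplicity1 i))) =
    (\<Sum>k = 1..p ^ n * N - 1. tate_coeff (p ^ n * N) p k * to_fract (submodule_trace L (\<lambda>x. (g ^^ k) (h x))))"
proof -
  define t where "t k = to_fract (submodule_trace L (\<lambda>x. (g ^^ k) (h x)))" for k
  define S where "S l = (\<Sum>j<p ^ (n - l) * N. t (p ^ l * j))" for l
  have S: "S l = (\<Sum>i<s. \<kappa> i * (of_nat (p ^ (n - l) * N) * of_nat (rank_E i l)))" if "l \<le> n" for l
  proof -
    have "S l = to_fract (\<Sum>j<p ^ (n - l) * N. submodule_trace L (\<lambda>x. (g ^^ (p ^ l * j)) (h x)))"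
      by (simp add: S_def t_def to_fract_sum)
    also have "\<dots> = of_nat (p ^ (n - l) * N) * to_fract (submodule_trace (F l) h)"
      by (simp only: trace_F[OF that] to_fract_mult of_nat_to_fract)
    also have "\<dots> = of_nat (p ^ (n - l) * N) * (\<Sum>i<s. \<kappa> i * of_nat (rank_E i l))"
      by (simp only: trace_decomposition[OF stable_F F_subset] rank_E_def)
    finally show ?thesis by (simp add: sum_distrib_left mult_ac)
  qed
  have "(\<Sum>k = 1..p ^ n * N - 1. tate_coeff (p ^ n * N) p k * t k) = (\<Sum>l<n. coeff_level p n N l * (S l - S (Suc l)))"
    unfolding S_def by (rule sum_tate_coeff[OF p p_N N_pos n])
  also have "\<dots> = (\<Sum>l<n. \<Sum>i<s. \<kappa> i * (coeff_level p n N l *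
      (of_nat (p ^ (n - l) * N) * of_nat (rank_E i l) - of_nat (p ^ (n - Suc l) * N) * of_nat (rank_E i (Suc l)))))"
  proof (intro sum.cong refl)
    fix l assume "l \<in> {..<n}"
    then have l: "l \<le> n" "Suc l \<le> n" by auto
    show "coeff_level p n N l * (S l - S (Suc l)) = (\<Sum>i<s. \<kappa> i * (coeff_level p n N l *
      (of_nat (p ^ (n - l) * N) * of_nat (rank_E i l) - of_nat (p ^ (n - Suc l) * N) * of_nat (rank_E i (Suc l)))))"
      unfolding S[OF l(1)] S[OF l(2)] sum_subtractf[symmetric] sum_distrib_left
      by (intro sum.cong refl) (simp only: right_diff_distrib mult.left_commute[of "coeff_level p n N l"])
  qed
  also have "\<dots> = (\<Sum>i<s. \<kappa> i * ((of_nat (multiplicity0 i) - of_nat (multiplicity1 i)) / of_nat e))"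
    by (subst sum.swap, intro sum.cong refl) (simp only: sum_distrib_left[symmetric] multiplicity_diff lessThan_iff)
  also have "\<dots> = 1 / of_nat e * ((\<Sum>i<s. \<kappa> i * of_nat (multiplicity0 i)) - (\<Sum>i<s. \<kappa> i * of_nat (multiplicity1 i)))"
    unfolding sum_subtractf[symmetric] sum_distrib_left
    by (intro sum.cong refl) (simp add: right_diff_distrib diff_divide_distrib)
  finally show ?thesis by (simp only: t_def)
qed

lemma len_H0_finite: "V.len (Norm ` L) (F 0) \<noteq> \<infinity>" and len_H1_finite: "V.len (D ` L) B \<noteq> \<infinity>"
  using Herbrand_quotient by (metis enat.distinct(1))+

end

section \<open>Brauer characters of subquotients\<close>

context factored_order_op
begin

text \<open>\<open>R\<close> identifies \<open>P1 / P0\<close> equivariantly with the reduction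
  modulo \<open>\<pi>\<close> of the lattice on which \<open>h'\<close> acts. The same polynomials
  \<open>idem i\<close> cut out components on both sides, so the rank of a component of the lattice,
  being the length of its reduction, can be measured in \<open>P1 / P0\<close>.\<close>

lemma lift_trace:
  assumes P: "stable P0" "stable P1" "P0 \<subseteq> P1"
    and h': "factored_order_op \<pi> m s w f h'" and hL: "h' ` below_degree t \<subseteq> below_degree t"
    and R: "V.correspondence R" and dom: "Domain R = P1" and ran: "Range R = below_degree t"
    and ker: "\<And>x y. (x, y) \<in> R \<Longrightarrow> x \<in> P0 \<longleftrightarrow> y \<in> smult \<pi> ` below_degree t"
    and equiv: "\<And>x y. (x, y) \<in> R \<Longrightarrow> (h x, h' y) \<in> R"
  shows "to_fract (submodule_trace (below_degree t) h') =
    (\<Sum>i<s. \<kappa> i * of_nat (the_enat (V.len (E i ` P0) (E i ` P1))))"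
proof -
  interpret H: factored_order_op \<pi> m s w f h' by (rule h')
  let ?L = "below_degree t :: 'a poly set"
  have L: "V.subspace ?L" by (rule is_basis_subspace[OF is_basis_below_degree])
  have stL: "H.stable ?L" using L hL by (simp add: H.stable_def)
  have stpL: "H.stable (smult \<pi> ` ?L)"
    unfolding H.stable_def
  proof
    show "V.subspace (smult \<pi> ` ?L)" by (rule V.subspace_linear_image[OF linear_op_smult L])
    show "h' ` smult \<pi> ` ?L \<subseteq> smult \<pi> ` ?L" using hL by (auto simp: V.linear_op_scale[OF H.h])
  qed
  have pL: "smult \<pi> ` ?L \<subseteq> ?L" using L by (auto intro: V.subspace_scale)
  have act: "(poly_act q h x, poly_act q h' y) \<in> R" if "(x, y) \<in> R" for q x y
    by (induction q)
       (auto simp: poly_act_pCons[OF h] poly_act_pCons[OF H.h] V.corr_0[OF R]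
         intro!: V.corr_add[OF R] V.corr_scale[OF R] equiv that)
  have actE: "(E i x, H.E i y) \<in> R" if "(x, y) \<in> R" for i x y
    unfolding E_def H.E_def by (rule act[OF that])
  have "rk (H.E i ` ?L) = V.len (E i ` P0) (E i ` P1)" if i: "i < s" for i
  proof -
    have "rk (H.E i ` ?L) = V.len (H.E i ` smult \<pi> ` ?L) (H.E i ` ?L)"
      by (simp add: rk_def image_image V.linear_op_scale[OF H.linear_E])
    also have "\<dots> = V.len (smult \<pi> ` ?L) (H.E i ` ?L + smult \<pi> ` ?L)"
      using H.len_E_image[OF stpL stL pL i] by simp
    also have "\<dots> = V.len P0 (E i ` P1 + P0)"
    proof -
      have 1: "R `` P0 = smult \<pi> ` ?L"
        using ker ran pL by (auto simp: set_eq_iff Image_iff) (metis RangeE subsetD imageI)+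
      have 2: "R `` (E i ` P1 + P0) = H.E i ` ?L + smult \<pi> ` ?L"
      proof (intro equalityI subsetI)
        fix y assume "y \<in> R `` (E i ` P1 + P0)"
        then obtain x where x: "x \<in> E i ` P1 + P0" "(x, y) \<in> R" by auto
        from x(1) obtain z' z0 where z': "z' \<in> E i ` P1" and z0: "z0 \<in> P0" and xz: "x = z' + z0" by (rule set_plus_elim)
        from z' obtain z where z: "z \<in> P1" "z' = E i z" by auto
        obtain y1 where y1: "(z, y1) \<in> R" using z(1) dom by auto
        have "(x - E i z, y - H.E i y1) \<in> R" by (rule V.corr_diff[OF R x(2) actE[OF y1]])
        then have "y - H.E i y1 \<in> smult \<pi> ` ?L" using ker z0 xz z(2) by auto
        moreover have "y1 \<in> ?L" using y1 ran by auto
        ultimately have "H.E i y1 + (y - H.E i y1) \<in> H.E i ` ?L + smult \<pi> ` ?L" by (intro set_plus_intro imageI)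
        then show "y \<in> H.E i ` ?L + smult \<pi> ` ?L" by simp
      next
        fix y assume "y \<in> H.E i ` ?L + smult \<pi> ` ?L"
        then obtain a b where "a \<in> H.E i ` ?L" and b: "b \<in> smult \<pi> ` ?L" and y: "y = a + b" by (rule set_plus_elim)
        then obtain z where z: "z \<in> ?L" "a = H.E i z" by auto
        obtain x where x: "(x, z) \<in> R" using z(1) ran by auto
        obtain x0 where x0: "(x0, b) \<in> R" using b pL ran by blast
        have "(E i x + x0, y) \<in> R" unfolding y z(2) by (rule V.corr_add[OF R actE[OF x] x0])
        moreover have "x0 \<in> P0" using ker[OF x0] b by simp
        moreover have "x \<in> P1" using x dom by auto
        ultimately show "y \<in> R `` (E i ` P1 + P0)" by (intro ImageI[of "E i x + x0"] set_plus_intro imageI)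
      qed
      have "V.len (R `` P0) (R `` (E i ` P1 + P0)) = V.len P0 (E i ` P1 + P0)"
      proof (rule V.len_Image[OF R])
        show "V.subspace P0" using stableD(1)[OF P(1)] .
        show "V.subspace (E i ` P1 + P0)"
          by (intro V.subspace_plus stableD(1)[OF P(1)] stableD(1)[OF stable_E_image[OF P(2)]])
        show "P0 \<subseteq> E i ` P1 + P0" by (rule V.plus_upper2[OF stableD(1)[OF stable_E_image[OF P(2)]]])
        show "E i ` P1 + P0 \<subseteq> Domain R" unfolding dom
          by (rule V.plus_least[OF stableD(1)[OF P(2)] E_image_subset[OF P(2)] P(3)])
        have "0 \<in> smult \<pi> ` ?L" using V.subspace_0[OF H.stableD(1)[OF stpL]] .
        then show "{x. (x, 0) \<in> R} \<subseteq> P0" using ker by blast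
      qed
      then show ?thesis by (simp only: 1 2)
    qed
    also have "\<dots> = V.len (E i ` P0) (E i ` P1)" by (rule len_E_image[OF P i])
    finally show ?thesis .
  qed
  then show ?thesis using H.trace_decomposition[OF stL subset_refl] by simp
qed

text \<open>Finiteness of the total length bounds every term, which makes \<open>the_enat\<close>
  additive here.\<close>

lemma sum_len_chain:
  assumes st: "\<And>j. j \<le> k \<Longrightarrow> stable (P j)" and mono: "\<And>j. j < k \<Longrightarrow> P j \<subseteq> P (Suc j)"
    and fin: "V.len (P 0) (P k) \<noteq> \<infinity>" and i: "i < s"
  shows "(\<Sum>j<k. the_enat (V.len (E i ` P j) (E i ` P (Suc j)))) = the_enat (V.len (E i ` P 0) (E i ` P k))"
proof -
  have sub: "P 0 \<subseteq> P j" if "j \<le> k" for j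
    using that
  proof (induction j)
    case (Suc j)
    then show ?case using mono[of j] by auto
  qed simp
  have "V.len (E i ` P 0) (E i ` P j) = (\<Sum>j<j. V.len (E i ` P j) (E i ` P (Suc j)))" if "j \<le> k" for j
    using that
  proof (induction j)
    case (Suc j)
    have "V.len (E i ` P 0) (E i ` P (Suc j)) =
        V.len (E i ` P 0) (E i ` P j) + V.len (E i ` P j) (E i ` P (Suc j))"
      using Suc.prems sub[of j] mono[of j]
      by (intro V.len_add image_mono stableD(1)[OF stable_E_image] st) auto
    then show ?case using Suc by simp
  qed simp
  then have eq: "V.len (E i ` P 0) (E i ` P k) = (\<Sum>j<k. V.len (E i ` P j) (E i ` P (Suc j)))" by simp
  have "V.len (E i ` P 0) (E i ` P k) = V.len (P 0) (E i ` P k + P 0)"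
    using len_E_image[OF st[of 0] st[of k] sub[of k] i] by simp
  also have "\<dots> \<le> V.len (P 0) (P k)"
    using st[of 0] st[of k] sub[of k]
    by (intro V.len_mono2 V.subspace_plus V.plus_least V.plus_upper2 E_image_subset stableD(1)[OF stable_E_image])
       (auto simp: stableD(1))
  finally have "V.len (E i ` P 0) (E i ` P k) \<noteq> \<infinity>" using fin by (cases "V.len (P 0) (P k)") (auto dest: enat_ile)
  moreover have "V.len (E i ` P j) (E i ` P (Suc j)) \<le> V.len (E i ` P 0) (E i ` P k)" if "j < k" for j
    unfolding eq by (rule member_le_sum) (use that in auto)
  ultimately have "\<forall>j\<in>{..<k}. V.len (E i ` P j) (E i ` P (Suc j)) \<noteq> \<infinity>"
    by (metis enat_ord_simps(5) lessThan_iff)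
  then have "(\<Sum>j<k. V.len (E i ` P j) (E i ` P (Suc j))) =
      (\<Sum>j<k. enat (the_enat (V.len (E i ` P j) (E i ` P (Suc j)))))"
    by (intro sum.cong refl) (metis not_infinity_eq the_enat.simps)
  also have "\<dots> = enat (\<Sum>j<k. the_enat (V.len (E i ` P j) (E i ` P (Suc j))))"
    by (induction k) (simp_all add: zero_enat_def)
  finally show ?thesis by (simp add: eq)
qed

end

section \<open>Presentations of modules by submodules of the polynomial ring\<close>

text \<open>
  \<open>presents \<psi> P Q S\<close> says that \<open>\<psi>\<close> induces an isomorphism from \<open>P / Q\<close> to the module \<open>S\<close>.
\<close>

definition presents ::
    "('r::idom poly \<Rightarrow> 'm) \<Rightarrow> 'r poly set \<Rightarrow> 'r poly set \<Rightarrow> ('r, 'm) module \<Rightarrow> bool" where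
  "presents \<psi> P Q S \<longleftrightarrow>
     V.subspace P \<and> V.subspace Q \<and> Q \<subseteq> P \<and> \<psi> ` P = carrier S \<and>
     (\<forall>x\<in>P. \<forall>y\<in>P. \<psi> (x + y) = \<psi> x \<oplus>\<^bsub>S\<^esub> \<psi> y) \<and>
     (\<forall>c. \<forall>x\<in>P. \<psi> (smult c x) = c \<odot>\<^bsub>S\<^esub> \<psi> x) \<and>
     (\<forall>x\<in>P. \<psi> x = \<zero>\<^bsub>S\<^esub> \<longleftrightarrow> x \<in> Q)"

locale presentation =
  fixes \<psi> :: "'r::idom poly \<Rightarrow> 'm" and P Q :: "'r poly set" and S :: "('r, 'm) module"
  assumes presents: "presents \<psi> P Q S"
begin

lemma P: "V.subspace P" and Q: "V.subspace Q" and QP: "Q \<subseteq> P" and image: "\<psi> ` P = carrier S"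
  using presents by (auto simp: presents_def)

lemma \<psi>_add: "x \<in> P \<Longrightarrow> y \<in> P \<Longrightarrow> \<psi> (x + y) = \<psi> x \<oplus>\<^bsub>S\<^esub> \<psi> y"
  and \<psi>_smult: "x \<in> P \<Longrightarrow> \<psi> (smult c x) = c \<odot>\<^bsub>S\<^esub> \<psi> x"
  and \<psi>_zero_iff: "x \<in> P \<Longrightarrow> \<psi> x = \<zero>\<^bsub>S\<^esub> \<longleftrightarrow> x \<in> Q"
  using presents by (auto simp: presents_def)

lemma P0: "0 \<in> P" and Padd: "x \<in> P \<Longrightarrow> y \<in> P \<Longrightarrow> x + y \<in> P"
  and Psmult: "x \<in> P \<Longrightarrow> smult c x \<in> P" and Pdiff: "x \<in> P \<Longrightarrow> y \<in> P \<Longrightarrow> x - y \<in> P"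
  and Pminus: "x \<in> P \<Longrightarrow> - x \<in> P"
  using P by (auto intro: V.subspace_0 V.subspace_add V.subspace_scale V.subspace_diff V.subspace_neg)

lemma \<psi>_0: "\<psi> 0 = \<zero>\<^bsub>S\<^esub>"
  using \<psi>_zero_iff[OF P0] V.subspace_0[OF Q] by simp

lemma \<psi>_closed: "x \<in> P \<Longrightarrow> \<psi> x \<in> carrier S"
  using image by auto

lemma carrierE: "u \<in> carrier S \<Longrightarrow> (\<And>x. x \<in> P \<Longrightarrow> u = \<psi> x \<Longrightarrow> thesis) \<Longrightarrow> thesis"
  unfolding image[symmetric] by auto

text \<open>As \<open>\<psi>\<close> is onto and respects the operations, the axioms are inherited
  from \<open>P\<close>. In this way submodules, quotients and subquotients become modules by one
  argument.\<close>

lemma abelian_group: "abelian_group S"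
proof (rule abelian_groupI)
  show "u \<oplus>\<^bsub>S\<^esub> v \<in> carrier S" if "u \<in> carrier S" "v \<in> carrier S" for u v
    using that by (elim carrierE) (simp add: \<psi>_add[symmetric] \<psi>_closed Padd)
  show "\<zero>\<^bsub>S\<^esub> \<in> carrier S" using \<psi>_closed[OF P0] by (simp add: \<psi>_0)
  show "u \<oplus>\<^bsub>S\<^esub> v \<oplus>\<^bsub>S\<^esub> w = u \<oplus>\<^bsub>S\<^esub> (v \<oplus>\<^bsub>S\<^esub> w)"
    if "u \<in> carrier S" "v \<in> carrier S" "w \<in> carrier S" for u v w
    using that by (elim carrierE) (simp add: \<psi>_add[symmetric] Padd add.assoc)
  show "u \<oplus>\<^bsub>S\<^esub> v = v \<oplus>\<^bsub>S\<^esub> u" if "u \<in> carrier S" "v \<in> carrier S" for u v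
    using that by (elim carrierE) (simp add: \<psi>_add[symmetric] add.commute)
  show "\<zero>\<^bsub>S\<^esub> \<oplus>\<^bsub>S\<^esub> u = u" if "u \<in> carrier S" for u
    using that by (elim carrierE) (simp add: \<psi>_add[symmetric] P0 flip: \<psi>_0)
  show "\<exists>v\<in>carrier S. v \<oplus>\<^bsub>S\<^esub> u = \<zero>\<^bsub>S\<^esub>" if "u \<in> carrier S" for u
    using that
  proof (rule carrierE)
    fix x assume x: "x \<in> P" "u = \<psi> x"
    have "\<psi> (- x) \<oplus>\<^bsub>S\<^esub> u = \<psi> (- x + x)" unfolding x(2) by (rule \<psi>_add[symmetric, OF Pminus[OF x(1)] x(1)])
    then have "\<psi> (- x) \<oplus>\<^bsub>S\<^esub> u = \<zero>\<^bsub>S\<^esub>" by (simp add: \<psi>_0)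
    then show ?thesis using \<psi>_closed[OF Pminus[OF x(1)]] by blast
  qed
qed

lemma module: "Module.module class_ring S"
proof (rule moduleI)
  show "cring (class_ring :: 'r ring)" by (rule class_cring.is_cring)
  show "abelian_group S" by (rule abelian_group)
  show "a \<odot>\<^bsub>S\<^esub> u \<in> carrier S" if "u \<in> carrier S" for a u
    using that by (elim carrierE) (simp add: \<psi>_smult[symmetric] \<psi>_closed Psmult)
  show "(a \<oplus>\<^bsub>class_ring\<^esub> b) \<odot>\<^bsub>S\<^esub> u = a \<odot>\<^bsub>S\<^esub> u \<oplus>\<^bsub>S\<^esub> b \<odot>\<^bsub>S\<^esub> u" if "u \<in> carrier S" for a b u
    using that by (elim carrierE) (simp add: \<psi>_smult[symmetric] \<psi>_add[symmetric] Psmult smult_add_left)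
  show "a \<odot>\<^bsub>S\<^esub> (u \<oplus>\<^bsub>S\<^esub> v) = a \<odot>\<^bsub>S\<^esub> u \<oplus>\<^bsub>S\<^esub> a \<odot>\<^bsub>S\<^esub> v" if "u \<in> carrier S" "v \<in> carrier S" for a u v
    using that by (elim carrierE) (simp add: \<psi>_smult[symmetric] \<psi>_add[symmetric] Psmult Padd smult_add_right)
  show "(a \<otimes>\<^bsub>class_ring\<^esub> b) \<odot>\<^bsub>S\<^esub> u = a \<odot>\<^bsub>S\<^esub> (b \<odot>\<^bsub>S\<^esub> u)" if "u \<in> carrier S" for a b u
    using that by (elim carrierE) (simp add: \<psi>_smult[symmetric] Psmult)
  show "\<one>\<^bsub>class_ring\<^esub> \<odot>\<^bsub>S\<^esub> u = u" if "u \<in> carrier S" for u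
    using that by (elim carrierE) (simp add: \<psi>_smult[symmetric])
qed

lemma \<psi>_minus: "x \<in> P \<Longrightarrow> y \<in> P \<Longrightarrow> \<psi> (x - y) = \<psi> x \<ominus>\<^bsub>S\<^esub> \<psi> y"
proof -
  assume xy: "x \<in> P" "y \<in> P"
  interpret abelian_group S by (rule abelian_group)
  have "\<psi> (x - y) \<oplus>\<^bsub>S\<^esub> \<psi> y = \<psi> x" using \<psi>_add[of "x - y" y] xy Pdiff by simp
  then show ?thesis using xy \<psi>_closed Pdiff by (metis add.inv_solve_right a_minus_def)
qed

lemma \<psi>_eq_iff: "x \<in> P \<Longrightarrow> y \<in> P \<Longrightarrow> \<psi> x = \<psi> y \<longleftrightarrow> x - y \<in> Q"
proof -
  assume xy: "x \<in> P" "y \<in> P"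
  interpret abelian_group S by (rule abelian_group)
  have "x - y \<in> Q \<longleftrightarrow> \<psi> x \<ominus>\<^bsub>S\<^esub> \<psi> y = \<zero>\<^bsub>S\<^esub>" using xy Pdiff \<psi>_zero_iff \<psi>_minus by metis
  also have "\<dots> \<longleftrightarrow> \<psi> x = \<psi> y" using xy \<psi>_closed by (simp add: minus_eq add.inv_solve_right')
  finally show ?thesis by simp
qed

lemma \<psi>_finsum: "(\<And>i. i \<in> I \<Longrightarrow> x i \<in> P) \<Longrightarrow> \<psi> (\<Sum>i\<in>I. x i) = (\<Oplus>\<^bsub>S\<^esub>i\<in>I. \<psi> (x i))"
proof (induction I rule: infinite_finite_induct)
  case (infinite I)
  interpret abelian_group S by (rule abelian_group)
  show ?case using infinite by (simp add: \<psi>_0 finsum_infinite)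
next
  case empty
  interpret abelian_group S by (rule abelian_group)
  show ?case by (simp add: \<psi>_0)
next
  case (insert i I)
  interpret abelian_group S by (rule abelian_group)
  have "(\<Sum>i\<in>I. x i) \<in> P" using insert by (intro V.subspace_sum P) auto
  then show ?case using insert \<psi>_closed by (simp add: \<psi>_add Pi_def)
qed

lemma submodule_image: "V.subspace X \<Longrightarrow> X \<subseteq> P \<Longrightarrow> LinearCombinations.submodule class_ring (\<psi> ` X) S"
proof -
  assume X: "V.subspace X" "X \<subseteq> P"
  show ?thesis
  proof (rule submodule.intro[OF module])
    show "\<psi> ` X \<subseteq> carrier S" using X(2) image by auto
    show "\<zero>\<^bsub>S\<^esub> \<in> \<psi> ` X" using V.subspace_0[OF X(1)] \<psi>_0 by force
    show "u \<oplus>\<^bsub>S\<^esub> v \<in> \<psi> ` X" if uv: "u \<in> \<psi> ` X" "v \<in> \<psi> ` X" for u v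
    proof -
      obtain x y where "x \<in> X" "y \<in> X" "u = \<psi> x" "v = \<psi> y" using uv by auto
      then have "u \<oplus>\<^bsub>S\<^esub> v = \<psi> (x + y)" "x + y \<in> X" using X by (auto simp: \<psi>_add subset_iff V.subspace_add)
      then show ?thesis by simp
    qed
    show "c \<odot>\<^bsub>S\<^esub> u \<in> \<psi> ` X" if u: "u \<in> \<psi> ` X" for c u
    proof -
      obtain x where "x \<in> X" "u = \<psi> x" using u by auto
      then have "c \<odot>\<^bsub>S\<^esub> u = \<psi> (smult c x)" "smult c x \<in> X" using X by (auto simp: \<psi>_smult subset_iff V.subspace_scale)
      then show ?thesis by simp
    qed
  qed
qed

text \<open>Together with the image under \<open>\<psi>\<close>, the correspondence between
  submodules of \<open>S\<close> and submodules of \<open>P\<close> above \<open>Q\<close>.\<close>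

definition pre :: "'m set \<Rightarrow> 'r poly set" where
  "pre N = {x \<in> P. \<psi> x \<in> N}"

lemma image_pre: "N \<subseteq> carrier S \<Longrightarrow> \<psi> ` pre N = N"
  unfolding pre_def image[symmetric] by auto

lemma pre_image: "V.subspace X \<Longrightarrow> Q \<subseteq> X \<Longrightarrow> X \<subseteq> P \<Longrightarrow> pre (\<psi> ` X) = X"
proof (intro equalityI subsetI)
  fix x assume X: "V.subspace X" "Q \<subseteq> X" "X \<subseteq> P" and "x \<in> pre (\<psi> ` X)"
  then obtain y where y: "x \<in> P" "y \<in> X" "\<psi> x = \<psi> y" by (auto simp: pre_def)
  then have "x - y \<in> X" using \<psi>_eq_iff[of x y] X by auto
  then show "x \<in> X" using V.subspace_add[OF X(1) _ y(2), of "x - y"] by simp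
qed (auto simp: pre_def)

lemma pre_submodule:
  assumes "LinearCombinations.submodule class_ring N S"
  shows "V.subspace (pre N)" "Q \<subseteq> pre N" "pre N \<subseteq> P" "\<psi> ` pre N = N"
proof -
  interpret N: LinearCombinations.submodule class_ring N S by (rule assms)
  show "V.subspace (pre N)"
    by (rule V.subspaceI) (auto simp: pre_def P0 \<psi>_0 Padd \<psi>_add Psmult \<psi>_smult)
  show "Q \<subseteq> pre N" using QP \<psi>_zero_iff by (auto simp: pre_def) (metis N.zero_closed subsetD)
  show "pre N \<subseteq> P" by (auto simp: pre_def)
  show "\<psi> ` pre N = N" by (rule image_pre[OF N.subset])
qed

lemma restrict:
  assumes "V.subspace X" "Q \<subseteq> X" "X \<subseteq> P"
  shows "presents \<psi> X Q (S\<lparr>carrier := \<psi> ` X\<rparr>)"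
  using presents assms unfolding presents_def by (auto simp: subset_iff)

end

lemma quot_map_update: "quot_map (S\<lparr>carrier := X\<rparr>) N f = quot_map S N f"
  by (simp add: quot_map_def set_add_def set_mult_def fun_eq_iff)

context presentation
begin

context
  fixes X
  assumes X: "V.subspace X" "Q \<subseteq> X" "X \<subseteq> P"
begin

definition "coset x = \<psi> ` X +>\<^bsub>S\<^esub> \<psi> x"

lemma abelian_subgroup_image: "abelian_subgroup (\<psi> ` X) S"
proof -
  interpret Module.module class_ring S by (rule module)
  have "additive_subgroup (\<psi> ` X) S"
    using submodule.m_closed[OF submodule_image[OF X(1,3)]] submodule.zero_closed[OF submodule_image[OF X(1,3)]]
      submodule.subset[OF submodule_image[OF X(1,3)]] submodule.smult_closed[OF submodule_image[OF X(1,3)], of "- 1"]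
    by (intro additive_subgroup.intro subgroup.intro)
       (auto simp: a_inv_def[symmetric] smult_minus_1[symmetric] class_ring_simps)
  then show ?thesis using abelian_group by (rule abelian_subgroupI3)
qed

lemma mem_coset: "x \<in> P \<Longrightarrow> coset x = \<psi> ` {y \<in> P. y - x \<in> X}"
proof (intro equalityI subsetI)
  fix u assume x: "x \<in> P" and "u \<in> coset x"
  then obtain z where z: "z \<in> X" "u = \<psi> z \<oplus>\<^bsub>S\<^esub> \<psi> x" by (auto simp: coset_def a_r_coset_def r_coset_def)
  then have "u = \<psi> (z + x)" "z + x \<in> P" using x X(3) by (auto simp: \<psi>_add subset_iff Padd)
  then show "u \<in> \<psi> ` {y \<in> P. y - x \<in> X}" using z by auto
next
  fix u assume x: "x \<in> P" and "u \<in> \<psi> ` {y \<in> P. y - x \<in> X}"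
  then obtain y where y: "y \<in> P" "y - x \<in> X" "u = \<psi> y" by auto
  then have "u = \<psi> (y - x) \<oplus>\<^bsub>S\<^esub> \<psi> x" using \<psi>_add[of "y - x" x] x X(3) by auto
  then show "u \<in> coset x" using y by (auto simp: coset_def a_r_coset_def r_coset_def)
qed

text \<open>One computation for both uses of \<open>quot_map\<close>: scalars, which form the module
  structure of the quotient, and the group action.\<close>

lemma quot_map_coset:
  assumes T: "V.linear_op T" "\<And>x. x \<in> P \<Longrightarrow> T x \<in> P" "\<And>x. x \<in> X \<Longrightarrow> T x \<in> X"
    and \<theta>: "\<And>x. x \<in> P \<Longrightarrow> \<theta> (\<psi> x) = \<psi> (T x)" and x: "x \<in> P"
  shows "quot_map S (\<psi> ` X) \<theta> (coset x) = coset (T x)"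
proof (intro equalityI subsetI)
  fix u assume "u \<in> quot_map S (\<psi> ` X) \<theta> (coset x)"
  then obtain z y where z: "z \<in> X" and y: "y \<in> P" "y - x \<in> X" and u: "u = \<psi> z \<oplus>\<^bsub>S\<^esub> \<theta> (\<psi> y)"
    unfolding quot_map_def mem_coset[OF x] set_add_def set_mult_def by auto
  have "u = \<psi> (z + T y)" using z y X(3) T(2) by (simp add: u \<theta> \<psi>_add subset_iff)
  moreover have "z + T y - T x = z + T (y - x)" by (simp add: V.linear_op_diff[OF T(1)])
  then have "z + T y - T x \<in> X" using V.subspace_add[OF X(1) z T(3)[OF y(2)]] by (simp only:)
  ultimately show "u \<in> coset (T x)" using z y X(3) T(2) x by (auto simp: mem_coset intro!: imageI Padd)
next
  fix u assume "u \<in> coset (T x)"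
  then obtain y where y: "y \<in> P" "y - T x \<in> X" "u = \<psi> y" using mem_coset[OF T(2)[OF x]] by auto
  have "u = \<psi> (y - T x) \<oplus>\<^bsub>S\<^esub> \<theta> (\<psi> x)" using \<psi>_add[of "y - T x" "T x"] y X(3) T(2) x by (simp add: \<theta> subset_iff)
  moreover have "\<psi> x \<in> coset x" using x V.subspace_0[OF X(1)] by (auto simp: mem_coset)
  ultimately show "u \<in> quot_map S (\<psi> ` X) \<theta> (coset x)"
    using y unfolding quot_map_def set_add_def set_mult_def by auto
qed

text \<open>The same \<open>P\<close> presents the quotient with a larger kernel: iterated quotients
  enlarge the carrier type, while the polynomial side keeps its type.\<close>

lemma presents_quotient: "presents coset P X (quot_module S (\<psi> ` X))"
proof -
  interpret abelian_subgroup "\<psi> ` X" S by (rule abelian_subgroup_image)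
  have "coset x = \<psi> ` X \<longleftrightarrow> x \<in> X" if x: "x \<in> P" for x
  proof
    assume "coset x = \<psi> ` X"
    moreover have "\<psi> x \<in> coset x" using x V.subspace_0[OF X(1)] by (auto simp: mem_coset)
    ultimately show "x \<in> X" using pre_image[OF X] x by (auto simp: pre_def)
  next
    assume "x \<in> X"
    then show "coset x = \<psi> ` X" unfolding coset_def by (intro a_rcos_const imageI)
  qed
  moreover have "coset ` P = a_rcosets\<^bsub>S\<^esub> (\<psi> ` X)"
    unfolding coset_def A_RCOSETS_def RCOSETS_def a_r_coset_def by (simp add: image[symmetric] image_image UNION_singleton_eq_range)
  moreover have "coset (x + y) = coset x <+>\<^bsub>S\<^esub> coset y" if "x \<in> P" "y \<in> P" for x y
    using that by (simp add: coset_def \<psi>_add a_rcos_sum \<psi>_closed)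
  moreover have "coset (smult c x) = quot_map S (\<psi> ` X) (\<lambda>u. c \<odot>\<^bsub>S\<^esub> u) (coset x)" if "x \<in> P" for c x
  proof (rule quot_map_coset[symmetric])
    show "V.linear_op (smult c)" by (rule linear_op_smult)
  qed (simp_all add: that Psmult \<psi>_smult V.subspace_scale[OF X(1)])
  ultimately show ?thesis
    using P X by (simp add: presents_def quot_module_def)
qed

end

end

section \<open>Free modules\<close>

lemma presents_free: "presents (\<lambda>x. vec r (coeff x)) (below_degree r) {0} (free_module r :: ('r::idom, 'r vec) module)"
  unfolding presents_def
proof (intro conjI ballI allI)
  show "V.subspace (below_degree r :: 'r poly set)" by (rule is_basis_subspace[OF is_basis_below_degree])
  then show "{0} \<subseteq> (below_degree r :: 'r poly set)" using V.subspace_0[of "below_degree r"] by simp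
  show "(\<lambda>x. vec r (coeff x)) ` below_degree r = carrier (free_module r :: ('r, 'r vec) module)"
  proof (intro equalityI subsetI)
    fix u :: "'r vec" assume "u \<in> carrier (free_module r)"
    then have "u \<in> carrier_vec r" by (simp only: module_vec_simps)
    then have u: "dim_vec u = r" by (rule carrier_vecD)
    define x where "x = (\<Sum>i<r. monom (u $ i) i)"
    have c: "coeff x i = (if i < r then u $ i else 0)" for i by (simp add: x_def coeff_sum)
    then have "x \<in> below_degree r" by (simp add: below_degree_def)
    moreover have "u = vec r (coeff x)" using u by (intro eq_vecI) (auto simp: c)
    ultimately show "u \<in> (\<lambda>x. vec r (coeff x)) ` below_degree r" by blast
  qed (auto simp: module_vec_simps)
  show "vec r (coeff x) = \<zero>\<^bsub>free_module r\<^esub> \<longleftrightarrow> x \<in> {0}" if "x \<in> below_degree r" for x :: "'r poly"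
  proof
    assume "vec r (coeff x) = \<zero>\<^bsub>free_module r\<^esub>"
    then have "coeff x i = 0" if "i < r" for i using that by (metis index_vec index_zero_vec(1) module_vec_simps(2))
    moreover have "coeff x i = 0" if "i \<ge> r" for i using that \<open>x \<in> below_degree r\<close> by (simp add: below_degree_def)
    ultimately have "coeff x i = 0" for i using not_less by blast
    then show "x \<in> {0}" by (simp add: poly_eq_iff)
  qed (auto simp: module_vec_simps)
qed (auto simp: module_vec_simps V.subspace_single_0)

locale free_presentation = presentation \<psi> "below_degree r" "{0}" A
  for \<psi> :: "'r::idom poly \<Rightarrow> 'm" and r and A
begin

lemma \<psi>_inj: "inj_on \<psi> (below_degree r)"
  using \<psi>_eq_iff by (auto intro!: inj_onI)

lemma monom_mem: "i < r \<Longrightarrow> monom a i \<in> below_degree r"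
  by (auto simp: below_degree_def)

lemma below_degree_eq_sum: "x \<in> below_degree r \<Longrightarrow> x = (\<Sum>i<r. smult (coeff x i) (monom 1 i))"
  by (intro poly_eqI) (auto simp: coeff_sum smult_monom below_degree_def)

lemma lincomb_eq:
  "LinearCombinations.module.lincomb A a ((\<lambda>i. \<psi> (monom 1 i)) ` {..<r}) =
    \<psi> (\<Sum>i<r. smult (a (\<psi> (monom 1 i))) (monom 1 i))"
proof -
  interpret Module.module class_ring A by (rule module)
  have inj: "inj_on (\<lambda>i. \<psi> (monom 1 i)) {..<r}"
    using inj_onD[OF \<psi>_inj _ monom_mem monom_mem] by (intro inj_onI) (metis lessThan_iff monom_eq_iff' one_neq_zero)
  have "lincomb a ((\<lambda>i. \<psi> (monom 1 i)) ` {..<r}) = (\<Oplus>\<^bsub>A\<^esub>i\<in>{..<r}. a (\<psi> (monom 1 i)) \<odot>\<^bsub>A\<^esub> \<psi> (monom 1 i))"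
    unfolding lincomb_def by (subst finsum_reindex[OF _ inj]) (auto simp: \<psi>_closed monom_mem)
  also have "\<dots> = (\<Oplus>\<^bsub>A\<^esub>i\<in>{..<r}. \<psi> (smult (a (\<psi> (monom 1 i))) (monom 1 i)))"
    by (intro finsum_cong') (auto simp: \<psi>_smult monom_mem \<psi>_closed Psmult)
  finally show ?thesis by (subst \<psi>_finsum) (auto intro: Psmult monom_mem)
qed

text \<open>Needed for \<open>free_module\<close>: its \<open>lin_trace\<close> refers to a chosen
  basis, and the choice is meaningful only if a basis exists.\<close>

lemma fg_free: "fg_free A"
proof -
  interpret Module.module class_ring A by (rule module)
  define B where "B = (\<lambda>i. \<psi> (monom 1 i)) ` {..<r}"
  have inj: "inj_on (\<lambda>i. \<psi> (monom 1 i)) {..<r}"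
    using inj_onD[OF \<psi>_inj _ monom_mem monom_mem] by (intro inj_onI) (metis lessThan_iff monom_eq_iff' one_neq_zero)
  have B: "finite B" "B \<subseteq> carrier A" by (auto simp: B_def \<psi>_closed monom_mem)
  have lc: "lincomb a B = \<psi> (\<Sum>i<r. smult (a (\<psi> (monom 1 i))) (monom 1 i))" for a
    unfolding B_def by (rule lincomb_eq)
  have "\<not> lin_dep B"
  proof
    assume "lin_dep B"
    then obtain A' a v where A': "finite A'" "A' \<subseteq> B" "lincomb a A' = \<zero>\<^bsub>A\<^esub>" "v \<in> A'" "a v \<noteq> 0"
      unfolding lin_dep_def by auto
    define a' where "a' u = (if u \<in> A' then a u else 0)" for u
    have "lincomb a' B = lincomb a A'"
      unfolding lincomb_def
      by (rule add.finprod_mono_neutral_cong_left[symmetric]) (use A'(2) B smult_l_null in \<open>auto simp: a'_def class_ring_simps\<close>)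
    then have "\<psi> (\<Sum>i<r. smult (a' (\<psi> (monom 1 i))) (monom 1 i)) = \<zero>\<^bsub>A\<^esub>" using A'(3) lc by simp
    moreover have "(\<Sum>i<r. smult (a' (\<psi> (monom 1 i))) (monom 1 i)) \<in> below_degree r"
      by (intro V.subspace_sum P Psmult monom_mem) simp
    ultimately have "(\<Sum>i<r. smult (a' (\<psi> (monom 1 i))) (monom 1 i)) = 0" using \<psi>_zero_iff by auto
    moreover obtain j where j: "j < r" "v = \<psi> (monom 1 j)" using A'(2,4) by (auto simp: B_def)
    ultimately have "coeff (\<Sum>i<r. smult (a' (\<psi> (monom 1 i))) (monom 1 i)) j = 0" by simp
    then have "a' v = 0" using j by (simp add: coeff_sum smult_monom)
    then show False using A' by (simp add: a'_def)
  qed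
  moreover have "span B = carrier A"
  proof (intro equalityI subsetI)
    fix u assume "u \<in> carrier A"
    then obtain x where x: "x \<in> below_degree r" "u = \<psi> x" by (rule carrierE)
    define a where "a v = coeff x (the_inv_into {..<r} (\<lambda>i. \<psi> (monom 1 i)) v)" for v
    have "(\<Sum>i<r. smult (a (\<psi> (monom 1 i))) (monom 1 i)) = x"
      using below_degree_eq_sum[OF x(1)] by (simp add: a_def the_inv_into_f_f[OF inj])
    then have "lincomb a B = u" using lc x by simp
    then show "u \<in> span B" unfolding span_def using B(1) by auto
  qed (use span_is_subset2[OF B(2)] in auto)
  ultimately show ?thesis using B unfolding fg_free_def finite_basis_def by blast
qed

end

lemma presents_basis:
  fixes A :: "('r::idom, 'm) module"
  assumes A: "Module.module class_ring A" and B: "finite_basis A B" and b: "bij_betw b {..<r} B"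
  shows "presents (\<lambda>x. \<Oplus>\<^bsub>A\<^esub>i\<in>{..<r}. coeff x i \<odot>\<^bsub>A\<^esub> b i) (below_degree r) {0} A"
proof -
  interpret Module.module class_ring A by (rule A)
  define \<psi> where "\<psi> x = (\<Oplus>\<^bsub>A\<^esub>i\<in>{..<r}. coeff x i \<odot>\<^bsub>A\<^esub> b i)" for x
  have BA: "B \<subseteq> carrier A" and fin: "finite B" and ind: "\<not> lin_dep B" and span: "span B = carrier A"
    using B by (auto simp: finite_basis_def)
  have bA: "b i \<in> carrier A" if "i < r" for i using that b BA by (auto simp: bij_betw_def)
  have sm: "c \<odot>\<^bsub>A\<^esub> b i \<in> carrier A" if "i < r" for i c using bA[OF that] by (simp add: class_ring_simps)
  have \<psi>_lin: "\<psi> x = lincomb (\<lambda>v. coeff x (the_inv_into {..<r} b v)) B" for x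
  proof -
    have inj: "inj_on b {..<r}" and im: "B = b ` {..<r}" using b by (auto simp: bij_betw_def)
    show ?thesis unfolding lincomb_def \<psi>_def im
      by (subst finsum_reindex[OF _ inj]) (auto simp: sm the_inv_into_f_f[OF inj] intro!: finsum_cong')
  qed
  show ?thesis
    unfolding presents_def \<psi>_def[symmetric]
  proof (intro conjI ballI allI)
    show L: "V.subspace (below_degree r :: 'r poly set)" by (rule is_basis_subspace[OF is_basis_below_degree])
    then show "{0} \<subseteq> (below_degree r :: 'r poly set)" using V.subspace_0[of "below_degree r"] by simp
    show "V.subspace {0 :: 'r poly}" by (rule V.subspace_single_0)
    show "\<psi> ` below_degree r = carrier A"
    proof (intro equalityI subsetI)
      fix u assume "u \<in> \<psi> ` below_degree r"
      then show "u \<in> carrier A" by (auto simp: \<psi>_def intro!: finsum_closed sm)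
    next
      fix u assume "u \<in> carrier A"
      then have "u \<in> span B" using span by simp
      from finite_in_span[OF fin BA this] obtain a where a: "lincomb a B = u" by blast
      define x where "x = (\<Sum>i<r. monom (a (b i)) i)"
      have c: "coeff x i = (if i < r then a (b i) else 0)" for i by (simp add: x_def coeff_sum)
      have inj: "inj_on b {..<r}" and im: "B = b ` {..<r}" using b by (auto simp: bij_betw_def)
      have "lincomb a B = \<psi> x" unfolding lincomb_def \<psi>_def im
        by (subst finsum_reindex[OF _ inj]) (auto simp: sm c intro!: finsum_cong')
      moreover have "x \<in> below_degree r" by (simp add: below_degree_def c)
      ultimately show "u \<in> \<psi> ` below_degree r" using a by blast
    qed
    show "\<psi> (x + y) = \<psi> x \<oplus>\<^bsub>A\<^esub> \<psi> y" for x y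
    proof -
      have "\<psi> (x + y) = (\<Oplus>\<^bsub>A\<^esub>i\<in>{..<r}. (coeff x i \<odot>\<^bsub>A\<^esub> b i) \<oplus>\<^bsub>A\<^esub> (coeff y i \<odot>\<^bsub>A\<^esub> b i))"
        unfolding \<psi>_def using smult_l_distr bA
        by (intro finsum_cong') (auto simp: class_ring_simps sm intro!: a_closed)
      then show ?thesis unfolding \<psi>_def by (subst finsum_addf[symmetric]) (auto simp: sm)
    qed
    show "\<psi> (smult c x) = c \<odot>\<^bsub>A\<^esub> \<psi> x" for c x
    proof -
      have "c \<odot>\<^bsub>A\<^esub> \<psi> x = (\<Oplus>\<^bsub>A\<^esub>i\<in>{..<r}. c \<odot>\<^bsub>A\<^esub> (coeff x i \<odot>\<^bsub>A\<^esub> b i))"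
        unfolding \<psi>_def by (rule finsum_smult) (auto simp: class_ring_simps sm)
      also have "\<dots> = \<psi> (smult c x)"
        unfolding \<psi>_def using smult_assoc1 bA by (intro finsum_cong') (auto simp: class_ring_simps sm)
      finally show ?thesis ..
    qed
    show "\<psi> x = \<zero>\<^bsub>A\<^esub> \<longleftrightarrow> x \<in> {0}" if x: "x \<in> below_degree r" for x
    proof
      assume "\<psi> x = \<zero>\<^bsub>A\<^esub>"
      then have l0: "lincomb (\<lambda>v. coeff x (the_inv_into {..<r} b v)) B = \<zero>\<^bsub>A\<^esub>" using \<psi>_lin by simp
      have "coeff x i = 0" if "i < r" for i
      proof -
        have "coeff x (the_inv_into {..<r} b (b i)) = 0"
          using ind l0 fin b that unfolding lin_dep_def by (force simp: bij_betw_def class_ring_simps)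
        then show ?thesis using b that by (simp add: bij_betw_def the_inv_into_f_f)
      qed
      moreover have "coeff x i = 0" if "i \<ge> r" for i using that x by (simp add: below_degree_def)
      ultimately have "coeff x i = 0" for i using not_less by blast
      then show "x \<in> {0}" by (simp add: poly_eq_iff)
    next
      assume "x \<in> {0}"
      then have "\<psi> x = (\<Oplus>\<^bsub>A\<^esub>i\<in>{..<r}. \<zero>\<^bsub>A\<^esub>)"
        unfolding \<psi>_def using smult_l_null bA by (intro finsum_cong') (auto simp: class_ring_simps)
      then show "\<psi> x = \<zero>\<^bsub>A\<^esub>" by simp
    qed
  qed
qed

text \<open>Operators are extended to all polynomials by the identity on the coefficients from \<open>r\<close> on.\<close>

context free_presentation
begin

definition inv\<psi> :: "'m \<Rightarrow> 'r poly" where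
  "inv\<psi> = inv_into (below_degree r) \<psi>"

definition op_of :: "('m \<Rightarrow> 'm) \<Rightarrow> 'r poly \<Rightarrow> 'r poly" where
  "op_of \<theta> x = inv\<psi> (\<theta> (\<psi> (poly_cutoff r x))) + (x - poly_cutoff r x)"

lemma cutoff_mem: "poly_cutoff r x \<in> below_degree r"
  by (simp add: below_degree_def coeff_poly_cutoff)

lemma cutoff_id: "x \<in> below_degree r \<Longrightarrow> poly_cutoff r x = x"
  by (auto simp: below_degree_def coeff_poly_cutoff poly_eq_iff)

lemma inv\<psi>_mem: "u \<in> carrier A \<Longrightarrow> inv\<psi> u \<in> below_degree r"
  unfolding inv\<psi>_def by (rule inv_into_into) (simp add: image)

lemma \<psi>_inv\<psi>: "u \<in> carrier A \<Longrightarrow> \<psi> (inv\<psi> u) = u"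
  unfolding inv\<psi>_def by (rule f_inv_into_f) (simp add: image)

lemma inv\<psi>_\<psi>: "x \<in> below_degree r \<Longrightarrow> inv\<psi> (\<psi> x) = x"
  unfolding inv\<psi>_def by (rule inv_into_f_f[OF \<psi>_inj])

lemma inv\<psi>_eqI: "x \<in> below_degree r \<Longrightarrow> \<psi> x = u \<Longrightarrow> inv\<psi> u = x"
  using inv\<psi>_\<psi> by auto

context
  fixes \<theta> assumes \<theta>: "\<theta> \<in> module_hom class_ring A A"
begin

lemma \<theta>_closed: "u \<in> carrier A \<Longrightarrow> \<theta> u \<in> carrier A"
  using \<theta> by (auto simp: module_hom_def)

lemma op_of_low: "x \<in> below_degree r \<Longrightarrow> op_of \<theta> x = inv\<psi> (\<theta> (\<psi> x))"
  by (simp add: op_of_def cutoff_id)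

lemma op_of_mem: "x \<in> below_degree r \<Longrightarrow> op_of \<theta> x \<in> below_degree r"
  by (simp add: op_of_low inv\<psi>_mem \<theta>_closed \<psi>_closed)

lemma \<psi>_op_of: "x \<in> below_degree r \<Longrightarrow> \<psi> (op_of \<theta> x) = \<theta> (\<psi> x)"
  by (simp add: op_of_low \<psi>_inv\<psi> \<theta>_closed \<psi>_closed)

lemma linear_op_of: "V.linear_op (op_of \<theta>)"
proof -
  have add: "poly_cutoff r (x + y) = poly_cutoff r x + poly_cutoff r y" for x y :: "'r poly"
    by (simp add: poly_eq_iff coeff_poly_cutoff)
  have sc: "poly_cutoff r (smult c x) = smult c (poly_cutoff r x)" for c and x :: "'r poly"
    by (simp add: poly_eq_iff coeff_poly_cutoff)
  have iadd: "inv\<psi> (\<theta> (\<psi> (x + y))) = inv\<psi> (\<theta> (\<psi> x)) + inv\<psi> (\<theta> (\<psi> y))"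
    if "x \<in> below_degree r" "y \<in> below_degree r" for x y
    using that \<theta>
    by (intro inv\<psi>_eqI) (simp_all add: inv\<psi>_mem \<theta>_closed \<psi>_closed Padd \<psi>_add \<psi>_inv\<psi> module_hom_add)
  have isc: "inv\<psi> (\<theta> (\<psi> (smult c x))) = smult c (inv\<psi> (\<theta> (\<psi> x)))" if "x \<in> below_degree r" for c x
    using that \<theta>
    by (intro inv\<psi>_eqI) (simp_all add: inv\<psi>_mem \<theta>_closed \<psi>_closed Psmult \<psi>_smult \<psi>_inv\<psi> module_hom_smult)
  show ?thesis
    unfolding V.linear_op_def op_of_def add sc iadd[OF cutoff_mem cutoff_mem] isc[OF cutoff_mem]
    by (simp add: smult_add_right smult_diff_right)
qed

end

lemma op_of_comp:
  assumes "\<theta> \<in> module_hom class_ring A A" "\<theta>' \<in> module_hom class_ring A A"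
    "\<And>u. u \<in> carrier A \<Longrightarrow> \<theta>'' u = \<theta> (\<theta>' u)"
  shows "op_of \<theta>'' x = op_of \<theta> (op_of \<theta>' x)"
proof -
  let ?y = "inv\<psi> (\<theta>' (\<psi> (poly_cutoff r x)))"
  have y: "?y \<in> below_degree r"
    using inv\<psi>_mem[OF \<theta>_closed[OF assms(2) \<psi>_closed[OF cutoff_mem]]] .
  have "poly_cutoff r (op_of \<theta>' x) = ?y"
    using y by (auto simp: op_of_def poly_eq_iff coeff_poly_cutoff below_degree_def)
  moreover have "\<theta> (\<psi> ?y) = \<theta>'' (\<psi> (poly_cutoff r x))"
    using \<psi>_inv\<psi>[OF \<theta>_closed[OF assms(2) \<psi>_closed[OF cutoff_mem]]] assms(3) \<psi>_closed[OF cutoff_mem] by simp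
  ultimately show ?thesis by (simp add: op_of_def)
qed

text \<open>Here the extension by the identity, and not by zero, matters: finite order holds on all
  polynomials, as \<open>factored_order_op\<close> demands.\<close>

lemma op_of_id: "(\<And>u. u \<in> carrier A \<Longrightarrow> \<theta> u = u) \<Longrightarrow> op_of \<theta> x = x"
  by (simp add: op_of_def \<psi>_closed cutoff_mem inv\<psi>_\<psi>)

end

text \<open>The presentation is built from the very basis that \<open>SOME\<close> selects in
  \<open>lin_trace\<close>, so the diagonal entries agree term by term.\<close>

theorem free_presentation_trace:
  fixes A :: "('r::idom, 'm) module"
  assumes A: "Module.module class_ring A" and free: "fg_free A"
  obtains r \<psi> where "free_presentation \<psi> r A"
    "\<And>\<theta>. \<theta> \<in> module_hom class_ring A A \<Longrightarrow>
      lin_trace A \<theta> = submodule_trace (below_degree r) (free_presentation.op_of \<psi> r \<theta>)"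
proof -
  define B where "B = (SOME B. finite_basis A B)"
  have B: "finite_basis A B" unfolding B_def using free by (auto simp: fg_free_def intro: someI)
  then have fin: "finite B" by (simp add: finite_basis_def)
  obtain b where b: "bij_betw b {..<card B} B"
    using ex_bij_betw_nat_finite[OF fin] by (auto simp: atLeast0LessThan)
  define r where "r = card B"
  define \<psi> where "\<psi> x = (\<Oplus>\<^bsub>A\<^esub>i\<in>{..<r}. coeff x i \<odot>\<^bsub>A\<^esub> b i)" for x
  interpret M: Module.module class_ring A by (rule A)
  interpret free_presentation \<psi> r A
    unfolding free_presentation_def presentation_def \<psi>_def r_def by (rule presents_basis[OF A B b])
  have bA: "b i \<in> carrier A" if "i < r" for i
    using that b B by (auto simp: bij_betw_def finite_basis_def r_def)
  have b_eq: "\<psi> (monom 1 j) = b j" if "j < r" for j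
  proof -
    have "\<psi> (monom 1 j) = (\<Oplus>\<^bsub>A\<^esub>i\<in>{..<r}. if j = i then b i else \<zero>\<^bsub>A\<^esub>)"
      unfolding \<psi>_def
      using bA M.smult_one M.smult_l_null by (intro M.finsum_cong') (auto simp: class_ring_simps)
    also have "\<dots> = b j" using that bA by (intro M.add.finprod_singleton) auto
    finally show ?thesis .
  qed
  have im: "B = (\<lambda>i. \<psi> (monom 1 i)) ` {..<r}" using b b_eq by (auto simp: bij_betw_def r_def)
  have coords: "coords A B u (b i) = coeff (inv\<psi> u) i" if u: "u \<in> carrier A" and i: "i < r" for u i
  proof -
    have ex: "M.lincomb a B = u \<Longrightarrow> a (b i) = coeff (inv\<psi> u) i" for a
    proof -
      assume "M.lincomb a B = u"
      then have "\<psi> (\<Sum>i<r. smult (a (\<psi> (monom 1 i))) (monom 1 i)) = u" using lincomb_eq[of a] by (simp add: im)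
      moreover have "(\<Sum>i<r. smult (a (\<psi> (monom 1 i))) (monom 1 i)) \<in> below_degree r"
        by (intro V.subspace_sum P Psmult monom_mem) simp
      ultimately have "inv\<psi> u = (\<Sum>i<r. smult (a (\<psi> (monom 1 i))) (monom 1 i))" by (intro inv\<psi>_eqI)
      then show ?thesis using i by (simp add: coeff_sum smult_monom b_eq)
    qed
    have "u \<in> M.span B" using B u by (simp add: finite_basis_def)
    from M.finite_in_span[OF fin _ this] B obtain a where "M.lincomb a B = u" by (auto simp: finite_basis_def)
    then have "M.lincomb (coords A B u) B = u" unfolding coords_def by (rule someI[of "\<lambda>a. M.lincomb a B = u"])
    then show ?thesis by (rule ex)
  qed
  have "lin_trace A \<theta> = submodule_trace (below_degree r) (op_of \<theta>)" if \<theta>: "\<theta> \<in> module_hom class_ring A A" for \<theta>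
  proof -
    have "lin_trace A \<theta> = (\<Sum>i<r. coords A B (\<theta> (b i)) (b i))"
      unfolding lin_trace_def B_def[symmetric] Let_def
      using sum.reindex_bij_betw[OF b[folded r_def], of "\<lambda>v. coords A B (\<theta> v) v"] by simp
    also have "\<dots> = (\<Sum>i<r. coeff (op_of \<theta> (monom 1 i)) i)"
      by (intro sum.cong refl) (simp add: coords \<theta>_closed[OF \<theta>] bA op_of_low[OF \<theta>] monom_mem b_eq)
    also have "\<dots> = basis_trace r (monom 1) (op_of \<theta>)"
      unfolding basis_trace_def
    proof (intro sum.cong refl)
      fix i assume i: "i \<in> {..<r}"
      let ?x = "op_of \<theta> (monom 1 i)"
      have "?x \<in> below_degree r" using i by (intro op_of_mem[OF \<theta>] monom_mem) simp
      then have "comb r (monom 1) (coord r (monom 1) ?x) = ?x" by (rule comb_coord[OF is_basis_below_degree])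
      then have "coeff ?x i = coeff (comb r (monom 1) (coord r (monom 1) ?x)) i" by simp
      then show "coeff ?x i = coord r (monom 1) ?x i" using i by (simp add: comb_def coeff_sum smult_monom)
    qed
    also have "\<dots> = submodule_trace (below_degree r) (op_of \<theta>)"
      by (rule submodule_trace_eq[OF is_basis_below_degree linear_op_of[OF \<theta>] op_of_mem[OF \<theta>], symmetric])
    finally show ?thesis .
  qed
  then show ?thesis using that free_presentation_axioms by blast
qed

section \<open>Modules over the group ring of a finite cyclic group\<close>

context module_lengths
begin

text \<open>Induction on the length: a proper stable submodule \<open>U\<close> of largest length
  leaves no stable submodule strictly between \<open>U\<close> and \<open>P\<close>.\<close>

lemma exists_maximal_chain:
  assumes "len Q P = enat n" "subspace Q" "h ` Q \<subseteq> Q" "subspace P" "h ` P \<subseteq> P" "Q \<subseteq> P"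
  shows "\<exists>k X. X 0 = Q \<and> X k = P \<and>
    (\<forall>i\<le>k. subspace (X i) \<and> h ` X i \<subseteq> X i \<and> Q \<subseteq> X i \<and> X i \<subseteq> P) \<and>
    (\<forall>i<k. X i \<subset> X (Suc i) \<and>
      (\<forall>Y. subspace Y \<longrightarrow> h ` Y \<subseteq> Y \<longrightarrow> X i \<subseteq> Y \<longrightarrow> Y \<subseteq> X (Suc i) \<longrightarrow> Y = X i \<or> Y = X (Suc i)))"
  using assms
proof (induction n arbitrary: P rule: less_induct)
  case (less n P)
  show ?case
  proof (cases "Q = P")
    case True
    then show ?thesis using less.prems by (intro exI[of _ 0] exI[of _ "\<lambda>_. Q"]) auto
  next
    case False
    define S where "S U \<longleftrightarrow> subspace U \<and> h ` U \<subseteq> U \<and> Q \<subseteq> U \<and> U \<subset> P" for U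
    have lt: "\<exists>l. len Q U = enat l \<and> l < n" if "S U" for U
    proof -
      have U: "subspace U" "Q \<subseteq> U" "U \<subset> P" using that by (auto simp: S_def)
      have "enat n = len Q U + len U P" using less.prems U len_add[of Q U P] by auto
      moreover have "1 \<le> len U P" using U less.prems by (intro len_pos) auto
      ultimately show ?thesis by (cases "len Q U"; cases "len U P") (auto simp: one_enat_def)
    qed
    have "S Q" using less.prems False by (auto simp: S_def)
    then obtain U where U: "S U" "\<And>Y. S Y \<Longrightarrow> the_enat (len Q Y) \<le> the_enat (len Q U)"
      using ex_has_greatest_nat[of S Q "\<lambda>U. the_enat (len Q U)" n] lt by (metis less_imp_le the_enat.simps)
    obtain l where l: "len Q U = enat l" "l < n" using lt[OF U(1)] by blast
    have U': "subspace U" "h ` U \<subseteq> U" "Q \<subseteq> U" "U \<subset> P" using U(1) by (auto simp: S_def)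
    obtain k X where X: "X 0 = Q" "X k = U"
      "\<And>i. i \<le> k \<Longrightarrow> subspace (X i) \<and> h ` X i \<subseteq> X i \<and> Q \<subseteq> X i \<and> X i \<subseteq> U"
      "\<And>i. i < k \<Longrightarrow> X i \<subset> X (Suc i) \<and> (\<forall>Y. subspace Y \<longrightarrow> h ` Y \<subseteq> Y \<longrightarrow> X i \<subseteq> Y \<longrightarrow> Y \<subseteq> X (Suc i) \<longrightarrow> Y = X i \<or> Y = X (Suc i))"
      using less.IH[OF l(2,1) less.prems(2,3) U'(1,2,3)] by metis
    have top: "Y = U \<or> Y = P" if Y: "subspace Y" "h ` Y \<subseteq> Y" "U \<subseteq> Y" "Y \<subseteq> P" for Y
    proof (rule disjCI)
      assume "Y \<noteq> P"
      then have SY: "S Y" using Y U' by (auto simp: S_def)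
      have eq: "len Q Y = len Q U + len U Y" using less.prems(2) U' Y by (intro len_add) auto
      show "Y = U"
      proof (rule ccontr)
        assume "Y \<noteq> U"
        then have "1 \<le> len U Y" using U' Y by (intro len_pos) auto
        then have "the_enat (len Q U) < the_enat (len Q Y)"
          using eq l(1) lt[OF SY] by (cases "len U Y") (auto simp: one_enat_def)
        then show False using U(2)[OF SY] by simp
      qed
    qed
    define X' where "X' i = (if i \<le> k then X i else P)" for i
    have step: "X' i \<subset> X' (Suc i) \<and> (\<forall>Y. subspace Y \<longrightarrow> h ` Y \<subseteq> Y \<longrightarrow> X' i \<subseteq> Y \<longrightarrow> Y \<subseteq> X' (Suc i) \<longrightarrow> Y = X' i \<or> Y = X' (Suc i))"
      if "i < Suc k" for i
    proof (cases "i = k")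
      case True
      then show ?thesis using top U' X(2) by (simp add: X'_def)
    next
      case False
      then show ?thesis using that X(4)[of i] by (simp add: X'_def)
    qed
    have "subspace (X' i) \<and> h ` X' i \<subseteq> X' i \<and> Q \<subseteq> X' i \<and> X' i \<subseteq> P" if "i \<le> Suc k" for i
    proof (cases "i \<le> k")
      case True
      then show ?thesis using X(3)[OF True] U'(4) unfolding X'_def by (simp add: subset_trans[of "X i" U P] psubset_imp_subset)
    next
      case False
      then show ?thesis using less.prems by (simp add: X'_def)
    qed
    then show ?thesis using step X(1) by (intro exI[of _ "Suc k"] exI[of _ X']) (simp add: X'_def)
  qed
qed

end

locale cyclic_action =
  fixes G :: "('g, 'b) monoid_scheme" and a :: 'g and h :: "'r::idom poly \<Rightarrow> 'r poly"
  assumes G: "group G" and fin: "finite (carrier G)" and a: "a \<in> carrier G" and h: "V.linear_op h"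
begin

abbreviation H :: "('g, 'b) monoid_scheme" where "H \<equiv> subgroup_generated G {a}"

text \<open>In a finite group inverses are natural powers, so natural iterates of one operator
  describe the whole action.\<close>

lemma carrier_H: "carrier H = {a [^]\<^bsub>G\<^esub> (k::nat) | k. True}"
  using group.generate_pow_on_finite_carrier[OF G fin a] a
  by (auto simp: carrier_subgroup_generated)

lemma a_H: "a [^]\<^bsub>G\<^esub> (k::nat) \<in> carrier H"
  by (auto simp: carrier_H)

lemma linear_pow: "V.linear_op (h ^^ k)"
  by (induction k) (auto simp: V.linear_op_def V.linear_op_add[OF h] V.linear_op_scale[OF h])

lemma pow_image: "h ` X \<subseteq> X \<Longrightarrow> x \<in> X \<Longrightarrow> (h ^^ k) x \<in> X"
  by (induction k) auto

text \<open>\<open>S\<close> with \<open>\<rho>\<close> is \<open>P / Q\<close> with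
  \<open>h\<close> as the action of the generator \<open>a\<close>; \<open>\<rho>\<close> is
  prescribed only at powers of \<open>a\<close> and on the carrier.\<close>

definition acts :: "('r poly \<Rightarrow> 'm) \<Rightarrow> 'r poly set \<Rightarrow> 'r poly set \<Rightarrow> ('r, 'm) module \<Rightarrow> ('g \<Rightarrow> 'm \<Rightarrow> 'm) \<Rightarrow> bool" where
  "acts \<psi> P Q S \<rho> \<longleftrightarrow> presents \<psi> P Q S \<and> h ` P \<subseteq> P \<and> h ` Q \<subseteq> Q \<and>
     (\<forall>k. \<forall>x\<in>P. \<rho> (a [^]\<^bsub>G\<^esub> (k::nat)) (\<psi> x) = \<psi> ((h ^^ k) x))"

context
  fixes \<psi> :: "'r poly \<Rightarrow> 'm" and P Q S \<rho>
  assumes acts: "acts \<psi> P Q S \<rho>"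
begin

interpretation presentation \<psi> P Q S
  using acts by unfold_locales (simp add: acts_def)

lemma hP: "h ` P \<subseteq> P" and hQ: "h ` Q \<subseteq> Q" and
  \<rho>_\<psi>: "x \<in> P \<Longrightarrow> \<rho> (a [^]\<^bsub>G\<^esub> (k::nat)) (\<psi> x) = \<psi> ((h ^^ k) x)"
  using acts by (auto simp: acts_def)

lemma \<rho>_\<psi>1: "x \<in> P \<Longrightarrow> \<rho> a (\<psi> x) = \<psi> (h x)"
  using \<rho>_\<psi>[of x 1] group.is_monoid[OF G] a by (simp add: monoid.nat_pow_eone)

lemma acts_group_ring_module: "group_ring_module H S \<rho>"
proof (rule group_ring_module.intro)
  show "group H" using group.group_subgroup_generated[OF G] .
  show "Module.module class_ring S" by (rule module)
  show "\<rho> x \<in> module_hom class_ring S S" if "x \<in> carrier H" for x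
  proof -
    obtain k :: nat where k: "x = a [^]\<^bsub>G\<^esub> k" using \<open>x \<in> carrier H\<close> by (auto simp: carrier_H)
    show ?thesis
      unfolding module_hom_def k
    proof (intro CollectI conjI allI impI funcsetI; (elim conjE)?)
      show "\<rho> (a [^]\<^bsub>G\<^esub> k) u \<in> carrier S" if "u \<in> carrier S" for u
        using that by (elim carrierE) (simp add: \<rho>_\<psi> \<psi>_closed pow_image[OF hP])
      show "\<rho> (a [^]\<^bsub>G\<^esub> k) (u \<oplus>\<^bsub>S\<^esub> v) = \<rho> (a [^]\<^bsub>G\<^esub> k) u \<oplus>\<^bsub>S\<^esub> \<rho> (a [^]\<^bsub>G\<^esub> k) v"
        if "u \<in> carrier S" "v \<in> carrier S" for u v
        using that by (elim carrierE)
          (simp add: \<rho>_\<psi> \<psi>_add[symmetric] Padd pow_image[OF hP] V.linear_op_add[OF linear_pow])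
      show "\<rho> (a [^]\<^bsub>G\<^esub> k) (c \<odot>\<^bsub>S\<^esub> u) = c \<odot>\<^bsub>S\<^esub> \<rho> (a [^]\<^bsub>G\<^esub> k) u" if "u \<in> carrier S" for c u
        using that by (elim carrierE)
          (simp add: \<rho>_\<psi> \<psi>_smult[symmetric] Psmult pow_image[OF hP] V.linear_op_scale[OF linear_pow])
    qed
  qed
  show "\<rho> \<one>\<^bsub>H\<^esub> u = u" if "u \<in> carrier S" for u
    using that \<rho>_\<psi>[of _ 0] by (elim carrierE) simp
  show "\<rho> (x \<otimes>\<^bsub>H\<^esub> y) u = \<rho> x (\<rho> y u)" if xy: "x \<in> carrier H" "y \<in> carrier H" and u: "u \<in> carrier S" for x y u
  proof -
    obtain k l :: nat where kl: "x = a [^]\<^bsub>G\<^esub> k" "y = a [^]\<^bsub>G\<^esub> l" using xy by (auto simp: carrier_H)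
    have "x \<otimes>\<^bsub>H\<^esub> y = a [^]\<^bsub>G\<^esub> (k + l)"
      using monoid.nat_pow_mult[OF group.is_monoid[OF G] a] by (simp add: kl)
    moreover obtain z where z: "z \<in> P" "u = \<psi> z" using u by (rule carrierE)
    ultimately show ?thesis
      using z by (simp add: \<rho>_\<psi> kl pow_image[OF hP] funpow_add)
  qed
qed

lemma acts_quotient:
  assumes X: "V.subspace X" "Q \<subseteq> X" "X \<subseteq> P" and hX: "h ` X \<subseteq> X"
  shows "acts (presentation.coset \<psi> S X) P X (quot_module S (\<psi> ` X)) (quot_act S (\<psi> ` X) \<rho>)"
  unfolding acts_def
proof (intro conjI allI ballI)
  show "presents (coset X) P X (quot_module S (\<psi> ` X))" by (rule presents_quotient[OF X])
  show "quot_act S (\<psi> ` X) \<rho> (a [^]\<^bsub>G\<^esub> k) (coset X x) = coset X ((h ^^ k) x)" if "x \<in> P" for k :: nat and x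
    by (rule quot_map_coset[OF X linear_pow pow_image[OF hP] pow_image[OF hX] \<rho>_\<psi> that])
qed (rule hP, rule hX)

lemma acts_restrict:
  assumes X: "V.subspace X" "Q \<subseteq> X" "X \<subseteq> P" and hX: "h ` X \<subseteq> X"
  shows "acts \<psi> X Q (S\<lparr>carrier := \<psi> ` X\<rparr>) \<rho>"
  unfolding acts_def using restrict[OF X] hX hQ \<rho>_\<psi> X(3) by auto

text \<open>Stability under the generator is enough, and \<open>pre\<close> supplies the submodule
  of \<open>P\<close>. This converts composition series into chains of stable submodules and
  back.\<close>

lemma submodule_iff:
  "group_ring_submodule H S \<rho> N \<longleftrightarrow>
    (\<exists>X. V.subspace X \<and> h ` X \<subseteq> X \<and> Q \<subseteq> X \<and> X \<subseteq> P \<and> N = \<psi> ` X)"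
proof
  assume N: "group_ring_submodule H S \<rho> N"
  then have sub: "LinearCombinations.submodule class_ring N S" by (simp add: group_ring_submodule_def)
  have "a \<in> carrier H" using a_H[of 1] group.is_monoid[OF G] a by (simp add: monoid.nat_pow_eone)
  then have "\<psi> (h x) \<in> N" if "x \<in> P" "\<psi> x \<in> N" for x
    using N that \<rho>_\<psi>1[OF that(1)] unfolding group_ring_submodule_def by metis
  then have "h ` pre N \<subseteq> pre N" using hP by (auto simp: pre_def)
  then show "\<exists>X. V.subspace X \<and> h ` X \<subseteq> X \<and> Q \<subseteq> X \<and> X \<subseteq> P \<and> N = \<psi> ` X"
    using pre_submodule[OF sub] by metis
next
  assume "\<exists>X. V.subspace X \<and> h ` X \<subseteq> X \<and> Q \<subseteq> X \<and> X \<subseteq> P \<and> N = \<psi> ` X"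
  then obtain X where X: "V.subspace X" "h ` X \<subseteq> X" "X \<subseteq> P" "N = \<psi> ` X" by blast
  have "\<rho> (a [^]\<^bsub>G\<^esub> k) (\<psi> x) \<in> N" if "x \<in> X" for k :: nat and x
    using that X pow_image[OF X(2)] \<rho>_\<psi>[of x k] by auto
  then show "group_ring_submodule H S \<rho> N"
    using submodule_image[OF X(1,3)] X(4) by (auto simp: group_ring_submodule_def carrier_H)
qed

lemma acts_simple:
  assumes "P \<noteq> Q" and "\<And>X. V.subspace X \<Longrightarrow> h ` X \<subseteq> X \<Longrightarrow> Q \<subseteq> X \<Longrightarrow> X \<subseteq> P \<Longrightarrow> X = Q \<or> X = P"
  shows "simple_module H S \<rho>"
proof -
  have Q0: "\<psi> ` Q = {\<zero>\<^bsub>S\<^esub>}" using \<psi>_zero_iff QP V.subspace_0[OF Q] by (auto intro!: image_eqI[of _ _ 0] simp: \<psi>_0)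
  have "carrier S \<noteq> {\<zero>\<^bsub>S\<^esub>}"
  proof
    assume "carrier S = {\<zero>\<^bsub>S\<^esub>}"
    then have "x \<in> Q" if "x \<in> P" for x using \<psi>_closed[OF that] \<psi>_zero_iff[OF that] by simp
    then show False using assms(1) QP by blast
  qed
  moreover have "N = {\<zero>\<^bsub>S\<^esub>} \<or> N = carrier S" if "group_ring_submodule H S \<rho> N" for N
  proof -
    obtain X where "V.subspace X" "h ` X \<subseteq> X" "Q \<subseteq> X" "X \<subseteq> P" and N: "N = \<psi> ` X"
      using \<open>group_ring_submodule H S \<rho> N\<close> unfolding submodule_iff by (elim exE conjE)
    then have "X = Q \<or> X = P" by (intro assms(2))
    then show ?thesis using N Q0 image by auto
  qed
  ultimately show ?thesis using acts_group_ring_module by (simp add: simple_module_def)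
qed

end

lemma acts_subquotient:
  assumes acts: "acts \<psi> P Q S \<rho>"
    and X: "V.subspace X" "h ` X \<subseteq> X" "Q \<subseteq> X" and Y: "V.subspace Y" "h ` Y \<subseteq> Y" "Y \<subseteq> P" and XY: "X \<subseteq> Y"
  shows "acts (presentation.coset \<psi> (S\<lparr>carrier := \<psi> ` Y\<rparr>) X) Y X (subquot S (\<psi> ` Y) (\<psi> ` X)) (quot_act S (\<psi> ` X) \<rho>)"
  using acts_quotient[OF acts_restrict[OF acts Y(1) _ Y(3,2)] X(1) X(3) XY X(2)] X(3) XY
  by (simp add: quot_map_update)

text \<open>A maximal stable chain from \<open>Q\<close> to \<open>P\<close> maps to a composition
  series: no stable submodule lies inside a step, which is simplicity of the subquotient.\<close>

theorem acts_finite_length: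
  assumes acts: "acts \<psi> P Q S \<rho>" and fin: "V.len Q P \<noteq> \<infinity>"
  shows "finite_length H S \<rho>"
proof -
  interpret presentation \<psi> P Q S
    using acts by unfold_locales (simp add: acts_def)
  obtain n where n: "V.len Q P = enat n" using fin by auto
  obtain k X where X: "X 0 = Q" "X k = P"
    "\<And>i. i \<le> k \<Longrightarrow> V.subspace (X i) \<and> h ` X i \<subseteq> X i \<and> Q \<subseteq> X i \<and> X i \<subseteq> P"
    "\<And>i. i < k \<Longrightarrow> X i \<subset> X (Suc i) \<and>
      (\<forall>Y. V.subspace Y \<longrightarrow> h ` Y \<subseteq> Y \<longrightarrow> X i \<subseteq> Y \<longrightarrow> Y \<subseteq> X (Suc i) \<longrightarrow> Y = X i \<or> Y = X (Suc i))"
    using V.exists_maximal_chain[OF n Q hQ[OF acts] P hP[OF acts] QP] by metis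
  have "composition_series H S \<rho> k (\<lambda>i. \<psi> ` X i)"
    unfolding composition_series_def
  proof (intro conjI allI impI)
    show "\<psi> ` X 0 = {\<zero>\<^bsub>S\<^esub>}"
      using \<psi>_zero_iff QP V.subspace_0[OF Q] by (auto intro!: image_eqI[of _ _ 0] simp: \<psi>_0 X(1))
    show "\<psi> ` X k = carrier S" by (simp add: X(2) image)
    show "group_ring_submodule H S \<rho> (\<psi> ` X i)" if "i \<le> k" for i
      unfolding submodule_iff[OF acts] using X(3)[OF that] by blast
    fix i assume i: "i < k"
    have Xi: "V.subspace (X i)" "h ` X i \<subseteq> X i" "Q \<subseteq> X i" "X i \<subseteq> P" using X(3)[of i] i by auto
    have Xs: "V.subspace (X (Suc i))" "h ` X (Suc i) \<subseteq> X (Suc i)" "Q \<subseteq> X (Suc i)" "X (Suc i) \<subseteq> P"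
      using X(3)[of "Suc i"] i by auto
    have lt: "X i \<subset> X (Suc i)" using X(4)[OF i] by blast
    have "\<psi> ` X i \<noteq> \<psi> ` X (Suc i)"
      using pre_image[OF Xi(1,3,4)] pre_image[OF Xs(1,3,4)] lt by (metis less_irrefl)
    then show "\<psi> ` X i \<subset> \<psi> ` X (Suc i)" using lt by blast
    show "simple_module H (subquot S (\<psi> ` X (Suc i)) (\<psi> ` X i)) (quot_act S (\<psi> ` X i) \<rho>)"
      using acts_simple[OF acts_subquotient[OF acts Xi(1,2,3) Xs(1,2,4)]] lt X(4)[OF i] by blast
  qed
  then show ?thesis unfolding finite_length_def using acts_group_ring_module[OF acts] by blast
qed

end

context group_ring_module
begin

lemma pow_op_of:
  assumes fp: "free_presentation \<psi> r M" and y: "y \<in> carrier G"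
  shows "(free_presentation.op_of \<psi> r (\<rho> y) ^^ k) x = free_presentation.op_of \<psi> r (\<rho> (y [^]\<^bsub>G\<^esub> k)) x"
proof (induction k arbitrary: x)
  case 0
  interpret free_presentation \<psi> r M by (rule fp)
  show ?case using act_one by (simp add: op_of_id)
next
  case (Suc k)
  interpret free_presentation \<psi> r M by (rule fp)
  have yk: "y [^]\<^bsub>G\<^esub> k \<in> carrier G" using monoid.nat_pow_closed[OF group.is_monoid[OF group] y] .
  have "(op_of (\<rho> y) ^^ Suc k) x = op_of (\<rho> (y [^]\<^bsub>G\<^esub> k)) (op_of (\<rho> y) x)"
    by (simp add: Suc.IH[symmetric] funpow_swap1)
  also have "\<dots> = op_of (\<rho> (y [^]\<^bsub>G\<^esub> Suc k)) x"
    using act_mult[OF yk y] by (intro op_of_comp[symmetric] act_linear yk y) simp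
  finally show ?case .
qed

end

lemma nat_pow_subgroup_generated: "x [^]\<^bsub>subgroup_generated G S\<^esub> (k::nat) = x [^]\<^bsub>G\<^esub> k"
  by (simp add: nat_pow_def subgroup_generated_def)

context factored_order_op
begin

text \<open>The right side mentions neither the series nor the lifts, so this is where independence
  of the choices is obtained. Each factor is treated by \<open>lift_trace\<close>, and
  \<open>sum_len_chain\<close> adds up along the series.\<close>

theorem brauer_sum:
  assumes H: "cyclic_action G y h" and y: "y [^]\<^bsub>G\<^esub> m = \<one>\<^bsub>G\<^esub>"
    and max: "(max_ideal :: 'a set) = range ((*) \<pi>)"
    and acts: "cyclic_action.acts G y h \<psi> P Q S \<rho>" and fin: "V.len Q P \<noteq> \<infinity>"
    and choice: "brauer_choice (subgroup_generated G {y}) S \<rho> n F r \<sigma>"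
  shows "(\<Sum>j<n. generic_trace (free_module (r j)) (\<sigma> j y)) =
    (\<Sum>i<s. \<kappa> i * of_nat (the_enat (V.len (E i ` Q) (E i ` P))))"
proof -
  interpret H: cyclic_action G y h by (rule H)
  interpret presentation \<psi> P Q S
    using acts by unfold_locales (simp add: H.acts_def)
  let ?H = "subgroup_generated G {y}"
  have F: "composition_series ?H S \<rho> n F" and
    lift: "\<And>j. j < n \<Longrightarrow> is_lift ?H (subquot S (F (Suc j)) (F j)) (quot_act S (F j) \<rho>) (r j) (\<sigma> j)"
    using choice by (auto simp: brauer_choice_def)
  have Fsub: "\<exists>X. V.subspace X \<and> h ` X \<subseteq> X \<and> Q \<subseteq> X \<and> X \<subseteq> P \<and> F j = \<psi> ` X" if "j \<le> n" for j
    using F that unfolding composition_series_def H.submodule_iff[OF acts] by blast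
  define X where "X j = pre (F j)" for j
  have X: "V.subspace (X j)" "h ` X j \<subseteq> X j" "Q \<subseteq> X j" "X j \<subseteq> P" "\<psi> ` X j = F j" if j: "j \<le> n" for j
  proof -
    obtain Y where Y: "V.subspace Y" "h ` Y \<subseteq> Y" "Q \<subseteq> Y" "Y \<subseteq> P" "F j = \<psi> ` Y" using Fsub[OF j] by blast
    then have "X j = Y" unfolding X_def by (simp add: pre_image)
    then show "V.subspace (X j)" "h ` X j \<subseteq> X j" "Q \<subseteq> X j" "X j \<subseteq> P" "\<psi> ` X j = F j" using Y by auto
  qed
  have X0: "X 0 = Q" using F \<psi>_zero_iff QP by (auto simp: X_def pre_def composition_series_def)
  have Xn: "X n = P" using F image by (auto simp: X_def pre_def composition_series_def)
  have XS: "X j \<subseteq> X (Suc j)" if "j < n" for j using F that by (auto simp: X_def pre_def composition_series_def)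
  have st: "stable (X j)" if "j \<le> n" for j using X(1,2)[OF that] by (simp add: stable_def)
  have "generic_trace (free_module (r j)) (\<sigma> j y) = (\<Sum>i<s. \<kappa> i * of_nat (the_enat (V.len (E i ` X j) (E i ` X (Suc j)))))"
    if j: "j < n" for j
  proof -
    have jn: "j \<le> n" "Suc j \<le> n" using j by auto
    let ?T = "subquot S (F (Suc j)) (F j)" and ?\<tau> = "quot_act S (F j) \<rho>"
    let ?A = "free_module (r j) :: ('a, 'a vec) module"
    define N where "N = max_ideal_times ?A"
    define \<chi> where "\<chi> = presentation.coset \<psi> (S\<lparr>carrier := F (Suc j)\<rparr>) (X j)"
    have \<chi>: "H.acts \<chi> (X (Suc j)) (X j) ?T ?\<tau>"
      unfolding \<chi>_def using H.acts_subquotient[OF acts X(1,2,3)[OF jn(1)] X(1,2,4)[OF jn(2)] XS[OF j]]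
      by (simp add: X(5)[OF jn(1)] X(5)[OF jn(2)])
    interpret C: presentation \<chi> "X (Suc j)" "X j" ?T
      using \<chi> by unfold_locales (simp add: H.acts_def)
    have grm: "group_ring_module ?H ?A (\<sigma> j)"
      and "group_ring_iso ?H ?T ?\<tau> (quot_module ?A N) (quot_act ?A N (\<sigma> j))"
      using lift[OF j] by (simp_all add: is_lift_def Let_def N_def)
    then obtain \<phi> where \<phi>: "\<phi> \<in> module_hom class_ring ?T (quot_module ?A N)"
      and bij: "bij_betw \<phi> (carrier ?T) (carrier (quot_module ?A N))"
      and eqv: "\<And>x u. x \<in> carrier ?H \<Longrightarrow> u \<in> carrier ?T \<Longrightarrow> \<phi> (?\<tau> x u) = quot_act ?A N (\<sigma> j) x (\<phi> u)"
      unfolding group_ring_iso_def by blast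
    interpret grm: group_ring_module ?H ?A "\<sigma> j" by (rule grm)
    \<comment> \<open>The coordinate presentation only shows that a basis exists; from here on the
      presentation \<open>\<omega>\<close> attached to the basis chosen in \<open>lin_trace\<close>
      is used.\<close>
    have "free_presentation (\<lambda>x. vec (r j) (coeff x)) (r j) ?A"
      unfolding free_presentation_def presentation_def by (rule presents_free)
    then have "fg_free ?A" by (rule free_presentation.fg_free)
    then obtain t \<omega> where fp: "free_presentation \<omega> t ?A"
      and tr: "\<And>\<theta>. \<theta> \<in> module_hom class_ring ?A ?A \<Longrightarrow>
        lin_trace ?A \<theta> = submodule_trace (below_degree t) (free_presentation.op_of \<omega> t \<theta>)"
      using free_presentation_trace[OF grm.module] by blast
    interpret W: free_presentation \<omega> t ?A by (rule fp)
    let ?L = "below_degree t :: 'a poly set"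
    define h' where "h' = W.op_of (\<sigma> j y)"
    have yH: "y \<in> carrier ?H" using H.a_H[of 1] group.is_monoid[OF H.G] H.a by (simp add: monoid.nat_pow_eone)
    have hom: "\<sigma> j y \<in> module_hom class_ring ?A ?A" by (rule grm.act_linear[OF yH])
    have h': "V.linear_op h'" unfolding h'_def by (rule W.linear_op_of[OF hom])
    have pow: "(h' ^^ k) x = W.op_of (\<sigma> j (y [^]\<^bsub>G\<^esub> k)) x" for k x
      unfolding h'_def grm.pow_op_of[OF fp yH] nat_pow_subgroup_generated ..
    have "(h' ^^ m) x = x" for x
      unfolding pow y using grm.act_one by (simp add: W.op_of_id)
    then have fo: "factored_order_op \<pi> m s w f h'" by unfold_locales (rule h')
    have hL: "h' ` ?L \<subseteq> ?L" unfolding h'_def using W.op_of_mem[OF hom] by blast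
    interpret H': cyclic_action G y h' by (rule cyclic_action.intro[OF H.G H.fin H.a h'])
    have acts': "H'.acts \<omega> ?L {0} ?A (\<sigma> j)"
      unfolding H'.acts_def
    proof (intro conjI allI ballI)
      show "presents \<omega> ?L {0} ?A" by (rule W.presents)
      show "h' ` ?L \<subseteq> ?L" by (rule hL)
      show "h' ` {0} \<subseteq> {0}" using V.linear_op_0[OF h'] by simp
      show "\<sigma> j (y [^]\<^bsub>G\<^esub> k) (\<omega> x) = \<omega> ((h' ^^ k) x)" if "x \<in> ?L" for k :: nat and x
        unfolding pow using W.\<psi>_op_of[OF grm.act_linear[OF H.a_H] that] by simp
    qed
    have pL: "V.subspace (smult \<pi> ` ?L)" "smult \<pi> ` ?L \<subseteq> ?L" "{0} \<subseteq> smult \<pi> ` ?L" "h' ` smult \<pi> ` ?L \<subseteq> smult \<pi> ` ?L"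
    proof -
      show s: "V.subspace (smult \<pi> ` ?L)" by (rule V.subspace_linear_image[OF linear_op_smult W.P])
      show "smult \<pi> ` ?L \<subseteq> ?L" using W.Psmult by blast
      show "{0} \<subseteq> smult \<pi> ` ?L" using V.subspace_0[OF s] by blast
      show "h' ` smult \<pi> ` ?L \<subseteq> smult \<pi> ` ?L" using hL by (auto simp: V.linear_op_scale[OF h'])
    qed
    have N: "N = \<omega> ` smult \<pi> ` ?L"
    proof -
      interpret M: Module.module class_ring ?A by (rule W.module)
      have set: "{a \<odot>\<^bsub>?A\<^esub> u | a u. a \<in> max_ideal \<and> u \<in> carrier ?A} = \<omega> ` smult \<pi> ` ?L"
      proof (intro equalityI subsetI)
        fix v assume "v \<in> {a \<odot>\<^bsub>?A\<^esub> u | a u. a \<in> max_ideal \<and> u \<in> carrier ?A}"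
        then obtain c u where "v = (\<pi> * c) \<odot>\<^bsub>?A\<^esub> u" "u \<in> carrier ?A" unfolding max by blast
        then obtain x where "x \<in> ?L" "v = (\<pi> * c) \<odot>\<^bsub>?A\<^esub> \<omega> x" by (metis W.carrierE)
        then have "v = \<omega> (smult \<pi> (smult c x))" "smult c x \<in> ?L" by (simp_all add: W.\<psi>_smult[symmetric] W.Psmult)
        then show "v \<in> \<omega> ` smult \<pi> ` ?L" by blast
      next
        fix v assume "v \<in> \<omega> ` smult \<pi> ` ?L"
        then obtain x where x: "x \<in> ?L" "v = \<omega> (smult \<pi> x)" by blast
        have "\<pi> \<in> max_ideal" unfolding max using rangeI[of "(*) \<pi>" 1] by simp
        then show "v \<in> {a \<odot>\<^bsub>?A\<^esub> u | a u. a \<in> max_ideal \<and> u \<in> carrier ?A}"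
          using x W.\<psi>_smult[OF x(1), of \<pi>] W.\<psi>_closed[OF x(1)] by blast
      qed
      have sub: "LinearCombinations.submodule class_ring (\<omega> ` smult \<pi> ` ?L) ?A" by (rule W.submodule_image[OF pL(1,2)])
      then have "\<omega> ` smult \<pi> ` ?L \<subseteq> carrier ?A" by (rule submodule.subset)
      then show ?thesis
        unfolding N_def max_ideal_times_def set using M.span_is_subset[OF subset_refl sub] M.in_own_span by blast
    qed
    define \<chi>' where "\<chi>' = presentation.coset \<omega> ?A (smult \<pi> ` ?L)"
    have \<chi>': "H'.acts \<chi>' ?L (smult \<pi> ` ?L) (quot_module ?A N) (quot_act ?A N (\<sigma> j))"
      unfolding \<chi>'_def N by (rule H'.acts_quotient[OF acts' pL(1,3,2,4)])
    interpret C': presentation \<chi>' ?L "smult \<pi> ` ?L" "quot_module ?A N"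
      using \<chi>' by unfold_locales (simp add: H'.acts_def)
    \<comment> \<open>The fibre product of \<open>X (Suc j)\<close> and the lattice over the
      isomorphism \<open>\<phi>\<close> of their quotients.\<close>
    define R where "R = {(x, z). x \<in> X (Suc j) \<and> z \<in> ?L \<and> \<phi> (\<chi> x) = \<chi>' z}"
    \<comment> \<open>\<open>module_hom\<close> records sums and scalar multiples, so preservation
      of zero is derived from the scalar 0.\<close>
    have \<phi>0: "\<phi> (\<chi> 0) = \<chi>' 0"
    proof -
      have "\<phi> (\<chi> 0) \<in> carrier (quot_module ?A N)" using bij C.\<psi>_closed[OF C.P0] by (auto simp: bij_betw_def)
      then obtain z where z: "z \<in> ?L" "\<phi> (\<chi> 0) = \<chi>' z" by (rule C'.carrierE)
      have "\<phi> (\<chi> (smult 0 0)) = 0 \<odot>\<^bsub>quot_module ?A N\<^esub> \<phi> (\<chi> 0)"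
        using module_hom_smult[OF \<phi> _ C.\<psi>_closed[OF C.P0], of 0] C.\<psi>_smult[OF C.P0, of 0] by simp
      also have "\<dots> = \<chi>' (smult 0 z)" by (simp only: z(2) C'.\<psi>_smult[OF z(1)])
      finally show ?thesis by simp
    qed
    have R: "V.correspondence R"
      unfolding V.correspondence_def
    proof (intro conjI allI impI)
      show "(0, 0) \<in> R" using \<phi>0 C.P0 C'.P0 by (simp add: R_def)
      show "(x + x', z + z') \<in> R" if "(x, z) \<in> R" "(x', z') \<in> R" for x z x' z'
        using that module_hom_add[OF \<phi>] by (auto simp: R_def C.Padd C'.Padd C.\<psi>_add C'.\<psi>_add C.\<psi>_closed)
      show "(smult c x, smult c z) \<in> R" if "(x, z) \<in> R" for c x z
        using that module_hom_smult[OF \<phi>] by (auto simp: R_def C.Psmult C'.Psmult C.\<psi>_smult C'.\<psi>_smult C.\<psi>_closed)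
    qed
    have dom: "Domain R = X (Suc j)"
    proof (intro equalityI subsetI)
      fix x assume x: "x \<in> X (Suc j)"
      have "\<phi> (\<chi> x) \<in> carrier (quot_module ?A N)" using bij C.\<psi>_closed[OF x] by (auto simp: bij_betw_def)
      then obtain z where "z \<in> ?L" "\<phi> (\<chi> x) = \<chi>' z" by (rule C'.carrierE)
      then show "x \<in> Domain R" using x by (auto simp: R_def)
    qed (auto simp: R_def)
    have ran: "Range R = ?L"
    proof (intro equalityI subsetI)
      fix z assume z: "z \<in> ?L"
      then have "\<chi>' z \<in> \<phi> ` carrier ?T" using bij C'.\<psi>_closed[OF z] by (auto simp: bij_betw_def)
      then obtain u where "u \<in> carrier ?T" "\<chi>' z = \<phi> u" by blast
      then obtain x where "x \<in> X (Suc j)" "\<chi>' z = \<phi> (\<chi> x)" by (metis C.carrierE)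
      then show "z \<in> Range R" using z by (auto simp: R_def)
    qed (auto simp: R_def)
    have ker: "x \<in> X j \<longleftrightarrow> z \<in> smult \<pi> ` ?L" if xz: "(x, z) \<in> R" for x z
    proof -
      have xz': "x \<in> X (Suc j)" "z \<in> ?L" "\<phi> (\<chi> x) = \<chi>' z" using xz by (auto simp: R_def)
      have "x \<in> X j \<longleftrightarrow> \<chi> x = \<chi> 0" using C.\<psi>_eq_iff[OF xz'(1) C.P0] by simp
      also have "\<dots> \<longleftrightarrow> \<phi> (\<chi> x) = \<phi> (\<chi> 0)"
        using inj_on_eq_iff[OF bij_betw_imp_inj_on[OF bij] C.\<psi>_closed[OF xz'(1)] C.\<psi>_closed[OF C.P0]] by simp
      also have "\<dots> \<longleftrightarrow> z \<in> smult \<pi> ` ?L" using C'.\<psi>_eq_iff[OF xz'(2) C'.P0] by (simp add: xz'(3) \<phi>0)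
      finally show ?thesis .
    qed
    have equiv: "(h x, h' z) \<in> R" if xz: "(x, z) \<in> R" for x z
    proof -
      have xz': "x \<in> X (Suc j)" "z \<in> ?L" "\<phi> (\<chi> x) = \<chi>' z" using xz by (auto simp: R_def)
      have "\<phi> (\<chi> (h x)) = \<phi> (?\<tau> y (\<chi> x))" using H.\<rho>_\<psi>1[OF \<chi> xz'(1)] by simp
      also have "\<dots> = quot_act ?A N (\<sigma> j) y (\<chi>' z)" using eqv[OF yH C.\<psi>_closed[OF xz'(1)]] xz'(3) by simp
      also have "\<dots> = \<chi>' (h' z)" by (rule H'.\<rho>_\<psi>1[OF \<chi>' xz'(2)])
      finally show ?thesis using xz' hL X(2)[OF jn(2)] by (auto simp: R_def)
    qed
    have "to_fract (submodule_trace ?L h') = (\<Sum>i<s. \<kappa> i * of_nat (the_enat (V.len (E i ` X j) (E i ` X (Suc j)))))"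
      by (rule lift_trace[OF st[OF jn(1)] st[OF jn(2)] XS[OF j] fo hL R dom ran ker equiv])
    then show ?thesis by (simp add: generic_trace_def tr[OF hom] h'_def)
  qed
  then have "(\<Sum>j<n. generic_trace (free_module (r j)) (\<sigma> j y)) =
      (\<Sum>j<n. \<Sum>i<s. \<kappa> i * of_nat (the_enat (V.len (E i ` X j) (E i ` X (Suc j)))))"
    by (intro sum.cong refl) simp
  also have "\<dots> = (\<Sum>i<s. \<kappa> i * of_nat (\<Sum>j<n. the_enat (V.len (E i ` X j) (E i ` X (Suc j)))))"
    by (subst sum.swap) (simp add: sum_distrib_left)
  also have "\<dots> = (\<Sum>i<s. \<kappa> i * of_nat (the_enat (V.len (E i ` Q) (E i ` P))))"
  proof (intro sum.cong refl)
    fix i assume "i \<in> {..<s}"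
    then have "(\<Sum>j<n. the_enat (V.len (E i ` X j) (E i ` X (Suc j)))) = the_enat (V.len (E i ` X 0) (E i ` X n))"
      using fin st XS by (intro sum_len_chain) (auto simp: X0 Xn)
    then show "\<kappa> i * of_nat (\<Sum>j<n. the_enat (V.len (E i ` X j) (E i ` X (Suc j)))) =
        \<kappa> i * of_nat (the_enat (V.len (E i ` Q) (E i ` P)))" by (simp add: X0 Xn)
  qed
  finally show ?thesis .
qed

end

section \<open>Discrete valuation rings of mixed characteristic\<close>

lemma Units_class_ring: "x \<in> Units (class_ring :: 'r::idom ring) \<longleftrightarrow> x dvd 1"
  unfolding Units_def by (auto simp: dvd_def mult.commute)

lemma divides_class_ring: "x divides\<^bsub>class_ring\<^esub> y \<longleftrightarrow> x dvd (y :: 'r::idom)"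
  by (auto simp: factor_def dvd_def)

lemma PIdl_class_ring: "PIdl\<^bsub>class_ring\<^esub> x = range ((*) (x :: 'r::idom))"
  by (auto simp: cgenideal_def mult.commute)

text \<open>Every irreducible element generates a maximal ideal, and there is only one. Hence its
  generator \<open>\<pi>\<close> divides every nonunit, and repeated division by it stops unless all
  powers of \<open>\<pi>\<close> divide.\<close>

lemma exists_uniformizer:
  assumes "discrete_valuation_ring TYPE('r::idom)"
  obtains \<pi> :: "'r::idom" where "dvr \<pi>" "max_ideal = range ((*) \<pi>)" "maximalideal (max_ideal :: 'r set) class_ring"
proof -
  let ?R = "class_ring :: 'r ring"
  have pd: "principal_domain ?R" and nf: "\<not> field ?R" and uniq: "\<exists>!I. maximalideal I ?R"
    using assms by (auto simp: discrete_valuation_ring_def)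
  interpret principal_domain ?R by (rule pd)
  have max: "maximalideal (max_ideal :: 'r set) ?R" unfolding max_ideal_def by (rule theI'[OF uniq])
  have irr: "\<exists>c. c \<noteq> 0 \<and> \<not> c dvd 1 \<and> c dvd x \<and> (max_ideal :: 'r set) = range ((*) c)"
    if x: "x \<noteq> 0" "\<not> x dvd 1" for x :: 'r
  proof -
    have "x \<in> carrier ?R - {\<zero>\<^bsub>?R\<^esub>}" "x \<notin> Units ?R" using x by (simp_all add: Units_class_ring)
    then obtain c where c: "c \<in> carrier ?R" "ring_irreducible\<^bsub>?R\<^esub> c" "c divides\<^bsub>?R\<^esub> x"
      by (rule exists_irreducible_divisor)
    have "maximalideal (PIdl\<^bsub>?R\<^esub> c) ?R" by (rule irreducible_imp_maximalideal[OF c(1,2)])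
    then have "max_ideal = PIdl\<^bsub>?R\<^esub> c" using uniq max by blast
    then have "max_ideal = range ((*) c)" by (simp add: PIdl_class_ring)
    moreover have "c \<noteq> 0" "c \<notin> Units ?R"
      using c(2) by (auto simp: ring_irreducible_def Divisibility.irreducible_def)
    ultimately show ?thesis using c(3) by (auto simp: divides_class_ring Units_class_ring)
  qed
  \<comment> \<open>As R is not a field there is a nonzero nonunit, hence an irreducible element to
    serve as \<open>\<pi>\<close>.\<close>
  have "Units ?R \<noteq> carrier ?R - {\<zero>\<^bsub>?R\<^esub>}" using nf cring.cring_fieldI[OF class_cring.is_cring] by blast
  moreover have "Units ?R \<subseteq> carrier ?R - {\<zero>\<^bsub>?R\<^esub>}" by (auto simp: Units_class_ring)
  ultimately obtain x0 where "x0 \<in> carrier ?R - {\<zero>\<^bsub>?R\<^esub>}" "x0 \<notin> Units ?R" by blast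
  then have x0: "x0 \<noteq> 0" "\<not> x0 dvd 1" by (simp_all add: Units_class_ring)
  obtain \<pi> where \<pi>: "\<pi> \<noteq> 0" "\<not> \<pi> dvd 1" "(max_ideal :: 'r set) = range ((*) \<pi>)" using irr[OF x0] by blast
  have nonunit: "\<pi> dvd x" if "x \<noteq> 0" "\<not> x dvd 1" for x
  proof -
    obtain c where c: "c dvd x" "(max_ideal :: 'r set) = range ((*) c)" using irr \<open>x \<noteq> 0\<close> \<open>\<not> x dvd 1\<close> by blast
    have "c \<in> range ((*) c)" by (rule range_eqI[of _ _ 1]) simp
    then have "c \<in> range ((*) \<pi>)" using c(2) \<pi>(3) by simp
    then show ?thesis using c(1) by (auto intro: dvd_trans)
  qed
  text \<open>The intersection of the ideals \<open>(\<pi>\<^sup>k)\<close> is principal and stable under division by \<open>\<pi>\<close>,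
    hence zero.\<close>
  define J where "J = {x :: 'r. \<forall>k. \<pi> ^ k dvd x}"
  have add: "group (add_monoid ?R)"
    by (rule abelian_group.a_group[OF ring.axioms(1)[OF class_ring.ring_axioms]])
  have "subgroup J (add_monoid ?R)"
  proof (rule group.subgroupI[OF add])
    show "inv\<^bsub>add_monoid ?R\<^esub> x \<in> J" if "x \<in> J" for x
    proof -
      have "inv\<^bsub>add_monoid ?R\<^esub> x = - x" by (rule group.inv_equality[OF add]) simp_all
      then show ?thesis using that by (simp add: J_def)
    qed
  qed (auto simp: J_def intro: exI[of _ 0])
  then have "ideal J ?R" by (intro idealI) (auto simp: J_def intro: class_ring.ring_axioms)
  then obtain c where J: "J = range ((*) c)" using exists_gen[of J] unfolding PIdl_class_ring by blast
  have "c \<in> J" unfolding J by (rule range_eqI[of _ _ 1]) simp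
  have "c = 0"
  proof (rule ccontr)
    assume c0: "c \<noteq> 0"
    have "\<pi> ^ 1 dvd c" using \<open>c \<in> J\<close> unfolding J_def by blast
    then obtain c' where c': "c = \<pi> * c'" by (auto elim: dvdE)
    have "\<pi> ^ k dvd c'" for k
    proof -
      have "\<pi> ^ Suc k dvd \<pi> * c'" using \<open>c \<in> J\<close> c' unfolding J_def by blast
      then show ?thesis using \<pi>(1) by simp
    qed
    then have "c' \<in> J" by (simp add: J_def)
    then obtain d where "c' = c * d" unfolding J by blast
    then have "c * 1 = c * (\<pi> * d)" using c' by (metis mult.assoc mult.commute mult_1_right)
    then have "1 = \<pi> * d" using c0 by (simp only: mult_left_cancel not_False_eq_True)
    then show False using \<pi>(2) by (metis dvd_triv_left)
  qed
  have "\<exists>u k. u dvd 1 \<and> x = u * \<pi> ^ k" if "x \<noteq> 0" for x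
  proof (rule ccontr)
    assume no: "\<not> ?thesis"
    have "\<pi> ^ k dvd x" for k
    proof (induction k)
      case (Suc k)
      then obtain y where y: "x = \<pi> ^ k * y" by (auto elim: dvdE)
      then have "y \<noteq> 0" "\<not> y dvd 1" using no that by (auto simp: mult.commute)
      then show ?case using nonunit[of y] y by (simp add: mult.commute mult_dvd_mono)
    qed simp
    then have "x \<in> J" by (simp add: J_def)
    then show False using \<open>c = 0\<close> that unfolding J by auto
  qed
  then have "dvr \<pi>" using \<pi> by unfold_locales auto
  then show ?thesis using that \<pi>(3) max by blast
qed

text \<open>Surjectivity fixes the normalization: an element of value 1 is a unit times
  \<open>\<pi> ^ j\<close>, so \<open>j * v \<pi> = 1\<close> and thus
  \<open>v \<pi> = 1\<close>.\<close>

lemma (in dvr) valuation: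
  assumes v: "surjective_valuation v"
  shows "u dvd 1 \<Longrightarrow> v (u * \<pi> ^ k) = enat k"
proof -
  have vm: "v (x * y) = v x + v y" and vi: "v x = \<infinity> \<longleftrightarrow> x = 0" for x y
    using v by (auto simp: surjective_valuation_def)
  have "v 1 = v 1 + v 1" using vm[of 1 1] by simp
  moreover have "v 1 \<noteq> \<infinity>" using vi by simp
  ultimately have v1: "v 1 = 0" by (cases "v 1") (auto simp: zero_enat_def)
  have vu: "v u = 0" if "u dvd 1" for u
  proof -
    obtain u' where "1 = u * u'" using \<open>u dvd 1\<close> by (auto elim: dvdE)
    then have "v u + v u' = 0" using vm v1 by metis
    then show ?thesis by simp
  qed
  have vp: "v (\<pi> ^ k) = of_nat k * v \<pi>" for k
    by (induction k) (simp_all add: v1 vm distrib_right)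
  obtain y where y: "v y = 1" using v unfolding surjective_valuation_def by (metis surjD)
  then have "y \<noteq> 0" using vi[of y] by (auto simp: one_enat_def)
  then obtain w j where "w dvd 1" "y = w * \<pi> ^ j" using factorization by blast
  then have "of_nat j * v \<pi> = 1" using y vm vu vp by simp
  moreover obtain q where q: "v \<pi> = enat q" using vi[of \<pi>] uniformizer_nonzero by (cases "v \<pi>") auto
  ultimately have "v \<pi> = 1" by (simp add: of_nat_eq_enat one_enat_def)
  then show "v (u * \<pi> ^ k) = enat k" if "u dvd 1" using vm vu[OF that] vp by (simp add: of_nat_eq_enat)
qed

lemma add_pow_class_ring: "add_pow (class_ring :: 'r::idom ring) (n::nat) 1 = of_nat n"
  by (induction n) (simp_all add: add_pow_def nat_pow_def add.commute)

lemma mixed_characteristic_char_0: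
  assumes "mixed_characteristic TYPE('r::idom) p" "n > 0"
  shows "of_nat n \<noteq> (0 :: 'r)"
proof
  assume n: "of_nat n = (0 :: 'r)"
  have "ring_char (class_ring :: 'r ring) = 0" using assms by (simp add: mixed_characteristic_def)
  moreover have ex: "\<exists>n::nat. n > 0 \<and> [n] \<cdot>\<^bsub>class_ring\<^esub> \<one>\<^bsub>class_ring\<^esub> = \<zero>\<^bsub>(class_ring :: 'r ring)\<^esub>"
    using n assms(2) by (intro exI[of _ n]) (simp add: add_pow_class_ring)
  ultimately show False using LeastI_ex[OF ex] by (simp add: ring_char_def split: if_splits)
qed

lemma mixed_characteristic_mem:
  assumes "mixed_characteristic TYPE('r::idom) p" "p > 0"
    and max: "maximalideal (max_ideal :: 'r set) class_ring"
  shows "of_nat p \<in> (max_ideal :: 'r set)"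
proof -
  let ?R = "class_ring :: 'r ring" and ?I = "max_ideal :: 'r set"
  interpret maximalideal ?I ?R by (rule max)
  have pow: "add_pow (?R Quot ?I) (n::nat) (?I +>\<^bsub>?R\<^esub> 1) = ?I +>\<^bsub>?R\<^esub> of_nat n" for n
  proof (induction n)
    case 0
    have "?I +>\<^bsub>?R\<^esub> 0 = ?I" using a_rcos_const[OF zero_closed] by simp
    then show ?case by (simp add: add_pow_def nat_pow_def FactRing_def)
  next
    case (Suc n)
    have "add_pow (?R Quot ?I) (Suc n) (?I +>\<^bsub>?R\<^esub> 1) = (?I +>\<^bsub>?R\<^esub> of_nat n) <+>\<^bsub>?R\<^esub> (?I +>\<^bsub>?R\<^esub> 1)"
      using Suc by (simp add: add_pow_def nat_pow_def FactRing_def)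
    then show ?case using a_rcos_sum[of "of_nat n" 1] by (simp add: add.commute)
  qed
  have c: "ring_char (?R Quot ?I) = p" using assms by (simp add: mixed_characteristic_def)
  then have ex: "\<exists>n::nat. n > 0 \<and> [n] \<cdot>\<^bsub>?R Quot ?I\<^esub> \<one>\<^bsub>?R Quot ?I\<^esub> = \<zero>\<^bsub>?R Quot ?I\<^esub>"
    using assms(2) by (auto simp: ring_char_def split: if_splits)
  have "[p] \<cdot>\<^bsub>?R Quot ?I\<^esub> \<one>\<^bsub>?R Quot ?I\<^esub> = \<zero>\<^bsub>?R Quot ?I\<^esub>"
    using LeastI_ex[OF ex] ex c by (simp add: ring_char_def)
  then have "?I +>\<^bsub>?R\<^esub> of_nat p = ?I" using pow[of p] by (simp add: FactRing_def)
  then show ?thesis using a_rcos_self[of "of_nat p"] by simp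
qed

text \<open>By Bezout, \<open>\<pi>\<close> would otherwise divide 1.\<close>

lemma (in dvr) coprime_imp_unit:
  assumes "\<pi> dvd of_nat p" "coprime p k"
  shows "of_nat k dvd (1 :: 'r)"
proof (rule not_dvd_imp_unit, rule notI)
  assume k: "\<pi> dvd of_nat k"
  obtain x y :: int where "x * int p + y * int k = 1"
    using bezout_int[of "int p" "int k"] assms(2) by (auto simp: coprime_int_iff[symmetric] simp del: coprime_int_iff)
  then have "of_int x * of_nat p + of_int y * of_nat k = (1 :: 'r)" by (metis of_int_1 of_int_add of_int_mult of_int_of_nat_eq)
  then have "\<pi> dvd 1" using assms(1) k by (metis dvd_add dvd_mult)
  then show False using uniformizer_nonunit by simp
qed

section \<open>The trace formula\<close>

text \<open>\<open>has_lifts\<close> gives existence and the common value \<open>c\<close> gives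
  uniqueness for the definite description.\<close>

lemma brauer_trace_eq:
  assumes "has_lifts H M \<rho>"
    and "\<And>n F r \<sigma>. brauer_choice H M \<rho> n F r \<sigma> \<Longrightarrow> (\<Sum>i<n. generic_trace (free_module (r i)) (\<sigma> i h)) = c"
  shows "brauer_trace v p H h M \<rho> = 1 / of_nat (the_enat (v (of_nat p))) * c"
  unfolding brauer_trace_def
proof (rule the_equality)
  obtain n F r \<sigma> where choice: "brauer_choice H M \<rho> n F r \<sigma>" using assms(1) unfolding has_lifts_def by blast
  show "\<exists>n F r \<sigma>. brauer_choice H M \<rho> n F r \<sigma> \<and>
      1 / of_nat (the_enat (v (of_nat p))) * c =
      1 / of_nat (the_enat (v (of_nat p))) * (\<Sum>i<n. generic_trace (free_module (r i)) (\<sigma> i h))"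
    using choice assms(2)[OF choice] by blast
qed (use assms(2) in auto)

theorem theorem5p7:
  fixes G :: "('g, 'b) monoid_scheme"
    and g h :: 'g
    and N p :: nat
    and v :: "'r::idom \<Rightarrow> enat"
    and A :: "('r, 'm) module"
    and \<rho> :: "'g \<Rightarrow> 'm \<Rightarrow> 'm"
  assumes "group G" and "finite (carrier G)"
    and "g \<in> carrier G" and "\<forall>x\<in>carrier G. g \<otimes>\<^bsub>G\<^esub> x = x \<otimes>\<^bsub>G\<^esub> g"
    and "N = group.ord G g"
    and "h \<in> carrier G" and "coprime (group.ord G h) N"
    and "p \<in> prime_factors N"
    and "discrete_valuation_ring TYPE('r)" and "mixed_characteristic TYPE('r) p"
    and "surjective_valuation v"
    and "group_ring_module (subgroup_generated G {g, h}) A \<rho>" and "fg_free A"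
  shows "finite_length (subgroup_generated G {h}) (tate_H0 G g A \<rho>) (tate_H0_act G g A \<rho>) \<and>
    finite_length (subgroup_generated G {h}) (tate_H1 G g A \<rho>) (tate_H1_act G g A \<rho>) \<and>
    (has_lifts (subgroup_generated G {h}) (tate_H0 G g A \<rho>) (tate_H0_act G g A \<rho>) \<and>
     has_lifts (subgroup_generated G {h}) (tate_H1 G g A \<rho>) (tate_H1_act G g A \<rho>) \<longrightarrow>
     brauer_trace v p (subgroup_generated G {h}) h (tate_H0 G g A \<rho>) (tate_H0_act G g A \<rho>) -
     brauer_trace v p (subgroup_generated G {h}) h (tate_H1 G g A \<rho>) (tate_H1_act G g A \<rho>) =
     (\<Sum>k = 1..N - 1. tate_coeff N p k * to_fract (lin_trace A (\<rho> (g [^]\<^bsub>G\<^esub> k \<otimes>\<^bsub>G\<^esub> h)))))"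
proof -
  let ?K = "subgroup_generated G {g, h}" and ?H = "subgroup_generated G {h}"
  interpret G: group G by (rule assms(1))
  interpret M: group_ring_module ?K A \<rho> by (rule assms(12))
  obtain \<pi> :: 'r where dvr: "dvr \<pi>" and max: "(max_ideal :: 'r set) = range ((*) \<pi>)"
    and maxi: "maximalideal (max_ideal :: 'r set) class_ring"
    using exists_uniformizer[OF assms(9)] by blast
  interpret dvr \<pi> by (rule dvr)
  have p: "prime p" and pN: "p dvd N" and N0: "N > 0"
    using assms(8) by (auto simp: prime_factors_dvd intro: gr0I)
  note char0 = mixed_characteristic_char_0[OF assms(10)]
  have "of_nat p \<in> (max_ideal :: 'r set)"
    by (rule mixed_characteristic_mem[OF assms(10) prime_gt_0_nat[OF p] maxi])
  then have \<pi>p: "\<pi> dvd of_nat p" unfolding max by auto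
  obtain u e where u: "u dvd 1" and pe: "of_nat p = u * \<pi> ^ e"
    using factorization char0[OF prime_gt_0_nat[OF p]] by blast
  have e: "e > 0"
  proof (rule ccontr)
    assume "\<not> e > 0"
    then have "of_nat p = u" using pe by simp
    then show False using \<pi>p u uniformizer_nonunit dvd_trans by blast
  qed
  have vp: "the_enat (v (of_nat p)) = e" unfolding pe valuation[OF assms(11) u] by simp
  define n where "n = multiplicity p N"
  \<comment> \<open>From here \<open>N'\<close> takes the place of \<open>N\<close> in the locales,
    which carry only the prime-to-\<open>p\<close> part.\<close>
  obtain N' where N': "N = p ^ n * N'" "\<not> p dvd N'"
    using multiplicity_decompose'[of N p] N0 p unfolding n_def by (metis neq0_conv not_prime_unit)
  have n: "n > 0" using pN N' by (cases n) auto
  have pN': "coprime p N'" using p N'(2) by (simp add: prime_imp_coprime)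
  have cm: "coprime p (G.ord h)" using assms(7) pN by (metis coprime_commute coprime_divisors dvd_refl)
  obtain w' where w': "w' * of_nat N' = (1 :: 'r)"
    using coprime_imp_unit[OF \<pi>p pN'] by (metis dvdE mult.commute)
  obtain w where w: "w * of_nat (G.ord h) = (1 :: 'r)"
    using coprime_imp_unit[OF \<pi>p cm] by (metis dvdE mult.commute)
  have m0: "G.ord h > 0" using w by (cases "G.ord h") auto
  have "lead_coeff (monom 1 (G.ord h) - 1 :: 'r poly) = 1"
  proof -
    have "degree (- 1 + monom 1 (G.ord h) :: 'r poly) = G.ord h"
      using m0 by (subst degree_add_eq_right) (auto simp: degree_monom_eq)
    then show ?thesis using m0 by simp
  qed
  from monic_factorization[OF this] obtain fs :: "'r poly list" where
    fs: "monom 1 (G.ord h) - 1 = prod_list fs" "\<forall>f\<in>set fs. lead_coeff f = 1 \<and> irreducible (fract_poly f)" by metis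
  obtain r \<psi> where fp: "free_presentation \<psi> r A" and
    tr: "\<And>\<theta>. \<theta> \<in> module_hom class_ring A A \<Longrightarrow>
      lin_trace A \<theta> = submodule_trace (below_degree r) (free_presentation.op_of \<psi> r \<theta>)"
    using free_presentation_trace[OF M.module assms(13)] by blast
  interpret P: free_presentation \<psi> r A by (rule fp)
  define gop where "gop = P.op_of (\<rho> g)"
  define hop where "hop = P.op_of (\<rho> h)"
  have gK: "g \<in> carrier ?K" and hK: "h \<in> carrier ?K"
    using assms(3,6) by (auto simp: carrier_subgroup_generated intro: generate.incl)
  have pow_K: "y [^]\<^bsub>G\<^esub> (k::nat) \<in> carrier ?K" if "y \<in> carrier ?K" for y k
    using monoid.nat_pow_closed[OF group.is_monoid[OF M.group] that, of k] by (simp add: nat_pow_subgroup_generated)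
  have gpow: "(gop ^^ k) x = P.op_of (\<rho> (g [^]\<^bsub>G\<^esub> k)) x" for k x
    unfolding gop_def M.pow_op_of[OF fp gK] nat_pow_subgroup_generated ..
  have hpow: "(hop ^^ k) x = P.op_of (\<rho> (h [^]\<^bsub>G\<^esub> k)) x" for k x
    unfolding hop_def M.pow_op_of[OF fp hK] nat_pow_subgroup_generated ..
  have one: "P.op_of (\<rho> \<one>\<^bsub>G\<^esub>) x = x" for x
    using M.act_one by (intro P.op_of_id) simp
  \<comment> \<open>\<open>T.L\<close> models all of \<open>A\<close>, and \<open>gop\<close>,
    \<open>hop\<close> transport the actions of \<open>g\<close> and \<open>h\<close>; they commute
    because \<open>g\<close> is central.\<close>
  interpret T: tate_lattice \<pi> "G.ord h" "length fs" w "(!) fs" hop p n N' e r u w' gop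
  proof unfold_locales
    show "(\<Prod>i<length fs. fs ! i) = monom 1 (G.ord h) - 1"
      unfolding fs(1) by (simp add: prod.list_conv_set_nth atLeast0LessThan)
    show "lead_coeff (fs ! i) = 1" "irreducible (fract_poly (fs ! i))" if "i < length fs" for i
      using fs(2) that by auto
    show "V.linear_op hop" unfolding hop_def by (rule P.linear_op_of[OF M.act_linear[OF hK]])
    show "V.linear_op gop" unfolding gop_def by (rule P.linear_op_of[OF M.act_linear[OF gK]])
    show "(hop ^^ G.ord h) x = x" for x unfolding hpow using one G.pow_ord_eq_1[OF assms(6)] by simp
    show "(gop ^^ (p ^ n * N')) x = x" for x
      unfolding gpow N'(1)[symmetric] assms(5) using one G.pow_ord_eq_1[OF assms(3)] by simp
    show "gop x \<in> below_degree r" if "x \<in> below_degree r" for x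
      unfolding gop_def by (rule P.op_of_mem[OF M.act_linear[OF gK] that])
    show "hop x \<in> below_degree r" if "x \<in> below_degree r" for x
      unfolding hop_def by (rule P.op_of_mem[OF M.act_linear[OF hK] that])
    show "gop (hop x) = hop (gop x)" for x
    proof -
      have "gop (hop x) = P.op_of (\<rho> (g \<otimes>\<^bsub>G\<^esub> h)) x"
        unfolding gop_def hop_def using M.act_mult[OF gK hK] by (intro P.op_of_comp[symmetric] M.act_linear gK hK) simp
      moreover have "hop (gop x) = P.op_of (\<rho> (h \<otimes>\<^bsub>G\<^esub> g)) x"
        unfolding gop_def hop_def using M.act_mult[OF hK gK] by (intro P.op_of_comp[symmetric] M.act_linear gK hK) simp
      ultimately show ?thesis using assms(4,6) by simp
    qed
  qed (use w u w' p pe e n pN' char0 in auto)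
  interpret H: cyclic_action G h hop
    by (rule cyclic_action.intro[OF assms(1,2,6) T.h])
  have acts: "H.acts \<psi> T.L {0} A \<rho>"
    unfolding H.acts_def
  proof (intro conjI allI ballI)
    show "presents \<psi> T.L {0} A" by (rule P.presents)
    show "hop ` T.L \<subseteq> T.L" using T.hL by blast
    show "hop ` {0} \<subseteq> {0}" using V.linear_op_0[OF T.h] by simp
    show "\<rho> (h [^]\<^bsub>G\<^esub> k) (\<psi> x) = \<psi> ((hop ^^ k) x)" if "x \<in> T.L" for k :: nat and x
      unfolding hpow using P.\<psi>_op_of[OF M.act_linear[OF pow_K[OF hK]] that] by simp
  qed
  have norm: "tate_norm G g A \<rho> (\<psi> x) = \<psi> (T.Norm x)" if x: "x \<in> T.L" for x
  proof -
    interpret AG: abelian_group A by (rule P.abelian_group)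
    have eq: "\<rho> (g [^]\<^bsub>G\<^esub> i) (\<psi> x) = \<psi> ((gop ^^ i) x)" for i :: nat
      unfolding gpow using P.\<psi>_op_of[OF M.act_linear[OF pow_K[OF gK]] x] by simp
    have "\<psi> (T.Norm x) = (\<Oplus>\<^bsub>A\<^esub>i\<in>{..<N}. \<psi> ((gop ^^ i) x))"
      unfolding T.Norm_def N'(1)[symmetric] by (rule P.\<psi>_finsum) (rule T.gC_pow[OF x])
    then show ?thesis by (simp add: tate_norm_def eq assms(5))
  qed
  have diff: "tate_diff g A \<rho> (\<psi> x) = \<psi> (T.D x)" if x: "x \<in> T.L" for x
    unfolding tate_diff_def T.D_def P.\<psi>_minus[OF T.gL[OF x] x]
    using P.\<psi>_op_of[OF M.act_linear[OF gK] x] by (simp add: gop_def)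
  \<comment> \<open>The exponent in \<open>T.F 0\<close> is \<open>p ^ 0 = 1\<close>, so it is the
    kernel of \<open>T.D\<close>.\<close>
  have F0: "T.F 0 = {x \<in> T.L. T.D x = 0}" by (simp add: T.F_def T.D_def)
  have im0: "map_im A (tate_norm G g A \<rho>) = \<psi> ` T.Norm ` T.L"
    unfolding P.image[symmetric] image_image by (intro image_cong refl norm)
  have im1: "map_im A (tate_diff g A \<rho>) = \<psi> ` T.D ` T.L"
    unfolding P.image[symmetric] image_image by (intro image_cong refl diff)
  have ker0: "map_ker A (tate_diff g A \<rho>) = \<psi> ` T.F 0"
    unfolding a_kernel_def' F0 P.image[symmetric] using diff P.\<psi>_zero_iff P.\<psi>_0 T.DC by auto
  have ker1: "map_ker A (tate_norm G g A \<rho>) = \<psi> ` T.B"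
    unfolding a_kernel_def' T.B_def P.image[symmetric] using norm P.\<psi>_zero_iff P.\<psi>_0 T.NormC by auto
  \<comment> \<open>\<open>A\<close> itself is presented with kernel \<open>{0}\<close>; this is the
    condition that submodules lie above the kernel.\<close>
  have zero: "{0} \<subseteq> X" if "V.subspace X" for X :: "'r poly set" using V.subspace_0[OF that] by simp
  have BL: "T.B \<subseteq> T.L" by (auto simp: T.B_def)
  note st = T.stableD(1)
  have sth: "hop ` X \<subseteq> X" if "T.stable X" for X using T.stableD(2)[OF that] by blast
  have acts0: "\<exists>\<chi>. H.acts \<chi> (T.F 0) (T.Norm ` T.L) (tate_H0 G g A \<rho>) (tate_H0_act G g A \<rho>)"
    unfolding tate_H0_def tate_H0_act_def ker0 im0
    using H.acts_subquotient[OF acts st[OF T.stable_Norm_L] sth[OF T.stable_Norm_L] zero[OF st[OF T.stable_Norm_L]]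
        st[OF T.stable_F] sth[OF T.stable_F] T.F_subset T.Norm_mem_F0] by blast
  have acts1: "\<exists>\<chi>. H.acts \<chi> T.B (T.D ` T.L) (tate_H1 G g A \<rho>) (tate_H1_act G g A \<rho>)"
    unfolding tate_H1_def tate_H1_act_def ker1 im1
    using H.acts_subquotient[OF acts st[OF T.stable_D_L] sth[OF T.stable_D_L] zero[OF st[OF T.stable_D_L]]
        st[OF T.stable_B] sth[OF T.stable_B] BL T.D_mem_B] by blast
  obtain \<chi>0 where \<chi>0: "H.acts \<chi>0 (T.F 0) (T.Norm ` T.L) (tate_H0 G g A \<rho>) (tate_H0_act G g A \<rho>)"
    using acts0 by blast
  obtain \<chi>1 where \<chi>1: "H.acts \<chi>1 T.B (T.D ` T.L) (tate_H1 G g A \<rho>) (tate_H1_act G g A \<rho>)"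
    using acts1 by blast
  have fl: "finite_length ?H (tate_H0 G g A \<rho>) (tate_H0_act G g A \<rho>)"
    "finite_length ?H (tate_H1 G g A \<rho>) (tate_H1_act G g A \<rho>)"
    using H.acts_finite_length[OF \<chi>0 T.len_H0_finite] H.acts_finite_length[OF \<chi>1 T.len_H1_finite] by auto
  note sum = T.brauer_sum[OF H.cyclic_action_axioms G.pow_ord_eq_1[OF assms(6)] max]
  have "brauer_trace v p ?H h (tate_H0 G g A \<rho>) (tate_H0_act G g A \<rho>) -
      brauer_trace v p ?H h (tate_H1 G g A \<rho>) (tate_H1_act G g A \<rho>) =
      (\<Sum>k = 1..N - 1. tate_coeff N p k * to_fract (lin_trace A (\<rho> (g [^]\<^bsub>G\<^esub> k \<otimes>\<^bsub>G\<^esub> h))))"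
    if lifts: "has_lifts ?H (tate_H0 G g A \<rho>) (tate_H0_act G g A \<rho>)"
      "has_lifts ?H (tate_H1 G g A \<rho>) (tate_H1_act G g A \<rho>)"
  proof -
    have b0: "brauer_trace v p ?H h (tate_H0 G g A \<rho>) (tate_H0_act G g A \<rho>) =
        1 / of_nat e * (\<Sum>i<length fs. T.\<kappa> i * of_nat (T.multiplicity0 i))"
      unfolding T.multiplicity0_def vp[symmetric]
      by (rule brauer_trace_eq[OF lifts(1)]) (rule sum[OF \<chi>0 T.len_H0_finite])
    have b1: "brauer_trace v p ?H h (tate_H1 G g A \<rho>) (tate_H1_act G g A \<rho>) =
        1 / of_nat e * (\<Sum>i<length fs. T.\<kappa> i * of_nat (T.multiplicity1 i))"
      unfolding T.multiplicity1_def vp[symmetric]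
      by (rule brauer_trace_eq[OF lifts(2)]) (rule sum[OF \<chi>1 T.len_H1_finite])
    have trace: "submodule_trace T.L (\<lambda>x. (gop ^^ k) (hop x)) = lin_trace A (\<rho> (g [^]\<^bsub>G\<^esub> k \<otimes>\<^bsub>G\<^esub> h))" for k
    proof -
      have gkh: "g [^]\<^bsub>G\<^esub> k \<otimes>\<^bsub>G\<^esub> h \<in> carrier ?K"
        using monoid.m_closed[OF group.is_monoid[OF M.group] pow_K[OF gK] hK] by simp
      have "(\<lambda>x. (gop ^^ k) (hop x)) = P.op_of (\<rho> (g [^]\<^bsub>G\<^esub> k \<otimes>\<^bsub>G\<^esub> h))"
        unfolding gpow hop_def using M.act_mult[OF pow_K[OF gK] hK]
        by (intro ext P.op_of_comp[symmetric] M.act_linear pow_K gK hK) simp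
      then show ?thesis using tr[OF M.act_linear[OF gkh]] by simp
    qed
    show ?thesis
      unfolding b0 b1 right_diff_distrib[symmetric] T.tate_trace_formula N'(1)[symmetric] trace ..
  qed
  then show ?thesis using fl by blast
qed

end
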